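(* Let $\gamma>1$. For $r\in\mathbb{R}$, the $\mu_r$-high-frequency limit norm of the Leray transform $\mathbf{L}$ of $M_\gamma$ is $$\|\mathbf{L}\|_{L^2_{HF}(M_\gamma,\mu_r)}:=\limsup_{k\to\infty}\|\mathbf{L}_k\|_{L^2(M_\gamma,\mu_r)}=\sqrt{\frac{\gamma}{2\sqrt{\gamma-1}}}.$$
   Context: For $\gamma>1$ let $M_\gamma=\{(\zeta_1,\zeta_2)\in\mathbb{C}^2:\operatorname{Im}\zeta_2=|\zeta_1|^\gamma\}$, parametrized up to a null set by $(s,\alpha,\theta)\in\mathbb{R}\times(0,\infty)\times[0,2\pi)$ via $\zeta=(\alpha e^{i\theta},\,s+i\alpha^\gamma)$. For $r\in\mathbb{R}$, $\mu_r$ is the measure $\alpha^{r}\,ds\,d\alpha\,d\theta$ on $M_\gamma$. Each $f\in L^2(M_\gamma,\mu_r)$ has a partial Fourier expansion $f=\sum_{k\in\mathbb{Z}}f_k(s,\alpha)e^{ik\theta}$, and $L^2_k(M_\gamma,\mu_r)$ denotes the closed subspace of functions of the form $f_k(s,\alpha)e^{ik\theta}$. The Leray transform of $M_\gamma$ is formally $$\mathbf{L}f(z)=\frac{\gamma^2}{8\pi^2 i}\int_{M_\gamma}f(\zeta)\frac{|\zeta_1|^{\gamma-2}\,d\zeta_2\wedge d\bar\zeta_1\wedge d\zeta_1}{[\gamma\bar\zeta_1|\zeta_1|^{\gamma-2}(\zeta_1-z_1)+i(\zeta_2-z_2)]^2};$$ it decomposes as $\mathbf{L}=\bigoplus_{k\ge0}\mathbf{L}_k$,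 where for $z=(\alpha_ze^{i\theta_z},s_z+i\alpha_z^\gamma)\in M_\gamma$, with $A=(\gamma-1)\alpha_\zeta^\gamma+\alpha_z^\gamma+i(s_\zeta-s_z)$ and $B=\gamma\alpha_z\alpha_\zeta^{\gamma-1}$, $$\mathbf{L}_kf(s_z,\alpha_z,\theta_z)=e^{ik\theta_z}\,\frac{\gamma^2(k+1)}{2\pi}\int_0^\infty\!\int_{-\infty}^\infty\frac{B^k}{A^{k+2}}f_k(s_\zeta,\alpha_\zeta)\,\alpha_\zeta^{\gamma-1}\,ds_\zeta\,d\alpha_\zeta .$$ $\|\mathbf{L}_k\|_{L^2(M_\gamma,\mu_r)}$ is the operator norm of $\mathbf{L}_k$ on $L^2_k(M_\gamma,\mu_r)$ (computed on the dense subspace of bounded functions with compact support in $M_\gamma\setminus\{\zeta_1=0\}$; it may be infinite for finitely many $k$, which does not affect the limsup). *)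

theory Defs
  imports "HOL-Analysis.Analysis"
begin

definition leray_M :: "real \<Rightarrow> (complex \<times> complex) set" where
  "leray_M \<gamma> = {\<zeta>. Im (snd \<zeta>) = cmod (fst \<zeta>) powr \<gamma>}"

definition leray_param :: "real \<Rightarrow> real \<times> real \<times> real \<Rightarrow> complex \<times> complex" where
  "leray_param \<gamma> = (\<lambda>(s, \<alpha>, \<theta>). (of_real \<alpha> * cis \<theta>, Complex s (\<alpha> powr \<gamma>)))"

definition leray_mu :: "real \<Rightarrow> real \<Rightarrow> (complex \<times> complex) measure" where
  "leray_mu \<gamma> r =
     distr
       (density (restrict_space lborel (UNIV \<times> {0<..} \<times> {0..<2 * pi}))
          (\<lambda>(s, \<alpha>, \<theta>). ennreal (\<alpha> powr r)))
       (restrict_space borel (leray_M \<gamma>))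
       (leray_param \<gamma>)"

text \<open>\<^const>\<open>distr\<close> is meaningful only for a measurable map.\<close>

lemma leray_param_in_M: "\<alpha> > 0 \<Longrightarrow> leray_param \<gamma> (s, \<alpha>, \<theta>) \<in> leray_M \<gamma>"
  by (simp add: leray_param_def leray_M_def norm_mult)

lemma leray_param_measurable:
  "leray_param \<gamma> \<in>
     density (restrict_space lborel (UNIV \<times> {0<..} \<times> {0..<2 * pi}))
       (\<lambda>(s, \<alpha>, \<theta>). ennreal (\<alpha> powr r))
     \<rightarrow>\<^sub>M restrict_space borel (leray_M \<gamma>)"
proof -
  have cont: "continuous_on UNIV cis"
    by (simp add: continuous_on_cis)
  have [measurable]: "cis \<in> borel_measurable borel"
    by (rule borel_measurable_continuous_onI[OF cont])
  have "(\<lambda>p::real \<times> real \<times> real.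
          (of_real (fst (snd p)) * cis (snd (snd p)),
           of_real (fst p) + \<i> * of_real (fst (snd p) powr \<gamma>)))
        \<in> borel_measurable borel"
    unfolding borel_prod[symmetric] by measurable
  also have "(\<lambda>p::real \<times> real \<times> real.
          (of_real (fst (snd p)) * cis (snd (snd p)),
           of_real (fst p) + \<i> * of_real (fst (snd p) powr \<gamma>))) = leray_param \<gamma>"
    by (auto simp: leray_param_def fun_eq_iff complex_eq_iff)
  finally have *: "leray_param \<gamma> \<in> borel_measurable borel" .
  show ?thesis
  proof (rule measurable_restrict_space2)
    show "leray_param \<gamma> \<in>
        space (density (restrict_space lborel (UNIV \<times> {0<..} \<times> {0..<2 * pi}))
          (\<lambda>(s, \<alpha>, \<theta>). ennreal (\<alpha> powr r))) \<rightarrow> leray_M \<gamma>"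
      by (auto simp: space_restrict_space leray_param_in_M)
    show "leray_param \<gamma> \<in> borel_measurable
        (density (restrict_space lborel (UNIV \<times> {0<..} \<times> {0..<2 * pi}))
          (\<lambda>(s, \<alpha>, \<theta>). ennreal (\<alpha> powr r)))"
      using measurable_restrict_space1[of "leray_param \<gamma>" lborel borel] * by simp
  qed
qed

definition L2_norm :: "'a measure \<Rightarrow> ('a \<Rightarrow> complex) \<Rightarrow> ennreal" where
  "L2_norm M f =
     (let I = \<integral>\<^sup>+ x. ennreal ((cmod (f x))\<^sup>2) \<partial>M
      in if I = top then top else ennreal (sqrt (enn2real I)))"

definition L2_space :: "'a measure \<Rightarrow> ('a \<Rightarrow> complex) set" where
  "L2_space M = {f \<in> borel_measurable M. L2_norm M f < top}"

definition fourier_coeff ::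
    "real \<Rightarrow> int \<Rightarrow> (complex \<times> complex \<Rightarrow> complex) \<Rightarrow> real \<Rightarrow> real \<Rightarrow> complex" where
  "fourier_coeff \<gamma> k f s \<alpha> =
     of_real (1 / (2 * pi)) *
     (LINT \<theta>:{0..<2 * pi}|lborel. f (leray_param \<gamma> (s, \<alpha>, \<theta>)) * cis (- (of_int k * \<theta>)))"

text \<open>At a point \<open>\<zeta>\<close> of the hypersurface the coordinates are \<open>s = Re \<zeta>\<^sub>2\<close>, \<open>\<alpha> = |\<zeta>\<^sub>1|\<close> and
  \<open>\<theta> = Arg \<zeta>\<^sub>1\<close>; since \<open>k\<close> is an integer, the branch of the argument plays no role in
  \<open>cis (k * Arg \<zeta>\<^sub>1)\<close>.\<close>

definition L2k_space ::
    "real \<Rightarrow> real \<Rightarrow> int \<Rightarrow> (complex \<times> complex \<Rightarrow> complex) set" where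
  "L2k_space \<gamma> r k =
     {f \<in> L2_space (leray_mu \<gamma> r).
        AE \<zeta> in leray_mu \<gamma> r.
          f \<zeta> = fourier_coeff \<gamma> k f (Re (snd \<zeta>)) (cmod (fst \<zeta>)) * cis (of_int k * Arg (fst \<zeta>))}"

definition L2k_core ::
    "real \<Rightarrow> real \<Rightarrow> int \<Rightarrow> (complex \<times> complex \<Rightarrow> complex) set" where
  "L2k_core \<gamma> r k =
     {f \<in> L2k_space \<gamma> r k.
        bounded (f ` leray_M \<gamma>) \<and>
        (\<exists>K. compact K \<and> K \<subseteq> {\<zeta> \<in> leray_M \<gamma>. fst \<zeta> \<noteq> 0} \<and>
             (\<forall>\<zeta> \<in> leray_M \<gamma> - K. f \<zeta> = 0))}"

text \<open>
  The Leray transform of the hypersurface is formally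
  \[ Lf(z) = \frac{\gamma^2}{8\pi^2 i}\int f(\zeta)
     \frac{|\zeta_1|^{\gamma-2}\,d\zeta_2\wedge d\bar\zeta_1\wedge d\zeta_1}
          {[\gamma\bar\zeta_1|\zeta_1|^{\gamma-2}(\zeta_1-z_1)+i(\zeta_2-z_2)]^2}. \]
  In coordinates the bracket is \<open>A - B * cis (\<theta>\<^sub>z - \<theta>\<^sub>\<zeta>)\<close> with \<open>A\<close>, \<open>B\<close> as below.  Expanding
  \<open>1 / (A - B * cis (\<theta>\<^sub>z - \<theta>\<^sub>\<zeta>))\<^sup>2\<close> as the series of \<open>(k + 1) * B^k / A^(k + 2) * cis (k * (\<theta>\<^sub>z - \<theta>\<^sub>\<zeta>))\<close>
  over \<open>k \<ge> 0\<close> and integrating in \<open>\<theta>\<^sub>\<zeta>\<close> gives the components \<open>leray_k \<gamma> k\<close>, with the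
  components for negative frequencies vanishing.
\<close>

definition leray_A :: "real \<Rightarrow> real \<Rightarrow> real \<Rightarrow> real \<Rightarrow> real \<Rightarrow> complex" where
  "leray_A \<gamma> sz \<alpha>z s\<zeta> \<alpha>\<zeta> = Complex ((\<gamma> - 1) * \<alpha>\<zeta> powr \<gamma> + \<alpha>z powr \<gamma>) (s\<zeta> - sz)"

definition leray_B :: "real \<Rightarrow> real \<Rightarrow> real \<Rightarrow> real" where
  "leray_B \<gamma> \<alpha>z \<alpha>\<zeta> = \<gamma> * \<alpha>z * \<alpha>\<zeta> powr (\<gamma> - 1)"

definition leray_k ::
    "real \<Rightarrow> nat \<Rightarrow> (complex \<times> complex \<Rightarrow> complex) \<Rightarrow> complex \<times> complex \<Rightarrow> complex" where
  "leray_k \<gamma> k f z =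
     (let sz = Re (snd z); \<alpha>z = cmod (fst z) in
      cis (real k * Arg (fst z)) * of_real (\<gamma>\<^sup>2 * (real k + 1) / (2 * pi)) *
      (LINT \<alpha>\<zeta>:{0<..}|lborel. LINT s\<zeta>|lborel.
         of_real (leray_B \<gamma> \<alpha>z \<alpha>\<zeta>) ^ k / leray_A \<gamma> sz \<alpha>z s\<zeta> \<alpha>\<zeta> ^ (k + 2) *
         fourier_coeff \<gamma> (int k) f s\<zeta> \<alpha>\<zeta> * of_real (\<alpha>\<zeta> powr (\<gamma> - 1))))"

text \<open>The operator norm takes values in \<^typ>\<open>ennreal\<close>, so that an unbounded operator has
  norm \<open>top\<close>.\<close>

definition leray_k_norm :: "real \<Rightarrow> real \<Rightarrow> nat \<Rightarrow> ennreal" where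
  "leray_k_norm \<gamma> r k =
     (SUP f \<in> {f \<in> L2k_core \<gamma> r (int k). L2_norm (leray_mu \<gamma> r) f \<noteq> 0}.
        L2_norm (leray_mu \<gamma> r) (leray_k \<gamma> k f) / L2_norm (leray_mu \<gamma> r) f)"

definition leray_HF_norm :: "real \<Rightarrow> real \<Rightarrow> ennreal" where
  "leray_HF_norm \<gamma> r = limsup (\<lambda>k. leray_k_norm \<gamma> r k)"

end

theory Submission
  imports Defs "HOL-Probability.Probability" "HOL-Real_Asymp.Real_Asymp"
begin

text \<open>
  Each component \<open>leray_k \<gamma> k\<close> is a convolution in the variable \<open>s\<close>, and the Laplace integral
  \<open>(k + 1)! / A^(k + 2) = \<integral> t^(k + 1) exp (- t A) dt\<close> over \<open>t > 0\<close> separates its frequencies.  Since the real part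
  of \<open>A\<close> is a function of \<open>\<alpha>\<^sub>z\<close> plus a function of \<open>\<alpha>\<^sub>\<zeta>\<close>, the operator at frequency \<open>t\<close> in \<open>s\<close> has rank
  one: up to a constant it sends \<open>g\<close> to \<open>t^(k + 1) \<langle>v\<^sub>t, g\<rangle> u\<^sub>t\<close> with
    \<open>u\<^sub>t(\<alpha>) = \<alpha>^k exp (- t \<alpha>^\<gamma>)\<close> and
    \<open>v\<^sub>t(\<alpha>) = \<alpha>^((\<gamma> - 1) (k + 1) - r) exp (- t (\<gamma> - 1) \<alpha>^\<gamma>)\<close>
  in \<open>L\<^sup>2(\<alpha>^r d\<alpha>)\<close>.  The norm of the fiber is the product of the norms of \<open>u\<^sub>t\<close> and \<open>v\<^sub>t\<close>, which are Gamma
  integrals; after multiplication by \<open>t^(k + 1)\<close> the powers of \<open>t\<close> cancel, as the dilation symmetry of the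
  hypersurface requires.  All fibers therefore have the same norm, whose square is
    \<open>leray_normsq \<gamma> r k = (\<gamma>^(k + 1) / (k! 2^(k + 1)))\<^sup>2 (\<gamma> - 1)^(- q) \<Gamma>(p) \<Gamma>(q)\<close>
  with \<open>p = (2 k + r + 1) / \<gamma>\<close> and \<open>p + q = 2 (k + 1)\<close>, as soon as \<open>p\<close> and \<open>q\<close> are positive, that is, for all
  large \<open>k\<close>.  Stirling's formula gives the limit \<open>\<gamma> / (2 sqrt (\<gamma> - 1))\<close> of this square.

  The upper bound (\<open>energy_leray_op_le\<close>) needs only half of Plancherel's theorem, the inequality
  \<open>\<integral> |ft h|\<^sup>2 \<le> 2 \<pi> \<integral> |h|\<^sup>2\<close> for integrable \<open>h\<close> (\<open>bessel_ft\<close>), once before and once after the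
  Cauchy-Schwarz inequality in \<open>\<alpha>\<close>.  For the lower bound there is a function whose transform at every
  frequency \<open>t\<close> is a multiple of \<open>v\<^sub>t\<close>, so that Cauchy-Schwarz is an equality; choosing the
  multiple to be continuous and supported in \<open>t \<ge> 1\<close> makes Plancherel's identity and Fourier inversion
  available in their elementary forms (\<open>test_fn_extremal\<close>).  This function is not compactly supported, but its truncations
  are in the dense class over which the norm is defined, their norms do not exceed its own, and by Fatou's
  lemma nothing is lost on the other side (\<open>energy_leray_op_le_liminf\<close>).  Both bounds together give the norm of each
  component exactly (\<open>leray_k_norm_eq\<close>).
\<close>

section \<open>The Fourier transform on the line\<close>

definition ft :: "(real \<Rightarrow> complex) \<Rightarrow> real \<Rightarrow> complex" where
  "ft h s = (LINT t|lborel. h t * cis (s * t))"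

abbreviation sqnorm :: "(real \<Rightarrow> complex) \<Rightarrow> ennreal" where
  "sqnorm h \<equiv> \<integral>\<^sup>+ t. ennreal ((cmod (h t))\<^sup>2) \<partial>lborel"

lemma borel_measurable_cis [measurable]: "cis \<in> borel_measurable borel"
  by (rule borel_measurable_continuous_onI) (simp add: continuous_on_cis)

lemma borel_measurable_cnj [measurable]: "cnj \<in> borel_measurable borel"
  by (rule borel_measurable_continuous_onI) (intro continuous_intros)

lemma norm_integral_le_nn_integral:
  fixes f :: "'a \<Rightarrow> 'b::{banach, second_countable_topology}"
  shows "ennreal (norm (LINT x|M. f x)) \<le> (\<integral>\<^sup>+ x. ennreal (norm (f x)) \<partial>M)"
  by (cases "integrable M f") (auto simp: integral_norm_bound_ennreal not_integrable_integral_eq)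

lemma integrable_mult_cis:
  assumes "integrable lborel h"
  shows "integrable lborel (\<lambda>t. h t * cis (s * t))"
proof -
  have [measurable]: "h \<in> borel_measurable borel" using assms by simp
  show ?thesis
    using assms by (rule Bochner_Integration.integrable_bound) (auto simp: norm_mult)
qed

lemma borel_measurable_ft [measurable]:
  assumes [measurable]: "h \<in> borel_measurable borel"
  shows "ft h \<in> borel_measurable borel"
  unfolding ft_def by measurable

lemma norm_ft_le:
  assumes "integrable lborel h"
  shows "norm (ft h s) \<le> (LINT t|lborel. norm (h t))"
  unfolding ft_def using integral_norm_bound[of lborel "\<lambda>t. h t * cis (s * t)"]
  by (simp add: norm_mult)

text \<open>The Gaussian is its own Fourier transform; this is the only transform computed from scratch, and it drives
  the regularization below.\<close>
lemma ft_std_normal: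
  "(LINT x|lborel. of_real (std_normal_density x) * cis (s * x)) = of_real (exp (- (s\<^sup>2) / 2))"
proof -
  have "char std_normal_distribution s = of_real (exp (- (s\<^sup>2) / 2))"
    by (simp add: char_std_normal_distribution)
  moreover have "char std_normal_distribution s = (LINT x|lborel. of_real (std_normal_density x) * cis (s * x))"
    unfolding char_def by (subst integral_density) (auto simp: scaleR_conv_of_real cis_conv_exp)
  ultimately show ?thesis by simp
qed

lemma integral_std_normal: "(LINT x|lborel. std_normal_density x) = 1"
  using integral_std_normal_moment_even[of 0] by simp

abbreviation gauss_average :: "real \<Rightarrow> (real \<Rightarrow> complex) \<Rightarrow> real \<Rightarrow> complex" where
  "gauss_average e h t \<equiv> LINT x|lborel. h (t + e * x) * of_real (std_normal_density x)"

lemma gauss_weight: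
  assumes e: "e > 0"
  shows "(LINT s|lborel. of_real (exp (- ((e * s)\<^sup>2) / 2)) * cis (s * x))
     = of_real (2 * pi * (std_normal_density (x / e) / e))"
proof -
  have "(LINT s|lborel. of_real (exp (- ((e * s)\<^sup>2) / 2)) * cis (s * x))
      = (1/e) *\<^sub>R (LINT s|lborel. of_real (exp (- (s\<^sup>2) / 2)) * cis (s * x / e))"
    using e by (subst lborel_integral_real_affine[where c="1/e" and t=0]) auto
  also have "(LINT s|lborel. of_real (exp (- (s\<^sup>2) / 2)) * cis (s * x / e))
      = (LINT s|lborel. of_real (sqrt (2*pi)) * (of_real (std_normal_density s) * cis ((x/e) * s)))"
    by (intro Bochner_Integration.integral_cong) (auto simp: std_normal_density_def mult.commute)
  also have "\<dots> = of_real (sqrt (2*pi)) * of_real (exp (- ((x/e)\<^sup>2) / 2))"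
    by (simp only: integral_mult_right_zero ft_std_normal)
  also have "(1/e) *\<^sub>R \<dots> = of_real (2 * pi * (std_normal_density (x / e) / e))"
  proof -
    have "sqrt (2*pi) * sqrt (2*pi) = 2 * pi" by simp
    then have "sqrt (2*pi) * exp (- ((x/e)\<^sup>2) / 2) = 2 * pi * std_normal_density (x/e)"
      by (simp add: std_normal_density_def field_simps)
    then show ?thesis
      by (simp add: scaleR_conv_of_real field_simps flip: of_real_mult)
  qed
  finally show ?thesis .
qed

lemma integrable_gauss_weight:
  assumes "e > 0"
  shows "integrable lborel (\<lambda>s::real. exp (- ((e * s)\<^sup>2) / 2))"
proof -
  have "integrable lborel (\<lambda>s::real. sqrt (2*pi) * std_normal_density (0 + e * s))"
    using integrable_std_normal_moment[of 0] assms
    by (intro integrable_mult_right lborel_integrable_real_affine) auto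
  then show ?thesis by (simp add: std_normal_density_def)
qed

text \<open>Inserting a Gaussian factor makes the double integral absolutely convergent, so that Fubini's theorem
  applies; it replaces the value of \<open>h\<close> at \<open>t\<close> by its average against a normal density of width \<open>e\<close>.
  Plancherel's identity and Fourier inversion arise as \<open>e \<rightarrow> 0\<close>.\<close>
lemma gauss_inversion:
  assumes h: "integrable lborel h" and e: "e > 0"
  shows "(LINT s|lborel. of_real (exp (- ((e * s)\<^sup>2) / 2)) * ft h s * cis (- (s * t)))
      = of_real (2 * pi) * gauss_average e h t"
proof -
  have [measurable]: "h \<in> borel_measurable borel" using h by simp
  let ?w = "\<lambda>s. exp (- ((e * s)\<^sup>2) / 2)"
  let ?K = "\<lambda>s u. of_real (?w s) * (h u * cis (s * u)) * cis (- (s * t))"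
  have int: "integrable (lborel \<Otimes>\<^sub>M lborel) (\<lambda>(s, u). ?K s u)"
  proof (rule lborel_pair.Fubini_integrable)
    show "integrable lborel (\<lambda>s. LINT u|lborel. norm (case (s, u) of (s, u) \<Rightarrow> ?K s u))"
      using integrable_gauss_weight[OF e] by (simp add: norm_mult)
    show "AE s in lborel. integrable lborel (\<lambda>u. case (s, u) of (s, u) \<Rightarrow> ?K s u)"
      using integrable_mult_cis[OF h] by (auto intro!: integrable_mult_left integrable_mult_right)
  qed measurable
  have "(LINT s|lborel. of_real (?w s) * ft h s * cis (- (s * t)))
     = (LINT s|lborel. LINT u|lborel. ?K s u)"
    by (simp add: ft_def)
  also have "\<dots> = (LINT u|lborel. LINT s|lborel. ?K s u)"
    by (rule lborel_pair.Fubini_integral[OF int, symmetric])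
  also have "\<dots> = (LINT u|lborel. h u * (LINT s|lborel. of_real (?w s) * cis (s * (u - t))))"
  proof (intro Bochner_Integration.integral_cong refl)
    fix u
    have "?K s u = h u * (of_real (?w s) * cis (s * (u - t)))" for s
      by (simp add: mult.assoc mult.left_commute cis_mult right_diff_distrib)
    then show "(LINT s|lborel. ?K s u)
        = h u * (LINT s|lborel. of_real (?w s) * cis (s * (u - t)))"
      by (simp only: integral_mult_right_zero)
  qed
  also have "\<dots> = (LINT u|lborel. h u * of_real (2 * pi * (std_normal_density ((u - t) / e) / e)))"
    by (simp only: gauss_weight[OF e])
  also have "\<dots> = e *\<^sub>R (LINT x|lborel. h (t + e * x) * of_real (2 * pi * (std_normal_density x / e)))"
    using e by (subst lborel_integral_real_affine[where c="e" and t=t]) auto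
  also have "\<dots> = (LINT x|lborel. of_real (2*pi) * (h (t + e * x) * of_real (std_normal_density x)))"
    unfolding integral_scaleR_right[symmetric] using e
    by (intro Bochner_Integration.integral_cong refl) (simp add: scaleR_conv_of_real)
  also have "\<dots> = of_real (2 * pi) * gauss_average e h t"
    by (rule integral_mult_right_zero)
  finally show ?thesis .
qed

text \<open>Integrating the regularized inversion formula against the conjugate of \<open>h\<close>.\<close>
lemma gauss_parseval:
  assumes h: "integrable lborel h" and e: "e > 0"
  shows "of_real (LINT s|lborel. exp (- ((e * s)\<^sup>2) / 2) * (norm (ft h s))\<^sup>2)
      = of_real (2 * pi) * (LINT t|lborel. cnj (h t) * gauss_average e h t)"
    (is "?L = ?R")
proof -
  have [measurable]: "h \<in> borel_measurable borel" using h by simp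
  have h': "integrable lborel (\<lambda>t. cnj (h t))" using h by simp
  let ?w = "\<lambda>s. exp (- ((e * s)\<^sup>2) / 2)"
  let ?K = "\<lambda>s t. of_real (?w s) * ft h s * (cnj (h t) * cis (- (s * t)))"
  have bd: "norm (?K s t) \<le> (LINT t|lborel. norm (h t)) * ?w s * norm (h t)" for s t
    using norm_ft_le[OF h, of s] by (simp add: norm_mult mult_right_mono mult_left_mono)
  have int: "integrable (lborel \<Otimes>\<^sub>M lborel) (\<lambda>(s, t). ?K s t)"
  proof (rule lborel_pair.Fubini_integrable)
    show "integrable lborel (\<lambda>s. LINT t|lborel. norm (case (s, t) of (s, t) \<Rightarrow> ?K s t))"
    proof (rule Bochner_Integration.integrable_bound)
      show "integrable lborel (\<lambda>s. (LINT t|lborel. norm (h t)) * ?w s * (LINT t|lborel. norm (h t)))"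
        using integrable_gauss_weight[OF e] by simp
      have "?w s * (norm (ft h s) * (LINT t|lborel. norm (h t))) \<le> ?w s * ((LINT t|lborel. norm (h t)) * (LINT t|lborel. norm (h t)))" for s
        using norm_ft_le[OF h, of s] by (intro mult_left_mono mult_right_mono) auto
      then show "AE s in lborel. norm (LINT t|lborel. norm (case (s, t) of (s, t) \<Rightarrow> ?K s t))
          \<le> norm ((LINT t|lborel. norm (h t)) * ?w s * (LINT t|lborel. norm (h t)))"
        by (simp add: norm_mult mult_ac)
    qed measurable
    show "AE s in lborel. integrable lborel (\<lambda>t. case (s, t) of (s, t) \<Rightarrow> ?K s t)"
      using integrable_mult_cis[OF h', of "- _"] by (auto intro!: integrable_mult_right)
  qed measurable
  have conj: "cnj (ft h s) = (LINT t|lborel. cnj (h t) * cis (- (s * t)))" for s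
  proof -
    have "cnj (ft h s) = (LINT t|lborel. cnj (h t * cis (s * t)))"
      unfolding ft_def by (rule Bochner_Integration.integral_cnj[symmetric])
    then show ?thesis by (simp add: cis_cnj)
  qed
  have "?L = (LINT s|lborel. of_real (?w s) * ft h s * cnj (ft h s))"
    unfolding integral_complex_of_real[symmetric]
    by (intro Bochner_Integration.integral_cong refl) (simp only: mult.assoc of_real_mult complex_norm_square)
  also have "\<dots> = (LINT s|lborel. LINT t|lborel. ?K s t)"
    by (simp only: conj integral_mult_right_zero)
  also have "\<dots> = (LINT t|lborel. LINT s|lborel. ?K s t)"
    by (rule lborel_pair.Fubini_integral[OF int, symmetric])
  also have "\<dots> = (LINT t|lborel. cnj (h t) * (LINT s|lborel. of_real (?w s) * ft h s * cis (- (s * t))))"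
    by (intro Bochner_Integration.integral_cong refl)
       (simp flip: integral_mult_right_zero add: algebra_simps)
  also have "\<dots> = (LINT t|lborel. of_real (2 * pi) * (cnj (h t) * gauss_average e h t))"
    by (simp only: gauss_inversion[OF h e] mult.left_commute)
  also have "\<dots> = ?R" by (rule integral_mult_right_zero)
  finally show ?thesis .
qed

lemma nn_integral_std_normal: "(\<integral>\<^sup>+ x. ennreal (std_normal_density x) \<partial>lborel) = 1"
  using integrable_std_normal_moment[of 0] integral_std_normal
  by (subst nn_integral_eq_integral) auto

lemma nn_integral_norm_square_shift:
  fixes h :: "real \<Rightarrow> complex"
  assumes [measurable]: "h \<in> borel_measurable borel"
  shows "sqnorm (\<lambda>t. h (t + c)) = sqnorm h"
  using nn_integral_real_affine[where f="\<lambda>t. ennreal ((norm (h t))\<^sup>2)" and c=1 and t=c]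
  by (simp add: add.commute)

text \<open>The average of the products \<open>h(t) h(t + e x)\<close> is controlled by
  \<open>2 |a b| \<le> |a|\<^sup>2 + |b|\<^sup>2\<close> and translation invariance.\<close>
lemma nn_integral_gauss_ft_le:
  assumes h: "integrable lborel h" and e: "e > 0"
  shows "(\<integral>\<^sup>+ s. ennreal (exp (- ((e * s)\<^sup>2) / 2) * (norm (ft h s))\<^sup>2) \<partial>lborel)
      \<le> ennreal (2 * pi) * sqnorm h"
proof -
  have [measurable]: "h \<in> borel_measurable borel" using h by simp
  let ?w = "\<lambda>s. exp (- ((e * s)\<^sup>2) / 2)"
  let ?I = "LINT t|lborel. cnj (h t) * gauss_average e h t"
  define E where "E = sqnorm h"
  have "integrable lborel (\<lambda>s. ?w s * (norm (ft h s))\<^sup>2)"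
  proof (rule Bochner_Integration.integrable_bound)
    show "integrable lborel (\<lambda>s. ?w s * (LINT t|lborel. norm (h t))\<^sup>2)"
      using integrable_gauss_weight[OF e] by simp
    show "AE s in lborel. norm (?w s * (norm (ft h s))\<^sup>2) \<le> norm (?w s * (LINT t|lborel. norm (h t))\<^sup>2)"
      using norm_ft_le[OF h] by (intro AE_I2) (auto simp: power_mono)
  qed measurable
  then have "(\<integral>\<^sup>+ s. ennreal (?w s * (norm (ft h s))\<^sup>2) \<partial>lborel) = ennreal (LINT s|lborel. ?w s * (norm (ft h s))\<^sup>2)"
    by (intro nn_integral_eq_integral) auto
  also have "\<dots> = ennreal (norm (complex_of_real (LINT s|lborel. ?w s * (norm (ft h s))\<^sup>2)))"
    by (simp add: integral_nonneg_AE)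
  also have "\<dots> = ennreal (2 * pi) * ennreal (norm ?I)"
    unfolding gauss_parseval[OF h e] by (simp add: norm_mult ennreal_mult')
  also have "ennreal (norm ?I) \<le> (\<integral>\<^sup>+ t. ennreal (norm (cnj (h t) * gauss_average e h t)) \<partial>lborel)"
    by (rule norm_integral_le_nn_integral)
  also have "\<dots> = (\<integral>\<^sup>+ t. ennreal (norm (LINT x|lborel. cnj (h t) * (h (t + e * x) * of_real (std_normal_density x)))) \<partial>lborel)"
    by (simp only: integral_mult_right_zero)
  also have "\<dots> \<le> (\<integral>\<^sup>+ t. \<integral>\<^sup>+ x. ennreal (norm (cnj (h t) * (h (t + e * x) * of_real (std_normal_density x)))) \<partial>lborel \<partial>lborel)"
    by (intro nn_integral_mono norm_integral_le_nn_integral)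
  also have "\<dots> \<le> (\<integral>\<^sup>+ t. \<integral>\<^sup>+ x. ennreal (std_normal_density x) * (ennreal (1/2) * (ennreal ((norm (h t))\<^sup>2) + ennreal ((norm (h (t + e * x)))\<^sup>2))) \<partial>lborel \<partial>lborel)"
  proof (intro nn_integral_mono)
    fix t x
    have "norm (h t) * norm (h (t + e * x)) \<le> 1/2 * ((norm (h t))\<^sup>2 + (norm (h (t + e * x)))\<^sup>2)"
      using sum_squares_bound[of "norm (h t)" "norm (h (t + e * x))"] by (simp add: mult.assoc)
    then have "norm (cnj (h t) * (h (t + e * x) * of_real (std_normal_density x)))
       \<le> std_normal_density x * (1/2 * ((norm (h t))\<^sup>2 + (norm (h (t + e * x)))\<^sup>2))"
      using mult_left_mono[of "norm (h t) * norm (h (t + e * x))" "1/2 * ((norm (h t))\<^sup>2 + (norm (h (t + e * x)))\<^sup>2)" "std_normal_density x"]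
      by (simp add: norm_mult mult_ac)
    then show "ennreal (norm (cnj (h t) * (h (t + e * x) * of_real (std_normal_density x)))) \<le> ennreal (std_normal_density x) * (ennreal (1/2) * (ennreal ((norm (h t))\<^sup>2) + ennreal ((norm (h (t + e * x)))\<^sup>2)))"
      by (subst ennreal_plus[symmetric], simp, simp, (subst ennreal_mult'[symmetric], simp)+) (rule ennreal_leI)
  qed
  also have "\<dots> = (\<integral>\<^sup>+ x. \<integral>\<^sup>+ t. ennreal (std_normal_density x) * (ennreal (1/2) * (ennreal ((norm (h t))\<^sup>2) + ennreal ((norm (h (t + e * x)))\<^sup>2))) \<partial>lborel \<partial>lborel)"
    by (rule lborel_pair.Fubini') measurable
  also have "\<dots> = (\<integral>\<^sup>+ x. ennreal (std_normal_density x) * (ennreal (1/2) * (E + E)) \<partial>lborel)"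
    by (simp add: nn_integral_cmult nn_integral_add nn_integral_norm_square_shift E_def)
  also have "\<dots> = ennreal (1/2) * (E + E)"
    by (simp add: nn_integral_multc nn_integral_std_normal)
  also have "\<dots> = E"
  proof -
    have "ennreal (1/2) * ennreal 2 = 1"
      by (subst ennreal_mult'[symmetric]) auto
    then show ?thesis by (simp only: mult_2[symmetric] ennreal_numeral[symmetric] mult.assoc[symmetric]) simp
  qed
  finally show ?thesis by (simp add: E_def mult_left_mono)
qed

lemma gauss_weight_tendsto: "(\<lambda>n. exp (- ((inverse (real (Suc n)) * s)\<^sup>2) / 2)) \<longlonglongrightarrow> 1"
proof -
  have "(\<lambda>n. exp (- ((inverse (real (Suc n)) * s)\<^sup>2) / 2)) \<longlonglongrightarrow> exp (- ((0 * s)\<^sup>2) / 2)"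
    by (intro tendsto_intros LIMSEQ_inverse_real_of_nat) auto
  then show ?thesis by simp
qed

text \<open>Fatou's lemma removes the Gaussian factor.  The right-hand side may be infinite.\<close>
lemma bessel_ft:
  assumes h: "integrable lborel h"
  shows "sqnorm (ft h)
      \<le> ennreal (2 * pi) * sqnorm h" (is "_ \<le> ?R")
proof -
  have [measurable]: "h \<in> borel_measurable borel" using h by simp
  let ?w = "\<lambda>n s. exp (- ((inverse (real (Suc n)) * s)\<^sup>2) / 2)"
  have lim: "liminf (\<lambda>n. ennreal (?w n s * (norm (ft h s))\<^sup>2)) = ennreal ((norm (ft h s))\<^sup>2)" for s
  proof (rule lim_imp_Liminf)
    have "(\<lambda>n. ennreal (?w n s * (norm (ft h s))\<^sup>2)) \<longlonglongrightarrow> ennreal (1 * (norm (ft h s))\<^sup>2)"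
      by (intro tendsto_ennrealI tendsto_mult gauss_weight_tendsto tendsto_const)
    then show "(\<lambda>n. ennreal (?w n s * (norm (ft h s))\<^sup>2)) \<longlonglongrightarrow> ennreal ((norm (ft h s))\<^sup>2)" by simp
  qed simp
  have "sqnorm (ft h) = (\<integral>\<^sup>+ s. liminf (\<lambda>n. ennreal (?w n s * (norm (ft h s))\<^sup>2)) \<partial>lborel)"
    by (simp only: lim)
  also have "\<dots> \<le> liminf (\<lambda>n. \<integral>\<^sup>+ s. ennreal (?w n s * (norm (ft h s))\<^sup>2) \<partial>lborel)"
    by (rule nn_integral_liminf) measurable
  also have "\<dots> \<le> liminf (\<lambda>n. ?R)"
    by (intro Liminf_mono always_eventually allI nn_integral_gauss_ft_le[OF h]) simp
  also have "\<dots> = ?R" by (simp add: Liminf_const)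
  finally show ?thesis .
qed

text \<open>The normal density of width \<open>e\<close> is an approximate identity.\<close>
lemma gauss_average_tendsto:
  fixes h :: "real \<Rightarrow> complex"
  assumes c: "continuous_on UNIV h" and b: "\<And>t. norm (h t) \<le> B"
  shows "(\<lambda>n. LINT x|lborel. h (t + inverse (real (Suc n)) * x) * of_real (std_normal_density x)) \<longlonglongrightarrow> h t"
proof -
  have [measurable]: "h \<in> borel_measurable borel" using c by (rule borel_measurable_continuous_onI)
  have "(\<lambda>n. LINT x|lborel. h (t + inverse (real (Suc n)) * x) * of_real (std_normal_density x))
     \<longlonglongrightarrow> (LINT x|lborel. h t * of_real (std_normal_density x))"
  proof (rule integral_dominated_convergence[where w="\<lambda>x. B * std_normal_density x"])
    show "integrable lborel (\<lambda>x. B * std_normal_density x)"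
      using integrable_std_normal_moment[of 0] by simp
    have "isCont h t" using c by (simp add: continuous_on_eq_continuous_at)
    moreover have "(\<lambda>n. t + inverse (real (Suc n)) * x) \<longlonglongrightarrow> t + 0 * x" for x
      by (intro tendsto_intros LIMSEQ_inverse_real_of_nat)
    ultimately have "(\<lambda>n. h (t + inverse (real (Suc n)) * x)) \<longlonglongrightarrow> h t" for x
      by (intro isCont_tendsto_compose[of t h]) simp_all
    then show "AE x in lborel. (\<lambda>n. h (t + inverse (real (Suc n)) * x) * of_real (std_normal_density x)) \<longlonglongrightarrow> h t * of_real (std_normal_density x)"
      by (intro AE_I2 tendsto_mult tendsto_const)
    show "AE x in lborel. norm (h (t + inverse (real (Suc n)) * x) * of_real (std_normal_density x)) \<le> B * std_normal_density x" for n
      using b by (intro AE_I2) (auto simp: norm_mult intro!: mult_right_mono)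
  qed measurable
  also have "(LINT x|lborel. h t * of_real (std_normal_density x)) = h t"
    using integral_std_normal by simp
  finally show ?thesis .
qed

text \<open>For continuous bounded \<open>h\<close> the Gaussian averages converge to \<open>h\<close> itself, which gives the inequality
  opposite to \<open>bessel_ft\<close>.\<close>
lemma plancherel_ft:
  assumes h: "integrable lborel h" and c: "continuous_on UNIV h" and b: "\<And>t. norm (h t) \<le> B"
  shows "sqnorm (ft h)
      = ennreal (2 * pi) * sqnorm h"
proof (rule antisym[OF bessel_ft[OF h]])
  have [measurable]: "h \<in> borel_measurable borel" using h by simp
  let ?w = "\<lambda>n s. exp (- ((inverse (real (Suc n)) * s)\<^sup>2) / 2)"
  let ?A = "\<lambda>n t. LINT x|lborel. h (t + inverse (real (Suc n)) * x) * of_real (std_normal_density x)"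
  have B: "norm (?A n t) \<le> B" for n t
  proof -
    have "norm (?A n t) \<le> (LINT x|lborel. B * std_normal_density x)"
    proof (rule order_trans[OF integral_norm_bound], rule integral_mono_AE)
      show "integrable lborel (\<lambda>x. B * std_normal_density x)"
        using integrable_std_normal_moment[of 0] by simp
      show "integrable lborel (\<lambda>x. norm (h (t + inverse (real (Suc n)) * x) * of_real (std_normal_density x)))"
        by (rule integrable_norm, rule Bochner_Integration.integrable_bound[where f="\<lambda>x. B * std_normal_density x"])
           (use b integrable_std_normal_moment[of 0] in \<open>auto simp: norm_mult abs_mult intro!: AE_I2 mult_right_mono intro: order_trans[OF b abs_ge_self]\<close>)
    qed (use b integrable_std_normal_moment[of 0] in \<open>auto simp: norm_mult intro!: mult_right_mono\<close>)
    then show ?thesis by (simp add: integral_std_normal)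
  qed
  have "(\<lambda>n. LINT t|lborel. cnj (h t) * ?A n t) \<longlonglongrightarrow> (LINT t|lborel. cnj (h t) * h t)"
  proof (rule integral_dominated_convergence[where w="\<lambda>t. norm (h t) * B"])
    show "AE t in lborel. (\<lambda>n. cnj (h t) * ?A n t) \<longlonglongrightarrow> cnj (h t) * h t"
      using gauss_average_tendsto[OF c b] by (intro AE_I2 tendsto_mult tendsto_const)
    show "AE t in lborel. norm (cnj (h t) * ?A n t) \<le> norm (h t) * B" for n
      using B by (intro AE_I2) (auto simp: norm_mult intro!: mult_left_mono)
  qed (use h in auto)
  then have "(\<lambda>n. ennreal (norm (of_real (2 * pi) * (LINT t|lborel. cnj (h t) * ?A n t)))) \<longlonglongrightarrow> ennreal (norm (of_real (2 * pi) * (LINT t|lborel. cnj (h t) * h t)))"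
    by (intro tendsto_intros)
  moreover have "ennreal (norm (of_real (2 * pi) * (LINT t|lborel. cnj (h t) * ?A n t))) \<le> sqnorm (ft h)" for n
  proof -
    have "ennreal (norm (of_real (2 * pi) * (LINT t|lborel. cnj (h t) * ?A n t)))
       = ennreal (norm (LINT s|lborel. ?w n s * (norm (ft h s))\<^sup>2))"
      by (subst gauss_parseval[OF h, symmetric]) (simp_all only: norm_of_real real_norm_def, simp)
    also have "\<dots> \<le> (\<integral>\<^sup>+ s. ennreal (norm (?w n s * (norm (ft h s))\<^sup>2)) \<partial>lborel)"
      by (rule norm_integral_le_nn_integral)
    also have "\<dots> \<le> sqnorm (ft h)"
      by (intro nn_integral_mono ennreal_leI) (simp add: mult_left_le_one_le)
    finally show ?thesis .
  qed
  ultimately have "ennreal (norm (of_real (2 * pi) * (LINT t|lborel. cnj (h t) * h t))) \<le> sqnorm (ft h)"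
    by (meson LIMSEQ_le_const2)
  moreover have "ennreal (norm (of_real (2 * pi) * (LINT t|lborel. cnj (h t) * h t))) = ennreal (2 * pi) * sqnorm h"
  proof -
    have i: "integrable lborel (\<lambda>t. (norm (h t))\<^sup>2)"
    proof (rule Bochner_Integration.integrable_bound)
      show "integrable lborel (\<lambda>t. norm (h t) * B)" using h by auto
      show "AE t in lborel. norm ((norm (h t))\<^sup>2) \<le> norm (norm (h t) * B)"
        using b by (intro AE_I2) (auto simp: power2_eq_square abs_mult intro!: mult_left_mono intro: order_trans[OF b])
    qed measurable
    have "(LINT t|lborel. cnj (h t) * h t) = of_real (LINT t|lborel. (norm (h t))\<^sup>2)"
      unfolding integral_complex_of_real[symmetric]
      by (intro Bochner_Integration.integral_cong refl) (simp only: complex_norm_square mult.commute)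
    then show ?thesis
      by (simp add: norm_mult ennreal_mult' nn_integral_eq_integral[OF i] integral_nonneg_AE)
  qed
  ultimately show "ennreal (2 * pi) * sqnorm h \<le> sqnorm (ft h)"
    by simp
qed

text \<open>The regularized inversion formula in the limit; dominated convergence on the frequency side is where the
  integrability of \<open>ft h\<close> enters.\<close>
lemma fourier_inversion:
  assumes h: "integrable lborel h" and c: "continuous_on UNIV h" and b: "\<And>t. norm (h t) \<le> B"
    and H: "integrable lborel (ft h)"
  shows "(LINT s|lborel. ft h s * cis (- (s * t))) = of_real (2 * pi) * h t"
proof -
  have [measurable]: "h \<in> borel_measurable borel" using h by simp
  let ?w = "\<lambda>n s. exp (- ((inverse (real (Suc n)) * s)\<^sup>2) / 2)"
  let ?A = "\<lambda>n t. LINT x|lborel. h (t + inverse (real (Suc n)) * x) * of_real (std_normal_density x)"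
  have "(\<lambda>n. LINT s|lborel. of_real (?w n s) * ft h s * cis (- (s * t))) \<longlonglongrightarrow> (LINT s|lborel. ft h s * cis (- (s * t)))"
  proof (rule integral_dominated_convergence[where w="\<lambda>s. norm (ft h s)"])
    have "(\<lambda>n. of_real (?w n s) * ft h s * cis (- (s * t))) \<longlonglongrightarrow> of_real 1 * ft h s * cis (- (s * t))" for s
      by (intro tendsto_mult tendsto_of_real gauss_weight_tendsto tendsto_const)
    then show "AE s in lborel. (\<lambda>n. of_real (?w n s) * ft h s * cis (- (s * t))) \<longlonglongrightarrow> ft h s * cis (- (s * t))"
      by simp
    show "AE s in lborel. norm (of_real (?w n s) * ft h s * cis (- (s * t))) \<le> norm (ft h s)" for n
      by (intro AE_I2) (simp add: norm_mult mult_left_le_one_le)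
  qed (use H in auto)
  moreover have "(\<lambda>n. LINT s|lborel. of_real (?w n s) * ft h s * cis (- (s * t))) \<longlonglongrightarrow> of_real (2 * pi) * h t"
    by (subst gauss_inversion[OF h], simp, intro tendsto_mult tendsto_const gauss_average_tendsto[OF c b])
  ultimately show ?thesis by (rule LIMSEQ_unique)
qed

section \<open>Gamma integrals and Stirling's formula\<close>

lemma Gamma_integral_Ioi:
  assumes "p > 0"
  shows "(\<lambda>t. t powr (p - 1) / exp t) absolutely_integrable_on {0<..}"
    and "integral {0<..} (\<lambda>t. t powr (p - 1) / exp t) = Gamma (p::real)"
proof -
  have *: "((\<lambda>t. t powr (p - 1) / exp t) has_integral Gamma p) {0<..}"
    by (subst has_integral_spike_set_eq[of "{0<..}" "{0..}"], auto intro: negligible_subset[OF negligible_sing[of 0]]) (rule Gamma_integral_real[OF assms])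
  then show "(\<lambda>t. t powr (p - 1) / exp t) absolutely_integrable_on {0<..}"
    by (intro nonnegative_absolutely_integrable_1) (auto simp: integrable_on_def)
  from * show "integral {0<..} (\<lambda>t. t powr (p - 1) / exp t) = Gamma (p::real)"
    by (rule integral_unique)
qed

text \<open>The substitution \<open>t = c a^g\<close> reduces this to Euler's integral.\<close>
lemma nn_integral_powr_exp_powr:
  fixes x c g :: real
  assumes g: "g > 0" and c: "c > 0" and x: "x > -1"
  shows "(\<integral>\<^sup>+ a. ennreal (a powr x * exp (- (c * a powr g))) * indicator {0<..} a \<partial>lborel)
       = ennreal (c powr (- ((x + 1) / g)) * Gamma ((x + 1) / g) / g)"
proof -
  define p where "p = (x + 1) / g"
  have p: "p > 0" using g x by (simp add: p_def)
  let ?f = "\<lambda>t. t powr (p - 1) / exp t"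
  let ?h = "\<lambda>a. c * a powr g"
  have image: "?h ` {0<..} = {0<..}"
  proof safe
    fix t :: real assume t: "0 < t"
    have "t = ?h ((t / c) powr (1 / g))" using t c g by (simp add: powr_powr)
    then show "t \<in> ?h ` {0<..}" using t c by auto
  qed (use c in auto)
  have inj: "inj_on ?h {0<..}"
  proof (rule inj_onI)
    fix a b :: real assume ab: "a \<in> {0<..}" "b \<in> {0<..}" "?h a = ?h b"
    then have "(a powr g) powr (1 / g) = (b powr g) powr (1 / g)" using c by simp
    then show "a = b" using ab g by (simp add: powr_powr)
  qed
  have der: "(?h has_real_derivative (c * (g * a powr (g - 1)))) (at a within {0<..})" if "a \<in> {0<..}" for a
    using that by (auto intro!: derivative_eq_intros)
  have *: "(\<lambda>a. \<bar>c * (g * a powr (g - 1))\<bar> * ?f (?h a)) absolutely_integrable_on {0<..} \<and>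
      integral {0<..} (\<lambda>a. \<bar>c * (g * a powr (g - 1))\<bar> * ?f (?h a)) = Gamma p"
    using has_absolute_integral_change_of_variables_1'[OF _ der inj, of ?f "Gamma p"]
      Gamma_integral_Ioi[OF p] by (simp add: image)
  have **: "\<bar>c * (g * a powr (g - 1))\<bar> * ?f (?h a) = g * c powr p * (a powr x * exp (- (c * a powr g)))" if "a \<in> {0<..}" for a
  proof -
    have "(c * a powr g) powr (p - 1) = c powr (p - 1) * a powr (g * p - g)"
      using that c by (simp add: powr_mult powr_powr right_diff_distrib)
    moreover have "c * c powr (p - 1) = c powr p" using c by (simp add: powr_mult_base)
    moreover have "a powr (g - 1) * a powr (g * p - g) = a powr x"
      using g by (simp add: powr_add[symmetric] p_def)
    ultimately show ?thesis using c g that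
      by (simp add: exp_minus field_simps)
  qed
  have "((\<lambda>a. \<bar>c * (g * a powr (g - 1))\<bar> * ?f (?h a)) has_integral Gamma p) {0<..}"
    using * set_lebesgue_integral_eq_integral(1) by (auto simp: has_integral_iff)
  then have "((\<lambda>a. g * c powr p * (a powr x * exp (- (c * a powr g)))) has_integral Gamma p) {0<..}"
    by (rule has_integral_eq[OF **, rotated]) simp
  then have "((\<lambda>a. inverse (g * c powr p) * (g * c powr p * (a powr x * exp (- (c * a powr g))))) has_integral (inverse (g * c powr p) * Gamma p)) {0<..}"
    by (rule has_integral_mult_right)
  then have "((\<lambda>a. a powr x * exp (- (c * a powr g))) has_integral (c powr (-p) * Gamma p / g)) {0<..}"
    using g c by (simp add: powr_minus field_simps)
  then have "(\<integral>\<^sup>+ a. ennreal (indicator {0<..} a * (a powr x * exp (- (c * a powr g)))) \<partial>lborel) = ennreal (c powr (-p) * Gamma p / g)"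
    by (rule nn_integral_has_integral_lebesgue[rotated]) auto
  then show ?thesis
    by (simp add: p_def ennreal_mult' ennreal_indicator mult.commute)
qed

text \<open>The two quadratic bounds on \<open>ln (1 + y)\<close> dominate the integrand in the proof of Stirling's formula.\<close>
lemma ln_one_plus_le_nonneg:
  fixes y :: real assumes "y \<ge> 0" shows "ln (1 + y) \<le> y - y\<^sup>2 / (2 * (1 + y))"
proof -
  let ?f = "\<lambda>y::real. y - y\<^sup>2 / (2 * (1 + y)) - ln (1 + y)"
  have "?f 0 \<le> ?f y"
  proof (rule DERIV_nonneg_imp_nondecreasing[OF assms])
    fix z :: real assume z: "0 \<le> z" "z \<le> y"
    have "(?f has_real_derivative (1 - (2 * z * (2 * (1 + z)) - z\<^sup>2 * 2) / (2 * (1 + z))\<^sup>2 - 1 / (1 + z))) (at z)"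
      using z by (auto intro!: derivative_eq_intros simp: power2_eq_square)
    also have "1 - (2 * z * (2 * (1 + z)) - z\<^sup>2 * 2) / (2 * (1 + z))\<^sup>2 - 1 / (1 + z) = z\<^sup>2 / (2 * (1 + z)\<^sup>2)"
      using z by (simp add: divide_simps power2_eq_square) algebra
    finally have "(?f has_real_derivative (z\<^sup>2 / (2 * (1 + z)\<^sup>2))) (at z)" .
    moreover have "z\<^sup>2 / (2 * (1 + z)\<^sup>2) \<ge> 0" by simp
    ultimately show "\<exists>D. (?f has_real_derivative D) (at z) \<and> 0 \<le> D" by blast
  qed
  then show ?thesis by simp
qed

lemma ln_one_plus_le_nonpos:
  fixes y :: real assumes "y \<le> 0" "-1 < y" shows "ln (1 + y) \<le> y - y\<^sup>2 / 2"
proof -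
  let ?f = "\<lambda>y::real. y - y\<^sup>2 / 2 - ln (1 + y)"
  have "?f y \<ge> ?f 0"
  proof (rule DERIV_nonpos_imp_nonincreasing[OF assms(1)])
    fix z :: real assume z: "y \<le> z" "z \<le> 0"
    have "(?f has_real_derivative (1 - z - 1 / (1 + z))) (at z)"
      using z assms by (auto intro!: derivative_eq_intros)
    also have "1 - z - 1 / (1 + z) = - (z\<^sup>2 / (1 + z))"
      using z assms by (simp add: divide_simps power2_eq_square) algebra
    finally have "(?f has_real_derivative (- (z\<^sup>2 / (1 + z)))) (at z)" .
    moreover have "- (z\<^sup>2 / (1 + z)) \<le> 0" using z assms by simp
    ultimately show "\<exists>D. (?f has_real_derivative D) (at z) \<and> D \<le> 0" by blast
  qed
  then show ?thesis by simp
qed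

lemma integrable_exp_minus_abs: "integrable lborel (\<lambda>u::real. exp (- \<bar>u\<bar> / 2))"
proof -
  have 1: "integrable lborel (exponential_density (1/2))"
    using prob_space.emeasure_space_1[OF prob_space_exponential_density[of "1/2"]]
    by (intro integrableI_nonneg) (auto simp: emeasure_density exponential_density_def)
  have 2: "integrable lborel (\<lambda>u. exponential_density (1/2) (0 + (-1) * u))"
    using 1 by (intro lborel_integrable_real_affine) auto
  show ?thesis
    by (rule Bochner_Integration.integrable_bound[OF integrable_mult_right[OF Bochner_Integration.integrable_add[OF 1 2], of 2]])
       (auto simp: exponential_density_def intro!: AE_I2)
qed

text \<open>The integrand of \<open>\<Gamma>(x + 1)\<close> after the substitution \<open>t = x + sqrt x * u\<close>, divided by its value
  \<open>x^x exp (- x)\<close> at the maximum \<open>t = x\<close>.\<close>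
definition stirling_kernel :: "real \<Rightarrow> real \<Rightarrow> real" where
  "stirling_kernel x u = (if u > - sqrt x then exp (x * ln (1 + u / sqrt x) - sqrt x * u) else 0)"

text \<open>For \<open>u \<le> 0\<close> the kernel is at most \<open>exp (- u\<^sup>2 / 2)\<close>.  For \<open>u \<ge> 0\<close> it is at most
  \<open>exp (- u\<^sup>2 / (2 (1 + u / sqrt x)))\<close>, which decays only exponentially but is largest, among \<open>x \<ge> 1\<close>, at \<open>x = 1\<close>.\<close>
lemma stirling_kernel_le:
  assumes x: "x \<ge> 1" shows "stirling_kernel x u \<le> exp (1/2) * exp (- \<bar>u\<bar> / 2)"
proof (cases "u > - sqrt x")
  case True
  define y where "y = u / sqrt x"
  have u: "u = sqrt x * y" and s: "sqrt x * sqrt x = x" "sqrt x \<ge> 1" using x by (auto simp: y_def)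
  have y: "y > -1" using True s x by (simp add: y_def field_simps)
  have "x * ln (1 + y) - sqrt x * u \<le> (1 - \<bar>u\<bar>) / 2"
  proof (cases "y \<ge> 0")
    case yp: True
    then have up: "u \<ge> 0" using s u by simp
    have "x * ln (1 + y) \<le> x * (y - y\<^sup>2 / (2 * (1 + y)))"
      using x ln_one_plus_le_nonneg[OF yp] by (intro mult_left_mono) auto
    then have "x * ln (1 + y) - sqrt x * u \<le> - ((sqrt x * y)\<^sup>2 / (2 * (1 + y)))"
      using s x by (simp add: u algebra_simps power_mult_distrib flip: mult.assoc)
    also have "\<dots> = - (u\<^sup>2 / (2 * (1 + y)))" by (simp add: u)
    also have "\<dots> \<le> - (u\<^sup>2 / (2 * (1 + u)))"
    proof -
      have "y \<le> u" using s yp u mult_right_mono[of 1 "sqrt x" y] by simp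
      then show ?thesis using yp up by (simp add: frac_le)
    qed
    also have "\<dots> \<le> (1 - u) / 2"
      using up by (simp add: field_simps power2_eq_square)
    finally show ?thesis using up by simp
  next
    case yn: False
    then have un: "u \<le> 0" using s u by (simp add: mult_nonneg_nonpos)
    have "x * ln (1 + y) \<le> x * (y - y\<^sup>2 / 2)"
      using x yn y ln_one_plus_le_nonpos[of y] by (intro mult_left_mono) auto
    then have "x * ln (1 + y) - sqrt x * u \<le> - ((sqrt x * y)\<^sup>2 / 2)"
      using s x by (simp add: u algebra_simps power_mult_distrib flip: mult.assoc)
    also have "\<dots> = - (u\<^sup>2 / 2)" by (simp add: u)
    also have "\<dots> \<le> (1 + u) / 2"
      using sum_squares_ge_zero[of "u + 1/2" 0] by (simp add: power2_eq_square field_simps)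
    finally show ?thesis using un by simp
  qed
  then show ?thesis using True by (simp add: stirling_kernel_def y_def flip: exp_add)
qed (simp add: stirling_kernel_def)

lemma stirling_kernel_tendsto:
  "((\<lambda>x. stirling_kernel x u) \<longlongrightarrow> exp (- (u\<^sup>2) / 2)) at_top"
proof -
  have "eventually (\<lambda>x. u > - sqrt x) at_top" by real_asymp
  then have "eventually (\<lambda>x. exp (x * ln (1 + u / sqrt x) - sqrt x * u) = stirling_kernel x u) at_top"
    by eventually_elim (simp add: stirling_kernel_def)
  moreover have "((\<lambda>x. exp (x * ln (1 + u / sqrt x) - sqrt x * u)) \<longlongrightarrow> exp (- (u\<^sup>2) / 2)) at_top"
    by (real_asymp simp: power2_eq_square)
  ultimately show ?thesis by (rule Lim_transform_eventually[rotated])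
qed

lemma Gamma_eq_stirling_kernel:
  assumes x: "x > 0"
  shows "Gamma (x + 1) = x powr x * exp (- x) * sqrt x * (LINT u|lborel. stirling_kernel x u)"
proof -
  have [measurable]: "stirling_kernel x \<in> borel_measurable borel"
    unfolding stirling_kernel_def by measurable
  have "ennreal (Gamma (x + 1)) = (\<integral>\<^sup>+ t. ennreal (indicator {0..} t * t powr x / exp t) \<partial>lborel)"
    using Gamma_conv_nn_integral_real[of "x + 1"] x by simp
  also have "\<dots> = ennreal (sqrt x) * (\<integral>\<^sup>+ u. ennreal (indicator {0..} (x + sqrt x * u) * (x + sqrt x * u) powr x / exp (x + sqrt x * u)) \<partial>lborel)"
    using x by (subst nn_integral_real_affine[where c="sqrt x" and t=x]) auto
  also have "(\<integral>\<^sup>+ u. ennreal (indicator {0..} (x + sqrt x * u) * (x + sqrt x * u) powr x / exp (x + sqrt x * u)) \<partial>lborel)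
     = (\<integral>\<^sup>+ u. ennreal (x powr x * exp (- x)) * ennreal (stirling_kernel x u) \<partial>lborel)"
  proof (rule nn_integral_cong)
    fix u
    have "indicator {0..} (x + sqrt x * u) * (x + sqrt x * u) powr x / exp (x + sqrt x * u) = x powr x * exp (- x) * stirling_kernel x u"
    proof (cases "u > - sqrt x")
      case True
      have f: "x + sqrt x * u = x * (1 + u / sqrt x)" using x by (simp add: field_simps real_div_sqrt)
      have pos: "1 + u / sqrt x > 0" using True x by (simp add: field_simps)
      have "x + sqrt x * u > 0" unfolding f using pos x by simp
      moreover have "(x + sqrt x * u) powr x = x powr x * exp (x * ln (1 + u / sqrt x))"
        unfolding f using pos x by (subst powr_mult) (simp_all add: powr_def)
      ultimately show ?thesis using True
        by (simp add: stirling_kernel_def exp_add exp_diff exp_minus field_simps)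
    next
      case False
      then have "sqrt x * u \<le> sqrt x * (- sqrt x)" using x by (intro mult_left_mono) auto
      then have "x + sqrt x * u \<le> 0" using x by simp
      then show ?thesis using False by (cases "x + sqrt x * u = 0") (auto simp: stirling_kernel_def)
    qed
    then show "ennreal (indicator {0..} (x + sqrt x * u) * (x + sqrt x * u) powr x / exp (x + sqrt x * u)) = ennreal (x powr x * exp (- x)) * ennreal (stirling_kernel x u)"
      by (simp add: ennreal_mult')
  qed
  also have "\<dots> = ennreal (x powr x * exp (- x)) * (\<integral>\<^sup>+ u. ennreal (stirling_kernel x u) \<partial>lborel)"
    by (rule nn_integral_cmult) measurable
  finally have eq: "ennreal (Gamma (x + 1)) = ennreal (sqrt x) * (ennreal (x powr x * exp (- x)) * (\<integral>\<^sup>+ u. ennreal (stirling_kernel x u) \<partial>lborel))" .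
  have "(\<integral>\<^sup>+ u. ennreal (stirling_kernel x u) \<partial>lborel) < top"
  proof (rule ccontr)
    assume "\<not> ?thesis"
    then have "(\<integral>\<^sup>+ u. ennreal (stirling_kernel x u) \<partial>lborel) = top" using top.not_eq_extremum by blast
    then have "ennreal (Gamma (x + 1)) = top" using eq x by (simp add: ennreal_mult_top)
    then show False by simp
  qed
  moreover have nn: "stirling_kernel x u \<ge> 0" for u by (simp add: stirling_kernel_def)
  ultimately have "(\<integral>\<^sup>+ u. ennreal (stirling_kernel x u) \<partial>lborel) = ennreal (LINT u|lborel. stirling_kernel x u)"
    by (intro nn_integral_eq_integral integrableI_nonneg) auto
  with eq have "ennreal (Gamma (x + 1)) = ennreal (sqrt x * (x powr x * exp (- x) * (LINT u|lborel. stirling_kernel x u)))"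
    using x by (simp add: ennreal_mult')
  then show ?thesis using x nn
    by (subst (asm) ennreal_inj) (auto intro!: mult_nonneg_nonneg integral_nonneg_AE simp: mult_ac)
qed

text \<open>Laplace's method: the kernel converges to a Gaussian and is dominated uniformly in \<open>x \<ge> 1\<close>.\<close>
lemma stirling_Gamma:
  "((\<lambda>x::real. Gamma (x + 1) / (x powr x * exp (- x) * sqrt x)) \<longlongrightarrow> sqrt (2 * pi)) at_top"
proof -
  have [measurable]: "stirling_kernel x \<in> borel_measurable borel" for x
    unfolding stirling_kernel_def by measurable
  have "((\<lambda>x. LINT u|lborel. stirling_kernel x u) \<longlongrightarrow> (LINT u|lborel. exp (- (u\<^sup>2) / 2))) at_top"
  proof (rule integral_dominated_convergence_at_top[where w="\<lambda>u. exp (1/2) * exp (- \<bar>u\<bar> / 2)"])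
    show "integrable lborel (\<lambda>u::real. exp (1/2) * exp (- \<bar>u\<bar> / 2))"
      using integrable_exp_minus_abs by simp
    show "\<forall>\<^sub>F x in at_top. AE u in lborel. norm (stirling_kernel x u) \<le> exp (1/2) * exp (- \<bar>u\<bar> / 2)"
      using eventually_ge_at_top[of 1]
    proof eventually_elim
      case (elim x)
      have "\<bar>stirling_kernel x u\<bar> = stirling_kernel x u" for u by (simp add: stirling_kernel_def)
      then show ?case using stirling_kernel_le[OF elim] by simp
    qed
  qed (use stirling_kernel_tendsto in auto)
  also have "(LINT u|lborel. exp (- (u\<^sup>2) / 2)) = sqrt (2 * pi)"
  proof -
    have "(LINT u|lborel. exp (- (u\<^sup>2) / 2)) = (LINT u|lborel. sqrt (2 * pi) * std_normal_density u)"
      by (intro Bochner_Integration.integral_cong) (auto simp: std_normal_density_def)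
    also have "\<dots> = sqrt (2 * pi)"
      using integral_std_normal_moment_even[of 0] by simp
    finally show ?thesis .
  qed
  finally show ?thesis
    by (rule Lim_transform_eventually)
       (use eventually_gt_at_top[of 0] in \<open>eventually_elim, simp add: Gamma_eq_stirling_kernel\<close>)
qed

text \<open>With \<open>P = 2 / g\<close> and \<open>Q = 2 (g - 1) / g\<close> the arguments are \<open>p = P n + P a\<close> and \<open>q = Q n + Q b\<close>, where
  \<open>P + Q = 2\<close> and \<open>P a + Q b = 0\<close>.  In the logarithm of Stirling's approximation the terms of order \<open>n ln n\<close>,
  \<open>ln n\<close> and \<open>n\<close> cancel by the first relation, and the contribution of the shifts \<open>a\<close>, \<open>b\<close>
  tends to \<open>P a + Q b = 0\<close>.\<close>
lemma Gamma_Stirling_limit: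
  fixes g d :: real
  assumes g: "g > 1"
  defines "p \<equiv> \<lambda>n::nat. (2 * real n + d) / g" and "q \<equiv> \<lambda>n::nat. 2 * real n - (2 * real n + d) / g"
  shows "(\<lambda>n. (g ^ n / (fact (n - 1) * 2 ^ n))\<^sup>2 * ((g - 1) powr (- q n) * Gamma (p n) * Gamma (q n)))
     \<longlonglongrightarrow> g / (2 * sqrt (g - 1))"
proof -
  define S where "S = (\<lambda>x::real. Gamma (x + 1) / (x powr x * exp (- x) * sqrt x))"
  define P Q a b where "P = 2 / g" and "Q = 2 * (g - 1) / g" and "a = d / 2" and "b = - d / (2 * (g - 1))"
  define R where "R = (\<lambda>x. (P * x + P * a - 1/2) * ln (1 + a / x) + (Q * x + Q * b - 1/2) * ln (1 + b / x))"
  \<comment> \<open>The two relations responsible for every cancellation below.\<close>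
  have PQ: "P > 0" "Q > 0" "P + Q = 2" "P * a + Q * b = 0"
    using g by (auto simp: P_def Q_def a_def b_def field_simps)
  have p: "p n = P * real n + P * a" for n using g by (simp add: p_def P_def a_def field_simps)
  have q: "q n = Q * real n + Q * b" for n using g by (simp add: q_def Q_def b_def field_simps)
  have pt: "filterlim p at_top sequentially" unfolding p using PQ by real_asymp
  have qt: "filterlim q at_top sequentially" unfolding q using PQ by real_asymp
  have Sp: "(\<lambda>n. S (p n)) \<longlonglongrightarrow> sqrt (2 * pi)" and Sq: "(\<lambda>n. S (q n)) \<longlonglongrightarrow> sqrt (2 * pi)"
    and Sn: "(\<lambda>n. S (real n)) \<longlonglongrightarrow> sqrt (2 * pi)"
    using filterlim_compose[OF stirling_Gamma pt] filterlim_compose[OF stirling_Gamma qt]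
      filterlim_compose[OF stirling_Gamma filterlim_real_sequentially] by (simp_all add: S_def)
  have R: "(R \<longlongrightarrow> 0) at_top"
  proof -
    have "(R \<longlongrightarrow> P * a + Q * b) at_top" unfolding R_def by real_asymp
    then show ?thesis using PQ by simp
  qed
  have R': "(\<lambda>n. R (real n)) \<longlonglongrightarrow> 0"
    by (rule filterlim_compose[OF R filterlim_real_sequentially])
  have Gam: "Gamma x = S x * exp ((x - 1/2) * ln x - x)" if "x > 0" for x
  proof -
    have "Gamma (x + 1) = x * Gamma x" using that by (intro Gamma_plus1) (auto dest: nonpos_Ints_nonpos)
    moreover have "x powr x * exp (- x) * sqrt x = x * exp ((x - 1/2) * ln x - x)"
    proof -
      have "sqrt x = exp (ln x / 2)" using that by (simp add: powr_half_sqrt[symmetric] powr_def)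
      then have "x powr x * exp (- x) * sqrt x = exp (x * ln x + - x + ln x / 2)"
        using that by (simp only: exp_add) (simp add: powr_def)
      also have "x * ln x + - x + ln x / 2 = ln x + ((x - 1/2) * ln x - x)" by (simp add: field_simps)
      also have "exp \<dots> = x * exp ((x - 1/2) * ln x - x)" using that by (simp only: exp_add) simp
      finally show ?thesis .
    qed
    ultimately show ?thesis using that by (simp add: S_def)
  qed
  have ev: "eventually (\<lambda>n. S (p n) * S (q n) / (S (real n))\<^sup>2 * (g / 2 * (g - 1) powr (-1/2) * exp (R (real n)))
      = (g ^ n / (fact (n - 1) * 2 ^ n))\<^sup>2 * ((g - 1) powr (- q n) * Gamma (p n) * Gamma (q n))) sequentially"
  proof -
    have "eventually (\<lambda>n. p n > 0) sequentially" "eventually (\<lambda>n. q n > 0) sequentially"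
      using pt qt by (auto simp: filterlim_at_top_dense)
    then show ?thesis using eventually_gt_at_top[of 0]
    proof eventually_elim
      case (elim n)
      define N where "N = real n"
      have N: "N > 0" "fact (n - 1) = Gamma N" using elim Gamma_fact[of "n - 1", where ?'a = real] by (auto simp: N_def of_nat_diff)
      have pq: "p n + q n = 2 * N" by (simp add: p_def q_def N_def)
      have p': "p n = P * N * (1 + a / N)" and q': "q n = Q * N * (1 + b / N)"
        using elim(3) by (simp_all add: p q N_def distrib_left)
      have pos: "1 + a / N > 0" "1 + b / N > 0"
        using zero_less_mult_pos[OF elim(1)[unfolded p'], OF mult_pos_pos[OF PQ(1) N(1)]]
          zero_less_mult_pos[OF elim(2)[unfolded q'], OF mult_pos_pos[OF PQ(2) N(1)]] by auto
      have lnp: "ln (p n) = ln P + ln N + ln (1 + a / N)" unfolding p' using PQ N pos by (simp add: ln_mult)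
      have lnq: "ln (q n) = ln Q + ln N + ln (1 + b / N)" unfolding q' using PQ N pos by (simp add: ln_mult)
      have lnP: "ln P = ln 2 - ln g" and lnQ: "ln Q = ln 2 - ln g + ln (g - 1)"
        using g ln_mult[of 2 "g - 1"] by (simp_all add: P_def Q_def ln_div)
      have RN: "R N = (p n - 1/2) * ln (1 + a / N) + (q n - 1/2) * ln (1 + b / N)"
        by (simp add: R_def p q N_def)
      \<comment> \<open>The exponent after Stirling: everything that grows with \<open>N\<close> cancels.\<close>
      have E: "2 * (N * ln g) - 2 * (N * ln 2) - q n * ln (g - 1) + ((p n - 1/2) * ln (p n) - p n) + ((q n - 1/2) * ln (q n) - q n)
          - 2 * ((N - 1/2) * ln N - N) = ln g - ln 2 - 1/2 * ln (g - 1) + R N"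
      proof -
        have qn: "q n = 2 * N - p n" using pq by simp
        show ?thesis unfolding RN lnp lnq lnP lnQ unfolding qn by (simp add: algebra_simps)
      qed
      have "(g ^ n / (fact (n - 1) * 2 ^ n))\<^sup>2 * ((g - 1) powr (- q n) * Gamma (p n) * Gamma (q n))
         = S (p n) * S (q n) / (S N)\<^sup>2 * exp (2 * (N * ln g) - 2 * (N * ln 2) - q n * ln (g - 1) + ((p n - 1/2) * ln (p n) - p n) + ((q n - 1/2) * ln (q n) - q n)
          - 2 * ((N - 1/2) * ln N - N))"
      proof -
        have pw: "g ^ n = exp (N * ln g)" "(2::real) ^ n = exp (N * ln 2)" "(g - 1) powr (- q n) = inverse (exp (q n * ln (g - 1)))"
          using g by (simp_all add: N_def exp_of_nat_mult powr_def exp_minus)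
        have sq: "(exp x)\<^sup>2 = exp (2 * x)" for x :: real by (simp add: power2_eq_square flip: exp_add)
        have ex: "exp (2 * (N * ln g) - 2 * (N * ln 2) - q n * ln (g - 1) + ((p n - 1/2) * ln (p n) - p n) + ((q n - 1/2) * ln (q n) - q n)
          - 2 * ((N - 1/2) * ln N - N)) = (exp (N * ln g))\<^sup>2 / (exp (N * ln 2))\<^sup>2 / exp (q n * ln (g - 1)) *
            exp ((p n - 1/2) * ln (p n) - p n) * exp ((q n - 1/2) * ln (q n) - q n) / (exp ((N - 1/2) * ln N - N))\<^sup>2"
          unfolding sq by (simp only: exp_add exp_diff)
        show ?thesis
          unfolding N(2) Gam[OF elim(1)] Gam[OF elim(2)] Gam[OF N(1)] pw ex
          by (simp only: divide_inverse power_mult_distrib power_inverse inverse_mult_distrib mult_ac)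
      qed
      also have "\<dots> = S (p n) * S (q n) / (S N)\<^sup>2 * (g / 2 * (g - 1) powr (-1/2) * exp (R N))"
      proof -
        have "(g - 1) powr (-1/2) = 1 / exp (1/2 * ln (g - 1))"
          using g by (simp add: powr_def exp_minus inverse_eq_divide)
        then show ?thesis unfolding E exp_add exp_diff using g by simp
      qed
      finally show ?case by (simp add: N_def)
    qed
  qed
  have "(\<lambda>n. S (p n) * S (q n) / (S (real n))\<^sup>2 * (g / 2 * (g - 1) powr (-1/2) * exp (R (real n))))
     \<longlonglongrightarrow> sqrt (2 * pi) * sqrt (2 * pi) / (sqrt (2 * pi))\<^sup>2 * (g / 2 * (g - 1) powr (-1/2) * exp 0)"
    by (intro tendsto_intros Sp Sq Sn R') auto
  also have "sqrt (2 * pi) * sqrt (2 * pi) / (sqrt (2 * pi))\<^sup>2 * (g / 2 * (g - 1) powr (-1/2) * exp 0) = g / (2 * sqrt (g - 1))"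
    using g by (simp add: powr_minus powr_half_sqrt field_simps)
  finally show ?thesis using ev by (rule Lim_transform_eventually)
qed

section \<open>Laplace integrals\<close>

lemma integrable_power_exp:
  fixes a :: real assumes a: "a > 0"
  shows "integrable lborel (\<lambda>t. indicator {0<..} t *\<^sub>R (t ^ m * exp (- (t * a))))"
proof (rule integrableI_nonneg)
  have "(\<integral>\<^sup>+ t. ennreal (indicator {0<..} t *\<^sub>R (t ^ m * exp (- (t * a)))) \<partial>lborel)
     = (\<integral>\<^sup>+ t. ennreal (t powr real m * exp (- (a * t powr 1))) * indicator {0<..} t \<partial>lborel)"
    by (intro nn_integral_cong) (auto simp: indicator_def powr_realpow mult.commute)
  also have "\<dots> < \<infinity>" by (subst nn_integral_powr_exp_powr) (use a in auto)
  finally show "(\<integral>\<^sup>+ t. ennreal (indicator {0<..} t *\<^sub>R (t ^ m * exp (- (t * a)))) \<partial>lborel) < \<infinity>" .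
qed (auto simp: indicator_def)

lemma integrable_power_exp_complex:
  assumes A: "Re A > 0"
  shows "integrable lborel (\<lambda>t. indicator {0<..} t *\<^sub>R (of_real (t ^ m) * exp (- (of_real t * A))))"
  by (rule Bochner_Integration.integrable_bound[OF integrable_power_exp[OF A, of m]])
     (auto simp: norm_mult indicator_def norm_power intro!: AE_I2)

lemma power_exp_tendsto_0:
  assumes A: "Re A > 0"
  shows "((\<lambda>t. of_real (t ^ m) * exp (- (of_real t * A))) \<longlongrightarrow> (0::complex)) at_top"
proof (rule tendsto_norm_zero_cancel)
  have "((\<lambda>t. t ^ m * exp (- (t * Re A))) \<longlongrightarrow> 0) at_top" using A by real_asymp
  then show "((\<lambda>t. norm (of_real (t ^ m) * exp (- (of_real t * A)))) \<longlongrightarrow> 0) at_top"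
    by (rule Lim_transform_eventually)
       (use eventually_ge_at_top[of 0] in \<open>eventually_elim, simp add: norm_mult norm_power\<close>)
qed

text \<open>Induction on \<open>m\<close>: the derivative of \<open>t^(m + 1) exp (- t A)\<close> has integral zero, which is the recursion
  \<open>A I\<^sub>m\<^sub>+\<^sub>1 = (m + 1) I\<^sub>m\<close>.\<close>
lemma laplace_power:
  assumes A: "Re A > 0"
  shows "(LINT t|lborel. indicator {0<..} t *\<^sub>R (of_real (t ^ m) * exp (- (of_real t * A)))) = fact m / A ^ (m + 1)"
proof -
  have A0: "A \<noteq> 0" using A by force
  show ?thesis
  proof (induction m)
    case 0
    have "(LBINT t=0..\<infinity>. exp (- (of_real t * A))) = 0 - (- (1 / A))"
    proof (rule interval_integral_FTC_integrable)
      show "((\<lambda>t. - (exp (- (of_real t * A)) / A)) has_vector_derivative exp (- (of_real t * A))) (at t)" for t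
        by (rule has_vector_derivative_real_field) (use A0 in \<open>auto intro!: derivative_eq_intros\<close>)
      show "set_integrable lborel (einterval 0 \<infinity>) (\<lambda>t. exp (- (of_real t * A)))"
        using integrable_power_exp_complex[OF A, of 0] by (simp add: set_integrable_def einterval_def zero_ereal_def greaterThan_def)
      show "(((\<lambda>t. - (exp (- (of_real t * A)) / A)) \<circ> real_of_ereal) \<longlongrightarrow> - (1 / A)) (at_right 0)"
        unfolding zero_ereal_def ereal_tendsto_simps using A0 by (auto intro!: tendsto_eq_intros)
      have "((\<lambda>t. - (exp (- (of_real t * A)) / A)) \<longlongrightarrow> - (0 / A)) at_top"
        using power_exp_tendsto_0[OF A, of 0] A0 by (intro tendsto_intros) auto
      then show "(((\<lambda>t. - (exp (- (of_real t * A)) / A)) \<circ> real_of_ereal) \<longlongrightarrow> 0) (at_left \<infinity>)"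
        unfolding ereal_tendsto_simps by simp
    qed auto
    then show ?case by (simp add: interval_lebesgue_integral_def set_lebesgue_integral_def einterval_def zero_ereal_def greaterThan_def)
  next
    case (Suc m)
    let ?F = "\<lambda>m t. of_real (t ^ m) * exp (- (of_real t * A))"
    let ?f = "\<lambda>t. of_real (Suc m) * ?F m t - A * ?F (Suc m) t"
    have i: "integrable lborel (\<lambda>t. indicator {0<..} t *\<^sub>R ?F m t)" for m
      by (rule integrable_power_exp_complex[OF A])
    have "(LBINT t=0..\<infinity>. ?f t) = 0 - 0"
    proof (rule interval_integral_FTC_integrable)
      show "(?F (Suc m) has_vector_derivative ?f t) (at t)" for t
        unfolding of_real_power
        by (rule has_vector_derivative_real_field)
           (auto intro!: derivative_eq_intros simp: algebra_simps, metis One_nat_def power_eq_if)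
      show "set_integrable lborel (einterval 0 \<infinity>) ?f"
        using Bochner_Integration.integrable_diff[OF integrable_mult_right[OF i[of m], of "of_nat (Suc m)"] integrable_mult_right[OF i[of "Suc m"], of A]]
        by (simp add: set_integrable_def einterval_def zero_ereal_def greaterThan_def scaleR_conv_of_real algebra_simps)
      show "((?F (Suc m) \<circ> real_of_ereal) \<longlongrightarrow> 0) (at_right 0)"
        unfolding zero_ereal_def ereal_tendsto_simps by (auto intro!: tendsto_eq_intros)
      show "((?F (Suc m) \<circ> real_of_ereal) \<longlongrightarrow> 0) (at_left \<infinity>)"
        unfolding ereal_tendsto_simps by (rule power_exp_tendsto_0[OF A])
      show "isCont ?f t" for t by (intro continuous_intros)
    qed auto
    then have "0 = (LINT t|lborel. of_nat (Suc m) * (indicator {0<..} t *\<^sub>R ?F m t) - A * (indicator {0<..} t *\<^sub>R ?F (Suc m) t))"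
      by (simp add: interval_lebesgue_integral_def set_lebesgue_integral_def einterval_def zero_ereal_def greaterThan_def scaleR_conv_of_real algebra_simps)
    also have "\<dots> = of_nat (Suc m) * (fact m / A ^ (m + 1)) - A * (LINT t|lborel. indicator {0<..} t *\<^sub>R ?F (Suc m) t)"
      unfolding Suc.IH[symmetric]
      by (subst Bochner_Integration.integral_diff[OF integrable_mult_right[OF i] integrable_mult_right[OF i]])
         (simp only: integral_mult_right_zero)
    finally show ?case using A0 by (simp add: field_simps)
  qed
qed

text \<open>Lagrange's argument: \<open>2 u(x) v(y) u(y) v(x) \<le> (u(x) v(y))\<^sup>2 + (u(y) v(x))\<^sup>2\<close> is integrated over both
  variables.  In this form infinite integrals need no separate treatment.\<close>
lemma nn_integral_Cauchy_Schwarz: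
  assumes [measurable]: "u \<in> borel_measurable M" "v \<in> borel_measurable M"
  shows "(\<integral>\<^sup>+ x. u x * v x \<partial>M)\<^sup>2 \<le> (\<integral>\<^sup>+ x. (u x)\<^sup>2 \<partial>M) * (\<integral>\<^sup>+ x. (v x)\<^sup>2 \<partial>M)"
proof -
  let ?X = "\<integral>\<^sup>+ x. u x * v x \<partial>M" and ?U = "\<integral>\<^sup>+ x. (u x)\<^sup>2 \<partial>M" and ?V = "\<integral>\<^sup>+ x. (v x)\<^sup>2 \<partial>M"
  have am: "2 * (a * b) \<le> a\<^sup>2 + b\<^sup>2" for a b :: ennreal
  proof (cases a; cases b)
    fix a' b' :: real assume "0 \<le> a'" "a = ennreal a'" "0 \<le> b'" "b = ennreal b'"
    then show ?thesis using sum_squares_bound[of a' b']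
      by (simp add: ennreal_power flip: ennreal_mult' ennreal_plus ennreal_numeral)
  qed (auto simp: power2_eq_square)
  have "2 * ?X\<^sup>2 = (\<integral>\<^sup>+ x. \<integral>\<^sup>+ y. 2 * ((u x * v x) * (u y * v y)) \<partial>M \<partial>M)"
    by (simp add: nn_integral_cmult nn_integral_multc power2_eq_square)
  also have "\<dots> = (\<integral>\<^sup>+ x. \<integral>\<^sup>+ y. 2 * ((u x * v y) * (u y * v x)) \<partial>M \<partial>M)"
    by (simp add: mult_ac)
  also have "\<dots> \<le> (\<integral>\<^sup>+ x. \<integral>\<^sup>+ y. (u x * v y)\<^sup>2 + (u y * v x)\<^sup>2 \<partial>M \<partial>M)"
    by (intro nn_integral_mono am)
  also have "\<dots> = ?U * ?V + ?U * ?V"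
    by (simp add: power_mult_distrib nn_integral_add nn_integral_cmult nn_integral_multc)
  also have "\<dots> = 2 * (?U * ?V)" by (simp add: mult_2)
  finally show ?thesis by (simp add: ennreal_mult_le_mult_iff)
qed

lemma power_exp_le:
  fixes t a :: real assumes "t \<ge> 0" "a > 0"
  shows "t ^ m / fact m * exp (- (t * a)) \<le> 1 / a ^ m"
proof -
  have "(t * a) ^ m / fact m \<le> exp (t * a)"
  proof -
    have "(\<Sum>i\<in>{m}. (t * a) ^ i / fact i) \<le> (\<Sum>i. (t * a) ^ i / fact i)"
      using exp_converges[of "t * a"] assms
      by (intro sum_le_suminf) (auto simp: sums_iff divide_inverse mult.commute)
    also have "\<dots> = exp (t * a)"
      using exp_converges[of "t * a"] by (simp add: sums_iff divide_inverse mult.commute)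
    finally show ?thesis by simp

  qed
  then show ?thesis using assms by (simp add: exp_minus power_mult_distrib field_simps)
qed

text \<open>The function of the frequency whose transform, at \<open>s\<^sub>0\<close>, is the superposition of the kernels
  \<open>1 / (b + a + i (\<sigma> - s\<^sub>0))^(m + 1)\<close> with density \<open>\<Phi>\<close>.\<close>
definition laplace_symbol ::
    "nat \<Rightarrow> real \<Rightarrow> 'a measure \<Rightarrow> ('a \<Rightarrow> complex) \<Rightarrow> ('a \<Rightarrow> real) \<Rightarrow> ('a \<Rightarrow> real) \<Rightarrow> real \<Rightarrow> complex" where
  "laplace_symbol m a M \<Phi> b \<sigma> t = indicator {0<..} t *\<^sub>R (of_real (t ^ m / fact m * exp (- (t * a))) *
     (LINT x|M. \<Phi> x * of_real (exp (- (t * b x))) * cis (- (t * \<sigma> x))))"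

lemma laplace_integrand_bound:
  assumes "b x \<ge> 0" "t > 0"
  shows "norm (\<Phi> x * of_real (exp (- (t * b x))) * cis (- (t * \<sigma> x)) :: complex) \<le> norm (\<Phi> x)"
  using assms by (simp add: norm_mult mult_left_le)

lemma norm_laplace_integral_le:
  assumes \<Phi>: "integrable M \<Phi>" and b: "\<And>x. b x \<ge> 0" and t: "t > 0" and [measurable]: "b \<in> borel_measurable M" "\<sigma> \<in> borel_measurable M"
  shows "norm (LINT x|M. \<Phi> x * of_real (exp (- (t * b x))) * cis (- (t * \<sigma> x))) \<le> (LINT x|M. norm (\<Phi> x))"
proof -
  have [measurable]: "\<Phi> \<in> borel_measurable M" using \<Phi> by simp
  have "norm (LINT x|M. \<Phi> x * of_real (exp (- (t * b x))) * cis (- (t * \<sigma> x)))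
     \<le> (LINT x|M. norm (\<Phi> x * of_real (exp (- (t * b x))) * cis (- (t * \<sigma> x))))"
    by (rule integral_norm_bound)
  also have "\<dots> \<le> (LINT x|M. norm (\<Phi> x))"
  proof (rule integral_mono_AE)
    show "integrable M (\<lambda>x. norm (\<Phi> x * of_real (exp (- (t * b x))) * cis (- (t * \<sigma> x))))"
      by (rule integrable_norm, rule Bochner_Integration.integrable_bound[OF \<Phi>])
         (use laplace_integrand_bound[of b _ t \<Phi> \<sigma>, OF b t] in \<open>auto intro!: AE_I2\<close>)
  qed (use \<Phi> laplace_integrand_bound[of b _ t \<Phi> \<sigma>, OF b t] in auto)
  finally show ?thesis .
qed

lemma laplace_symbol_bound:
  assumes "integrable M \<Phi>" "\<And>x. b x \<ge> 0" "b \<in> borel_measurable M" "\<sigma> \<in> borel_measurable M" and a: "a > 0"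
  shows "norm (laplace_symbol m a M \<Phi> b \<sigma> t) \<le> 1 / a ^ m * (LINT x|M. norm (\<Phi> x))"
proof (cases "t > 0")
  case True
  have "norm (laplace_symbol m a M \<Phi> b \<sigma> t) = (t ^ m / fact m * exp (- (t * a))) * norm (LINT x|M. \<Phi> x * of_real (exp (- (t * b x))) * cis (- (t * \<sigma> x)))"
    using True by (simp add: laplace_symbol_def norm_mult norm_divide norm_power)
  also have "\<dots> \<le> 1 / a ^ m * (LINT x|M. norm (\<Phi> x))"
    using power_exp_le[of t a m] True a norm_laplace_integral_le[OF assms(1,2) True assms(3,4)]
    by (intro mult_mono) auto
  finally show ?thesis .
qed (use a in \<open>auto simp: laplace_symbol_def intro!: divide_nonneg_nonneg integral_nonneg_AE\<close>)

text \<open>Expanding the kernel by \<open>laplace_power\<close> turns the integral over \<open>M\<close> into a Fourier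
  integral.  The factor \<open>exp (- t a)\<close> with \<open>a > 0\<close> is what makes Fubini's theorem applicable for a merely integrable
  density.\<close>
lemma laplace_representation:
  fixes M :: "'a measure" and \<Phi> :: "'a \<Rightarrow> complex"
  assumes "sigma_finite_measure M" and \<Phi>: "integrable M \<Phi>" and b: "\<And>x. b x \<ge> 0" and a: "a > 0"
    and bm[measurable]: "b \<in> borel_measurable M" and sm[measurable]: "\<sigma> \<in> borel_measurable M"
  shows "integrable lborel (laplace_symbol m a M \<Phi> b \<sigma>)" (is ?th1)
    and "(LINT x|M. \<Phi> x / Complex (b x + a) (\<sigma> x - s0) ^ (m + 1)) = ft (laplace_symbol m a M \<Phi> b \<sigma>) s0" (is ?th2)
proof -
  interpret sigma_finite_measure M by fact
  interpret P: pair_sigma_finite lborel M by standard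
  have [measurable]: "\<Phi> \<in> borel_measurable M" using \<Phi> by simp
  let ?g = "\<lambda>t x. \<Phi> x * of_real (exp (- (t * b x))) * cis (- (t * \<sigma> x))"
  let ?e = "\<lambda>t. indicator {0<..} t *\<^sub>R (t ^ m * exp (- (t * a)))"
  let ?K = "\<lambda>s t x. of_real (?e t / fact m) * ?g t x * cis (s * t)"
  have Kint: "integrable (lborel \<Otimes>\<^sub>M M) (\<lambda>(t, x). ?K s t x)" for s
  proof (rule Bochner_Integration.integrable_bound)
    show "integrable (lborel \<Otimes>\<^sub>M M) (\<lambda>(t, x). ?e t * norm (\<Phi> x))"
    proof (rule P.Fubini_integrable)
      have "(LINT x|M. norm (?e t * norm (\<Phi> x))) = norm (?e t) * (LINT x|M. norm (\<Phi> x))" for t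
        by (subst norm_mult) (simp only: real_norm_def abs_norm_cancel integral_mult_right_zero)
      then show "integrable lborel (\<lambda>t. LINT x|M. norm (case (t, x) of (t, x) \<Rightarrow> ?e t * norm (\<Phi> x)))"
        using integrable_mult_left[OF integrable_norm[OF integrable_power_exp[OF a, of m]], of "LINT x|M. norm (\<Phi> x)"] by (simp only: prod.case)
    qed (use \<Phi> in \<open>auto intro!: AE_I2\<close>)
    have "norm (?K s t x) \<le> ?e t * norm (\<Phi> x)" for t x
    proof (cases "t > 0")
      case True
      then have "norm (?K s t x) = ?e t / fact m * norm (?g t x)"
        by (simp add: norm_mult norm_divide norm_power)
      also have "\<dots> \<le> ?e t / 1 * norm (\<Phi> x)"
        using laplace_integrand_bound[of b x t \<Phi> \<sigma>, OF b True] True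
        by (intro mult_mono divide_left_mono) auto
      finally show ?thesis by simp
    qed simp
    then show "AE p in lborel \<Otimes>\<^sub>M M. norm (case p of (t, x) \<Rightarrow> ?K s t x) \<le> norm (case p of (t, x) \<Rightarrow> ?e t * norm (\<Phi> x))"
      by (auto intro!: AE_I2 intro: order_trans[OF _ abs_ge_self])
  qed measurable
  have sym: "(LINT x|M. ?K s t x) = laplace_symbol m a M \<Phi> b \<sigma> t * cis (s * t)" for s t
    by (cases "t > 0") (simp_all add: laplace_symbol_def)
  have "integrable lborel (\<lambda>t. LINT x|M. ?K 0 t x)"
    using P.integrable_fst'[OF Kint[of 0]] by simp
  then show ?th1 by (simp only: sym) simp
  have "ft (laplace_symbol m a M \<Phi> b \<sigma>) s0 = (LINT t|lborel. LINT x|M. ?K s0 t x)"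
    by (simp only: ft_def sym)
  also have "\<dots> = (LINT x|M. LINT t|lborel. ?K s0 t x)"
    by (rule P.Fubini_integral[symmetric]) (rule Kint)
  also have "\<dots> = (LINT x|M. \<Phi> x / Complex (b x + a) (\<sigma> x - s0) ^ (m + 1))"
  proof (intro Bochner_Integration.integral_cong refl)
    fix x
    let ?A = "Complex (b x + a) (\<sigma> x - s0)"
    have "?K s0 t x = \<Phi> x / fact m * (indicator {0<..} t *\<^sub>R (of_real (t ^ m) * exp (- (of_real t * ?A))))" for t
    proof -
      have "exp (- (of_real t * ?A)) = of_real (exp (- (t * a))) * of_real (exp (- (t * b x))) * (cis (- (t * \<sigma> x)) * cis (s0 * t))"
        by (simp add: exp_eq_polar cis_mult algebra_simps flip: exp_add of_real_mult)
      then show ?thesis by (simp add: scaleR_conv_of_real mult_ac)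
    qed
    then have "(LINT t|lborel. ?K s0 t x) = \<Phi> x / fact m * (LINT t|lborel. indicator {0<..} t *\<^sub>R (of_real (t ^ m) * exp (- (of_real t * ?A))))"
      by (simp only: integral_mult_right_zero)
    also have "(LINT t|lborel. indicator {0<..} t *\<^sub>R (of_real (t ^ m) * exp (- (of_real t * ?A)))) = fact m / ?A ^ (m + 1)"
      using a b[of x] by (intro laplace_power) (simp add: add_nonneg_pos)
    finally have "(LINT t|lborel. ?K s0 t x) = \<Phi> x / fact m * (fact m / ?A ^ (m + 1))" .
    then show "(LINT t|lborel. ?K s0 t x) = \<Phi> x / ?A ^ (m + 1)" by simp
  qed
  finally show ?th2 by simp
qed

section \<open>The radial operators and their rank-one fibers\<close>

lemma ft_cmult: "ft (\<lambda>t. c * h t) s = c * ft h s"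
  unfolding ft_def mult.assoc by (rule integral_mult_right_zero)

abbreviation plane :: "(real \<times> real) measure" where
  "plane \<equiv> lborel \<Otimes>\<^sub>M lborel"

text \<open>The operator \<open>leray_k\<close> stripped of its angular factor and written in the coordinates \<open>s\<close>, \<open>\<alpha>\<close>.\<close>
definition leray_op :: "real \<Rightarrow> nat \<Rightarrow> (real \<Rightarrow> real \<Rightarrow> complex) \<Rightarrow> real \<Rightarrow> real \<Rightarrow> complex" where
  "leray_op \<gamma> k G s0 a0 = of_real (\<gamma>\<^sup>2 * (real k + 1) / (2 * pi)) *
     (LINT \<alpha>:{0<..}|lborel. LINT s|lborel.
         of_real (leray_B \<gamma> a0 \<alpha>) ^ k / leray_A \<gamma> s0 a0 s \<alpha> ^ (k + 2) * G s \<alpha> * of_real (\<alpha> powr (\<gamma> - 1)))"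

text \<open>The factors of the integrand of \<open>leray_op\<close> that depend only on the integration variables.\<close>
definition leray_density :: "real \<Rightarrow> nat \<Rightarrow> (real \<Rightarrow> real \<Rightarrow> complex) \<Rightarrow> real \<times> real \<Rightarrow> complex" where
  "leray_density \<gamma> k G = (\<lambda>(\<alpha>, s). indicator {0<..} \<alpha> *\<^sub>R (of_real (\<alpha> powr ((\<gamma> - 1) * (real k + 1))) * G s \<alpha>))"

abbreviation measurable2 :: "(real \<Rightarrow> real \<Rightarrow> complex) \<Rightarrow> bool" where
  "measurable2 G \<equiv> (\<lambda>(s, \<alpha>). G s \<alpha>) \<in> borel_measurable (borel \<Otimes>\<^sub>M borel)"

definition weight :: "real \<Rightarrow> real \<Rightarrow> ennreal" where
  "weight r \<alpha> = ennreal (indicator {0<..} \<alpha> * \<alpha> powr r)"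

lemma borel_measurable_weight [measurable]: "weight r \<in> borel_measurable borel"
  unfolding weight_def by measurable

text \<open>The squared norm in \<open>L\<^sup>2(\<alpha>^r ds d\<alpha>)\<close>.\<close>
definition energy :: "real \<Rightarrow> (real \<Rightarrow> real \<Rightarrow> complex) \<Rightarrow> ennreal" where
  "energy r G = (\<integral>\<^sup>+ \<alpha>. sqnorm (\<lambda>s. G s \<alpha>) * weight r \<alpha> \<partial>lborel)"

text \<open>The constant of \<open>leray_op\<close> with the factor \<open>\<gamma>^k\<close> of \<open>leray_B^k\<close> and the factor \<open>1 / (k + 1)!\<close> of the Laplace
  integral absorbed.\<close>
definition leray_const :: "real \<Rightarrow> nat \<Rightarrow> real" where
  "leray_const \<gamma> k = \<gamma> ^ (k + 2) / (2 * pi * fact k)"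

text \<open>The component of \<open>leray_op \<gamma> k G\<close> at frequency \<open>t\<close>, a multiple of \<open>u\<^sub>t(a0)\<close>; the number \<open>W t\<close>
  stands for the inner product of \<open>v\<^sub>t\<close> with the component of \<open>G\<close> at that frequency.\<close>
definition fiber :: "real \<Rightarrow> nat \<Rightarrow> (real \<Rightarrow> complex) \<Rightarrow> real \<Rightarrow> real \<Rightarrow> complex" where
  "fiber \<gamma> k W a0 t = indicator {0<..} t *\<^sub>R (of_real (leray_const \<gamma> k * t ^ (k + 1) * a0 ^ k * exp (- (t * a0 powr \<gamma>))) * W t)"

text \<open>The inner product of \<open>v\<^sub>t\<close> with the Fourier transform of \<open>G\<close> in \<open>s\<close>, as one integral over the half-plane;
  \<open>moment_eq_ft\<close> carries out the integration in \<open>s\<close>.\<close>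
definition moment :: "real \<Rightarrow> nat \<Rightarrow> (real \<Rightarrow> real \<Rightarrow> complex) \<Rightarrow> real \<Rightarrow> complex" where
  "moment \<gamma> k G t = (LINT x|plane. leray_density \<gamma> k G x *
      of_real (exp (- (t * ((\<gamma> - 1) * fst x powr \<gamma>)))) * cis (- (t * snd x)))"

lemma fiber_eq_laplace_symbol:
  "fiber \<gamma> k (moment \<gamma> k G) a0 t = of_real (\<gamma>\<^sup>2 * (real k + 1) / (2 * pi) * \<gamma> ^ k * a0 ^ k) *
     laplace_symbol (k + 1) (a0 powr \<gamma>) plane (leray_density \<gamma> k G) (\<lambda>x. (\<gamma> - 1) * fst x powr \<gamma>) snd t"
proof -
  have c: "leray_const \<gamma> k = \<gamma>\<^sup>2 * (real k + 1) / (2 * pi) * \<gamma> ^ k / fact (k + 1)"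
    by (simp add: leray_const_def power_add divide_simps power2_eq_square)
  have "leray_const \<gamma> k * t ^ (k + 1) * a0 ^ k * exp (- (t * a0 powr \<gamma>))
     = \<gamma>\<^sup>2 * (real k + 1) / (2 * pi) * \<gamma> ^ k * a0 ^ k * (t ^ (k + 1) / fact (k + 1) * exp (- (t * a0 powr \<gamma>)))"
    unfolding c by simp
  then have "complex_of_real (leray_const \<gamma> k * t ^ (k + 1) * a0 ^ k * exp (- (t * a0 powr \<gamma>)))
     = of_real (\<gamma>\<^sup>2 * (real k + 1) / (2 * pi) * \<gamma> ^ k * a0 ^ k) * of_real (t ^ (k + 1) / fact (k + 1) * exp (- (t * a0 powr \<gamma>)))"
    by (simp only: of_real_mult)
  then show ?thesis unfolding fiber_def laplace_symbol_def moment_def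
    by (simp only: mult_scaleR_right mult.assoc)
qed

lemma norm_leray_integrand_le:
  assumes g: "\<gamma> > 1" and a0: "a0 > 0"
  shows "norm (z / Complex ((\<gamma> - 1) * x powr \<gamma> + a0 powr \<gamma>) y ^ m) \<le> norm (of_real (1 / (a0 powr \<gamma>) ^ m) * z)"
proof -
  let ?D = "Complex ((\<gamma> - 1) * x powr \<gamma> + a0 powr \<gamma>) y"
  have a: "a0 powr \<gamma> > 0" using a0 by simp
  have "a0 powr \<gamma> \<le> \<bar>Re ?D\<bar>" using g a by simp
  also have "\<dots> \<le> cmod ?D" by (rule abs_Re_le_cmod)
  finally have le: "a0 powr \<gamma> \<le> cmod ?D" .
  then have pos: "cmod ?D > 0" using a by linarith
  from le have "(a0 powr \<gamma>) ^ m \<le> cmod ?D ^ m" using a by (intro power_mono) auto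
  then have "1 / cmod ?D ^ m \<le> 1 / (a0 powr \<gamma>) ^ m"
    by (intro divide_left_mono mult_pos_pos zero_less_power a pos) auto
  then have "norm z * (1 / cmod ?D ^ m) \<le> norm z * (1 / (a0 powr \<gamma>) ^ m)"
    by (rule mult_left_mono) simp
  then show ?thesis
    by (simp only: norm_mult norm_divide norm_power norm_of_real) (simp add: mult.commute)
qed

lemma leray_op_eq_integral:
  assumes g: "\<gamma> > 1" and a0: "a0 > 0" and int: "integrable plane (leray_density \<gamma> k G)"
  shows "leray_op \<gamma> k G s0 a0 = of_real (\<gamma>\<^sup>2 * (real k + 1) / (2 * pi)) * (of_real (\<gamma> ^ k * a0 ^ k) *
     (LINT x|plane. leray_density \<gamma> k G x / Complex ((\<gamma> - 1) * fst x powr \<gamma> + a0 powr \<gamma>) (snd x - s0) ^ (k + 2)))"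
proof -
  let ?P = "leray_density \<gamma> k G" and ?b = "\<lambda>x::real \<times> real. (\<gamma> - 1) * fst x powr \<gamma>"
  let ?c = "complex_of_real (\<gamma>\<^sup>2 * (real k + 1) / (2 * pi))"
  let ?D = "\<lambda>x. Complex (?b x + a0 powr \<gamma>) (snd x - s0)"
  have b: "?b x \<ge> 0" for x using g by simp
  have a: "a0 powr \<gamma> > 0" using a0 by simp
  have [measurable]: "?P \<in> borel_measurable (borel \<Otimes>\<^sub>M borel)"
    using borel_measurable_integrable[OF int] by (simp cong: measurable_cong_sets)
  have i: "integrable plane (\<lambda>x. ?P x / ?D x ^ (k + 2))"
  proof (rule Bochner_Integration.integrable_bound)
    show "integrable plane (\<lambda>x. of_real (1 / (a0 powr \<gamma>) ^ (k + 2)) * ?P x)"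
      using int by (intro integrable_mult_right)
    have meas: "(\<lambda>x. Complex (?b x + a0 powr \<gamma>) (snd x - s0)) \<in> borel_measurable (borel \<Otimes>\<^sub>M borel)"
      unfolding Complex_eq by measurable
    then show "(\<lambda>x. ?P x / ?D x ^ (k + 2)) \<in> borel_measurable plane"
      by measurable
    show "AE x in plane. norm (?P x / ?D x ^ (k + 2)) \<le> norm (of_real (1 / (a0 powr \<gamma>) ^ (k + 2)) * ?P x)"
      by (intro AE_I2 norm_leray_integrand_le g a0)
  qed
  have "leray_op \<gamma> k G s0 a0 = ?c * (LINT \<alpha>|lborel. LINT s|lborel. of_real (\<gamma> ^ k * a0 ^ k) * (?P (\<alpha>, s) / ?D (\<alpha>, s) ^ (k + 2)))"
    unfolding leray_op_def set_lebesgue_integral_def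
  proof (intro arg_cong2[where f="(*)"] refl Bochner_Integration.integral_cong)
    fix \<alpha> :: real
    show "indicator {0<..} \<alpha> *\<^sub>R (LINT s|lborel. of_real (leray_B \<gamma> a0 \<alpha>) ^ k / leray_A \<gamma> s0 a0 s \<alpha> ^ (k + 2) * G s \<alpha> * of_real (\<alpha> powr (\<gamma> - 1)))
       = (LINT s|lborel. of_real (\<gamma> ^ k * a0 ^ k) * (?P (\<alpha>, s) / ?D (\<alpha>, s) ^ (k + 2)))"
    proof (cases "\<alpha> > 0")
      case True
      have "(\<alpha> powr (\<gamma> - 1)) ^ k * \<alpha> powr (\<gamma> - 1) = \<alpha> powr ((\<gamma> - 1) * (real k + 1))"
        using True by (simp add: powr_realpow[symmetric] powr_powr powr_add[symmetric] algebra_simps)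
      then have "leray_B \<gamma> a0 \<alpha> ^ k * \<alpha> powr (\<gamma> - 1) = \<gamma> ^ k * a0 ^ k * \<alpha> powr ((\<gamma> - 1) * (real k + 1))"
        by (simp add: leray_B_def power_mult_distrib mult_ac)
      then have B: "complex_of_real (leray_B \<gamma> a0 \<alpha>) ^ k * of_real (\<alpha> powr (\<gamma> - 1)) = of_real (\<gamma> ^ k * a0 ^ k) * of_real (\<alpha> powr ((\<gamma> - 1) * (real k + 1)))"
        by (simp only: of_real_mult[symmetric] of_real_power[symmetric])
      have "of_real (leray_B \<gamma> a0 \<alpha>) ^ k / leray_A \<gamma> s0 a0 s \<alpha> ^ (k + 2) * G s \<alpha> * of_real (\<alpha> powr (\<gamma> - 1))
          = of_real (\<gamma> ^ k * a0 ^ k) * (?P (\<alpha>, s) / ?D (\<alpha>, s) ^ (k + 2))" for s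
      proof -
        have "of_real (leray_B \<gamma> a0 \<alpha>) ^ k / leray_A \<gamma> s0 a0 s \<alpha> ^ (k + 2) * G s \<alpha> * of_real (\<alpha> powr (\<gamma> - 1))
           = (of_real (leray_B \<gamma> a0 \<alpha>) ^ k * of_real (\<alpha> powr (\<gamma> - 1))) * G s \<alpha> / leray_A \<gamma> s0 a0 s \<alpha> ^ (k + 2)"
          by simp
        then show ?thesis unfolding B using True by (simp add: leray_density_def leray_A_def)
      qed
      then show ?thesis using True by simp
    qed (simp add: leray_density_def)
  qed
  also have "\<dots> = ?c * (of_real (\<gamma> ^ k * a0 ^ k) * (LINT x|plane. ?P x / ?D x ^ (k + 2)))"
    using lborel_pair.integral_fst'[OF i] by (simp only: integral_mult_right_zero fst_conv snd_conv)
  finally show ?thesis .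
qed

text \<open>The rank-one structure: the output depends on \<open>G\<close> only through one number \<open>moment \<gamma> k G t\<close> per
  frequency.  Boundedness of the fiber is recorded because Plancherel's identity asks for it.\<close>
lemma leray_op_eq_ft:
  assumes g: "\<gamma> > 1" and a0: "a0 > 0" and int: "integrable plane (leray_density \<gamma> k G)"
  shows "integrable lborel (fiber \<gamma> k (moment \<gamma> k G) a0)"
    and "leray_op \<gamma> k G s0 a0 = ft (fiber \<gamma> k (moment \<gamma> k G) a0) s0"
    and "\<exists>B. \<forall>t. norm (fiber \<gamma> k (moment \<gamma> k G) a0 t) \<le> B"
proof -
  let ?P = "leray_density \<gamma> k G" and ?b = "\<lambda>x::real \<times> real. (\<gamma> - 1) * fst x powr \<gamma>"
  let ?L = "laplace_symbol (k + 1) (a0 powr \<gamma>) plane ?P ?b snd"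
  let ?c = "complex_of_real (\<gamma>\<^sup>2 * (real k + 1) / (2 * pi))"
  let ?D = "\<lambda>x. Complex (?b x + a0 powr \<gamma>) (snd x - s0)"
  have sf: "sigma_finite_measure (lborel \<Otimes>\<^sub>M lborel :: (real \<times> real) measure)"
    by (simp add: lborel_prod lborel.sigma_finite_measure_axioms)
  have b: "?b x \<ge> 0" for x using g by simp
  have a: "a0 powr \<gamma> > 0" using a0 by simp
  have bm: "?b \<in> borel_measurable plane" "snd \<in> borel_measurable plane"
    by measurable
  have [measurable]: "?P \<in> borel_measurable (borel \<Otimes>\<^sub>M borel)"
    using borel_measurable_integrable[OF int] by (simp cong: measurable_cong_sets)
  note rep = laplace_representation[where m="k+1", OF sf int b a bm]
  have f: "fiber \<gamma> k (moment \<gamma> k G) a0 = (\<lambda>t. of_real (\<gamma>\<^sup>2 * (real k + 1) / (2 * pi) * \<gamma> ^ k * a0 ^ k) * ?L t)"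
    by (rule ext) (rule fiber_eq_laplace_symbol)
  show "integrable lborel (fiber \<gamma> k (moment \<gamma> k G) a0)"
    unfolding f by (intro integrable_mult_right rep)
  show "\<exists>B. \<forall>t. norm (fiber \<gamma> k (moment \<gamma> k G) a0 t) \<le> B"
    unfolding f norm_mult
    using mult_left_mono[OF laplace_symbol_bound[where m="k+1", OF int b bm a] norm_ge_zero] by blast
  have "leray_op \<gamma> k G s0 a0 = ?c * (of_real (\<gamma> ^ k * a0 ^ k) * (LINT x|plane. ?P x / ?D x ^ (k + 2)))"
    by (rule leray_op_eq_integral[OF g a0 int])
  also have "\<dots> = ?c * (of_real (\<gamma> ^ k * a0 ^ k) * ft ?L s0)"
    using rep(2)[of s0] by simp
  also have "\<dots> = ft (fiber \<gamma> k (moment \<gamma> k G) a0) s0"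
    unfolding f ft_cmult by simp
  finally show "leray_op \<gamma> k G s0 a0 = ft (fiber \<gamma> k (moment \<gamma> k G) a0) s0" .
qed

lemma moment_eq_ft:
  assumes g: "\<gamma> > 1" and t: "t > 0" and int: "integrable plane (leray_density \<gamma> k G)"
  shows "moment \<gamma> k G t = (LINT \<alpha>|lborel. of_real (indicator {0<..} \<alpha> * \<alpha> powr ((\<gamma> - 1) * (real k + 1)) * exp (- (t * ((\<gamma> - 1) * \<alpha> powr \<gamma>)))) * ft (\<lambda>s. G s \<alpha>) (- t))"
proof -
  have [measurable]: "leray_density \<gamma> k G \<in> borel_measurable (borel \<Otimes>\<^sub>M borel)"
    using borel_measurable_integrable[OF int] by (simp cong: measurable_cong_sets)
  have i: "integrable plane (\<lambda>x. leray_density \<gamma> k G x * of_real (exp (- (t * ((\<gamma> - 1) * fst x powr \<gamma>)))) * cis (- (t * snd x)))"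
    by (rule Bochner_Integration.integrable_bound[OF int])
       (use g t in \<open>auto intro!: AE_I2 laplace_integrand_bound[where b="\<lambda>x. (\<gamma> - 1) * fst x powr \<gamma>" and \<sigma>=snd]\<close>)
  have "moment \<gamma> k G t = (LINT \<alpha>|lborel. LINT s|lborel. leray_density \<gamma> k G (\<alpha>, s) * of_real (exp (- (t * ((\<gamma> - 1) * \<alpha> powr \<gamma>)))) * cis (- (t * s)))"
    unfolding moment_def using lborel_pair.integral_fst'[OF i] by simp
  also have "\<dots> = (LINT \<alpha>|lborel. of_real (indicator {0<..} \<alpha> * \<alpha> powr ((\<gamma> - 1) * (real k + 1)) * exp (- (t * ((\<gamma> - 1) * \<alpha> powr \<gamma>)))) * ft (\<lambda>s. G s \<alpha>) (- t))"
    unfolding ft_def integral_mult_right_zero[symmetric]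
    by (intro Bochner_Integration.integral_cong refl) (simp add: leray_density_def scaleR_conv_of_real mult_ac)
  finally show ?thesis .
qed

abbreviation u_fun :: "real \<Rightarrow> nat \<Rightarrow> real \<Rightarrow> real \<Rightarrow> real" where
  "u_fun \<gamma> k t \<alpha> \<equiv> \<alpha> ^ k * exp (- (t * \<alpha> powr \<gamma>))"

abbreviation v_fun :: "real \<Rightarrow> real \<Rightarrow> nat \<Rightarrow> real \<Rightarrow> real \<Rightarrow> real" where
  "v_fun \<gamma> r k t \<alpha> \<equiv> \<alpha> powr ((\<gamma> - 1) * (real k + 1) - r) * exp (- (t * ((\<gamma> - 1) * \<alpha> powr \<gamma>)))"

text \<open>The Gamma functions in the norms of \<open>u\<^sub>t\<close> and \<open>v\<^sub>t\<close> have the arguments \<open>p_exp\<close> and \<open>q_exp\<close>, and the two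
  norms are finite exactly when these are positive.\<close>
definition p_exp :: "real \<Rightarrow> real \<Rightarrow> nat \<Rightarrow> real" where
  "p_exp \<gamma> r k = (2 * real k + r + 1) / \<gamma>"
definition q_exp :: "real \<Rightarrow> real \<Rightarrow> nat \<Rightarrow> real" where
  "q_exp \<gamma> r k = 2 * (real k + 1) - p_exp \<gamma> r k"

text \<open>The squared norms of \<open>u\<^sub>t\<close> and \<open>v\<^sub>t\<close> in \<open>L\<^sup>2(\<alpha>^r d\<alpha>)\<close>.\<close>
definition normsq_u :: "real \<Rightarrow> real \<Rightarrow> nat \<Rightarrow> real \<Rightarrow> real" where
  "normsq_u \<gamma> r k t = (2 * t) powr (- p_exp \<gamma> r k) * Gamma (p_exp \<gamma> r k) / \<gamma>"
definition normsq_v :: "real \<Rightarrow> real \<Rightarrow> nat \<Rightarrow> real \<Rightarrow> real" where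
  "normsq_v \<gamma> r k t = (2 * t * (\<gamma> - 1)) powr (- q_exp \<gamma> r k) * Gamma (q_exp \<gamma> r k) / \<gamma>"

definition leray_normsq :: "real \<Rightarrow> real \<Rightarrow> nat \<Rightarrow> real" where
  "leray_normsq \<gamma> r k = (\<gamma> ^ (k + 1) / (fact k * 2 ^ (k + 1)))\<^sup>2 *
     ((\<gamma> - 1) powr (- q_exp \<gamma> r k) * Gamma (p_exp \<gamma> r k) * Gamma (q_exp \<gamma> r k))"

lemma nn_integral_u:
  assumes g: "\<gamma> > 1" and t: "t > 0" and p: "p_exp \<gamma> r k > 0"
  shows "(\<integral>\<^sup>+ \<alpha>. ennreal ((u_fun \<gamma> k t \<alpha>)\<^sup>2) * weight r \<alpha> \<partial>lborel) = ennreal (normsq_u \<gamma> r k t)"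
proof -
  have "(\<integral>\<^sup>+ \<alpha>. ennreal ((u_fun \<gamma> k t \<alpha>)\<^sup>2) * weight r \<alpha> \<partial>lborel)
      = (\<integral>\<^sup>+ \<alpha>. ennreal (\<alpha> powr (2 * real k + r) * exp (- ((2 * t) * \<alpha> powr \<gamma>))) * indicator {0<..} \<alpha> \<partial>lborel)"
  proof (intro nn_integral_cong)
    fix \<alpha> :: real
    show "ennreal ((u_fun \<gamma> k t \<alpha>)\<^sup>2) * weight r \<alpha> = ennreal (\<alpha> powr (2 * real k + r) * exp (- ((2 * t) * \<alpha> powr \<gamma>))) * indicator {0<..} \<alpha>"
    proof (cases "\<alpha> > 0")
      case True
      then have "(u_fun \<gamma> k t \<alpha>)\<^sup>2 * \<alpha> powr r = \<alpha> powr (2 * real k + r) * exp (- ((2 * t) * \<alpha> powr \<gamma>))"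
      proof -
        assume pos: "\<alpha> > 0"
        have e: "(exp z)\<^sup>2 = exp (2 * z)" for z :: real by (simp add: power2_eq_square flip: exp_add)
        have "(\<alpha> ^ k)\<^sup>2 = \<alpha> powr (2 * real k)"
          using pos powr_realpow[of \<alpha> "2 * k"] by (simp add: power_mult[symmetric] mult.commute)
        then show ?thesis by (simp add: power_mult_distrib e powr_add mult_ac)
      qed
      then have "ennreal ((u_fun \<gamma> k t \<alpha>)\<^sup>2) * ennreal (\<alpha> powr r) = ennreal (\<alpha> powr (2 * real k + r) * exp (- ((2 * t) * \<alpha> powr \<gamma>)))"
        by (simp only: ennreal_mult''[OF powr_ge_zero, symmetric])
      moreover have "weight r \<alpha> = ennreal (\<alpha> powr r)" "(indicator {0<..} \<alpha> :: ennreal) = 1"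
        using True by (simp_all add: weight_def)
      ultimately show ?thesis by (simp only: mult_1_right)
    qed (simp add: weight_def)
  qed
  also have "\<dots> = ennreal (normsq_u \<gamma> r k t)"
    using g t p by (subst nn_integral_powr_exp_powr) (auto simp: normsq_u_def p_exp_def add_ac zero_less_divide_iff)
  finally show ?thesis .
qed

lemma nn_integral_v:
  assumes g: "\<gamma> > 1" and t: "t > 0" and q: "q_exp \<gamma> r k > 0"
  shows "(\<integral>\<^sup>+ \<alpha>. ennreal ((v_fun \<gamma> r k t \<alpha>)\<^sup>2) * weight r \<alpha> \<partial>lborel) = ennreal (normsq_v \<gamma> r k t)"
proof -
  let ?x = "2 * ((\<gamma> - 1) * (real k + 1)) - r"
  have x: "(?x + 1) / \<gamma> = q_exp \<gamma> r k" using g by (simp add: q_exp_def p_exp_def field_simps)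
  have "(\<integral>\<^sup>+ \<alpha>. ennreal ((v_fun \<gamma> r k t \<alpha>)\<^sup>2) * weight r \<alpha> \<partial>lborel)
      = (\<integral>\<^sup>+ \<alpha>. ennreal (\<alpha> powr ?x * exp (- ((2 * t * (\<gamma> - 1)) * \<alpha> powr \<gamma>))) * indicator {0<..} \<alpha> \<partial>lborel)"
  proof (intro nn_integral_cong)
    fix \<alpha> :: real
    show "ennreal ((v_fun \<gamma> r k t \<alpha>)\<^sup>2) * weight r \<alpha> = ennreal (\<alpha> powr ?x * exp (- ((2 * t * (\<gamma> - 1)) * \<alpha> powr \<gamma>))) * indicator {0<..} \<alpha>"
    proof (cases "\<alpha> > 0")
      case True
      have e: "(exp z)\<^sup>2 = exp (2 * z)" for z :: real by (simp add: power2_eq_square flip: exp_add)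
      have pw: "(\<alpha> powr z)\<^sup>2 = \<alpha> powr (2 * z)" for z by (simp add: power2_eq_square flip: powr_add)
      have "(\<alpha> powr ((\<gamma> - 1) * (real k + 1) - r))\<^sup>2 * \<alpha> powr r = \<alpha> powr ?x"
        unfolding pw by (simp add: powr_add[symmetric] algebra_simps)
      then have "(v_fun \<gamma> r k t \<alpha>)\<^sup>2 * \<alpha> powr r = \<alpha> powr ?x * exp (- ((2 * t * (\<gamma> - 1)) * \<alpha> powr \<gamma>))"
      proof -
        assume A: "(\<alpha> powr ((\<gamma> - 1) * (real k + 1) - r))\<^sup>2 * \<alpha> powr r = \<alpha> powr ?x"
        have E: "(exp (- (t * ((\<gamma> - 1) * \<alpha> powr \<gamma>))))\<^sup>2 = exp (- ((2 * t * (\<gamma> - 1)) * \<alpha> powr \<gamma>))"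
          unfolding e by (simp add: mult.assoc)
        show ?thesis unfolding power_mult_distrib E A[symmetric] by (simp only: mult_ac)
      qed
      then have "ennreal ((v_fun \<gamma> r k t \<alpha>)\<^sup>2) * ennreal (\<alpha> powr r) = ennreal (\<alpha> powr ?x * exp (- ((2 * t * (\<gamma> - 1)) * \<alpha> powr \<gamma>)))"
        by (simp only: ennreal_mult''[OF powr_ge_zero, symmetric])
      moreover have "weight r \<alpha> = ennreal (\<alpha> powr r)" "(indicator {0<..} \<alpha> :: ennreal) = 1"
        using True by (simp_all add: weight_def)
      ultimately show ?thesis by (simp only: mult_1_right)
    qed (simp add: weight_def)
  qed
  also have "\<dots> = ennreal ((2 * t * (\<gamma> - 1)) powr - ((?x + 1) / \<gamma>) * Gamma ((?x + 1) / \<gamma>) / \<gamma>)"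
  proof (rule nn_integral_powr_exp_powr)
    have "(?x + 1) / \<gamma> > 0" unfolding x by (rule q)
    then show "?x > -1" using g by (simp add: zero_less_divide_iff)
  qed (use g t in auto)
  also have "\<dots> = ennreal (normsq_v \<gamma> r k t)"
    unfolding x normsq_v_def ..
  finally show ?thesis .
qed

text \<open>The powers of \<open>t\<close> cancel because \<open>p + q = 2 (k + 1)\<close>: every fiber has the same norm.\<close>
lemma leray_const_normsq:
  assumes g: "\<gamma> > 1" and t: "t > 0"
  shows "(2 * pi)\<^sup>2 * ((leray_const \<gamma> k * t ^ (k + 1))\<^sup>2 * normsq_u \<gamma> r k t * normsq_v \<gamma> r k t) = leray_normsq \<gamma> r k"
proof -
  define p q where "p = p_exp \<gamma> r k" and "q = q_exp \<gamma> r k"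
  have pq: "-p + -q = - real (2 * (k + 1))" by (simp add: p_def q_def q_exp_def)
  have "(2 * t * (\<gamma> - 1)) powr (-q) = (2 * t) powr (-q) * (\<gamma> - 1) powr (-q)"
    using g t by (simp add: powr_mult)
  moreover have "(2 * t) powr (-p) * (2 * t) powr (-q) = 1 / ((2 * t) ^ (k + 1))\<^sup>2"
  proof -
    have "(2 * t) powr (- real (2 * (k + 1))) = 1 / (2 * t) ^ (2 * (k + 1))"
      using t by (simp only: powr_minus_divide powr_realpow mult_pos_pos zero_less_numeral)
    also have "(2 * t) ^ (2 * (k + 1)) = ((2 * t) ^ (k + 1))\<^sup>2"
      unfolding power_mult[symmetric] by (simp only: mult.commute)
    finally show ?thesis unfolding powr_add[symmetric] pq .
  qed
  ultimately have n: "normsq_u \<gamma> r k t * normsq_v \<gamma> r k t = (1 / (2 * t) ^ (k + 1) / \<gamma>)\<^sup>2 * ((\<gamma> - 1) powr (-q) * Gamma p * Gamma q)"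
  proof -
    assume e1: "(2 * t * (\<gamma> - 1)) powr (-q) = (2 * t) powr (-q) * (\<gamma> - 1) powr (-q)"
      and e2: "(2 * t) powr (-p) * (2 * t) powr (-q) = 1 / ((2 * t) ^ (k + 1))\<^sup>2"
    have "normsq_u \<gamma> r k t * normsq_v \<gamma> r k t = ((2 * t) powr (-p) * (2 * t) powr (-q)) * ((\<gamma> - 1) powr (-q) * Gamma p * Gamma q) / \<gamma>\<^sup>2"
      unfolding normsq_u_def normsq_v_def p_def[symmetric] q_def[symmetric] e1 by (simp add: power2_eq_square)
    then show ?thesis unfolding e2 by (simp add: power_divide power_mult_distrib)
  qed
  have c: "2 * pi * (leray_const \<gamma> k * t ^ (k + 1)) * (1 / (2 * t) ^ (k + 1) / \<gamma>) = \<gamma> ^ (k + 1) / (fact k * 2 ^ (k + 1))"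
    using g t by (simp add: leray_const_def power_mult_distrib)
  have "(2 * pi)\<^sup>2 * ((leray_const \<gamma> k * t ^ (k + 1))\<^sup>2 * normsq_u \<gamma> r k t * normsq_v \<gamma> r k t)
     = (2 * pi * (leray_const \<gamma> k * t ^ (k + 1)) * (1 / (2 * t) ^ (k + 1) / \<gamma>))\<^sup>2 * ((\<gamma> - 1) powr (-q) * Gamma p * Gamma q)"
    unfolding mult.assoc n by (simp only: power_mult_distrib mult_ac)
  then show ?thesis
    unfolding c leray_normsq_def p_def q_def .
qed

section \<open>The upper bound\<close>

lemma borel_measurable_moment [measurable]:
  assumes [measurable]: "leray_density \<gamma> k G \<in> borel_measurable (borel \<Otimes>\<^sub>M borel)"
  shows "moment \<gamma> k G \<in> borel_measurable borel"
proof -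
  interpret sigma_finite_measure "lborel \<Otimes>\<^sub>M lborel :: (real \<times> real) measure"
    by (simp add: lborel_prod lborel.sigma_finite_measure_axioms)
  show ?thesis unfolding moment_def by measurable
qed

lemma normsq_u_nonneg:
  assumes "\<gamma> > 1" "p_exp \<gamma> r k > 0" shows "normsq_u \<gamma> r k t \<ge> 0"
  using assms by (simp add: normsq_u_def Gamma_real_nonneg)

text \<open>Integrating first in \<open>a0\<close> produces the norm of \<open>u\<^sub>t\<close>.\<close>
lemma nn_integral_fiber:
  assumes g: "\<gamma> > 1" and p: "p_exp \<gamma> r k > 0" and [measurable]: "W \<in> borel_measurable borel"
  shows "(\<integral>\<^sup>+ a0. sqnorm (fiber \<gamma> k W a0) * weight r a0 \<partial>lborel)
       = (\<integral>\<^sup>+ t. ennreal ((leray_const \<gamma> k * t ^ (k + 1))\<^sup>2 * normsq_u \<gamma> r k t) * ennreal ((cmod (W t))\<^sup>2) * indicator {0<..} t \<partial>lborel)"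
proof -
  let ?c = "\<lambda>t. (leray_const \<gamma> k * t ^ (k + 1))\<^sup>2" and ?u = "\<lambda>a0 t. (a0 ^ k * exp (- (t * a0 powr \<gamma>)))\<^sup>2"
  have eq: "ennreal ((cmod (fiber \<gamma> k W a0 t))\<^sup>2) = ennreal (?c t) * ennreal ((cmod (W t))\<^sup>2) * indicator {0<..} t * ennreal (?u a0 t)" for a0 t
  proof (cases "t > 0")
    case True
    have "(cmod (fiber \<gamma> k W a0 t))\<^sup>2 = ?c t * (cmod (W t))\<^sup>2 * ?u a0 t"
      using True by (simp add: fiber_def norm_mult norm_power power_mult_distrib mult_ac)
        (simp add: power2_eq_square flip: power_mult_distrib)
    then show ?thesis using True by (simp add: ennreal_mult'')
  qed (simp add: fiber_def)
  have "(\<integral>\<^sup>+ a0. sqnorm (fiber \<gamma> k W a0) * weight r a0 \<partial>lborel)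
     = (\<integral>\<^sup>+ a0. \<integral>\<^sup>+ t. ennreal (?c t) * ennreal ((cmod (W t))\<^sup>2) * indicator {0<..} t * ennreal (?u a0 t) * weight r a0 \<partial>lborel \<partial>lborel)"
    unfolding eq by (subst nn_integral_multc[symmetric]) auto
  also have "\<dots> = (\<integral>\<^sup>+ t. \<integral>\<^sup>+ a0. ennreal (?c t) * ennreal ((cmod (W t))\<^sup>2) * indicator {0<..} t * ennreal (?u a0 t) * weight r a0 \<partial>lborel \<partial>lborel)"
    by (rule lborel_pair.Fubini') measurable
  also have "\<dots> = (\<integral>\<^sup>+ t. ennreal (?c t) * ennreal ((cmod (W t))\<^sup>2) * indicator {0<..} t * (\<integral>\<^sup>+ a0. ennreal (?u a0 t) * weight r a0 \<partial>lborel) \<partial>lborel)"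
    by (subst nn_integral_cmult[symmetric]) (measurable, simp only: mult.assoc)
  also have "\<dots> = (\<integral>\<^sup>+ t. ennreal (?c t * normsq_u \<gamma> r k t) * ennreal ((cmod (W t))\<^sup>2) * indicator {0<..} t \<partial>lborel)"
  proof (intro nn_integral_cong)
    fix t :: real
    show "ennreal (?c t) * ennreal ((cmod (W t))\<^sup>2) * indicator {0<..} t * (\<integral>\<^sup>+ a0. ennreal (?u a0 t) * weight r a0 \<partial>lborel)
        = ennreal (?c t * normsq_u \<gamma> r k t) * ennreal ((cmod (W t))\<^sup>2) * indicator {0<..} t"
    proof (cases "t > 0")
      case True
      then show ?thesis unfolding nn_integral_u[OF g True p] ennreal_mult''[OF normsq_u_nonneg[OF g p]]
        by (simp add: mult_ac)
    qed simp
  qed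
  finally show ?thesis .
qed

lemma normsq_v_nonneg:
  assumes "\<gamma> > 1" "q_exp \<gamma> r k > 0" shows "normsq_v \<gamma> r k t \<ge> 0"
  using assms by (simp add: normsq_v_def Gamma_real_nonneg)

lemma leray_normsq_nonneg:
  assumes "p_exp \<gamma> r k > 0" "q_exp \<gamma> r k > 0" shows "leray_normsq \<gamma> r k \<ge> 0"
  using assms by (simp add: leray_normsq_def Gamma_real_nonneg)

text \<open>Cauchy-Schwarz against \<open>v\<^sub>t\<close>.\<close>
lemma norm_moment_le:
  assumes g: "\<gamma> > 1" and q: "q_exp \<gamma> r k > 0" and t: "t > 0"
    and int: "integrable plane (leray_density \<gamma> k G)"
    and [measurable]: "measurable2 G"
  shows "ennreal ((cmod (moment \<gamma> k G t))\<^sup>2)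
     \<le> ennreal (normsq_v \<gamma> r k t) * (\<integral>\<^sup>+ \<alpha>. ennreal ((cmod (ft (\<lambda>s. G s \<alpha>) (- t)))\<^sup>2) * weight r \<alpha> \<partial>lborel)"
proof -
  let ?w = "(\<gamma> - 1) * (real k + 1)"
  let ?v = "\<lambda>\<alpha>. \<alpha> powr (?w - r) * exp (- (t * ((\<gamma> - 1) * \<alpha> powr \<gamma>)))"
  define h where "h = (\<lambda>\<alpha>::real. ennreal (indicator {0<..} \<alpha> * \<alpha> powr (r / 2)))"
  have [measurable]: "h \<in> borel_measurable borel" unfolding h_def by measurable
  have h2: "(h \<alpha>)\<^sup>2 = weight r \<alpha>" for \<alpha>
    by (simp add: h_def weight_def ennreal_power power_mult_distrib indicator_def) (simp add: power2_eq_square flip: powr_add)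
  have "ennreal (cmod (moment \<gamma> k G t)) \<le> (\<integral>\<^sup>+ \<alpha>. ennreal (cmod (of_real (indicator {0<..} \<alpha> * \<alpha> powr ?w * exp (- (t * ((\<gamma> - 1) * \<alpha> powr \<gamma>)))) * ft (\<lambda>s. G s \<alpha>) (- t))) \<partial>lborel)"
    unfolding moment_eq_ft[OF g t int] by (rule norm_integral_le_nn_integral)
  also have "\<dots> = (\<integral>\<^sup>+ \<alpha>. (ennreal (?v \<alpha>) * h \<alpha>) * (ennreal (cmod (ft (\<lambda>s. G s \<alpha>) (- t))) * h \<alpha>) \<partial>lborel)"
  proof (intro nn_integral_cong)
    fix \<alpha> :: real
    show "ennreal (cmod (of_real (indicator {0<..} \<alpha> * \<alpha> powr ?w * exp (- (t * ((\<gamma> - 1) * \<alpha> powr \<gamma>)))) * ft (\<lambda>s. G s \<alpha>) (- t)))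
       = (ennreal (?v \<alpha>) * h \<alpha>) * (ennreal (cmod (ft (\<lambda>s. G s \<alpha>) (- t))) * h \<alpha>)"
    proof (cases "\<alpha> > 0")
      case True
      \<comment> \<open>One square root of the weight \<open>\<alpha>^r\<close> goes to each factor of the Cauchy-Schwarz inequality.\<close>
      have "\<alpha> powr ?w = \<alpha> powr (?w - r) * (\<alpha> powr (r/2) * \<alpha> powr (r/2))"
        by (simp flip: powr_add)
      then have "cmod (of_real (indicator {0<..} \<alpha> * \<alpha> powr ?w * exp (- (t * ((\<gamma> - 1) * \<alpha> powr \<gamma>)))) * ft (\<lambda>s. G s \<alpha>) (- t))
         = (?v \<alpha> * \<alpha> powr (r/2)) * (cmod (ft (\<lambda>s. G s \<alpha>) (- t)) * \<alpha> powr (r/2))"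
        using True by (simp add: norm_mult mult_ac)
      then show ?thesis using True by (simp add: h_def ennreal_mult')
    qed (simp add: h_def)
  qed
  finally have "(ennreal (cmod (moment \<gamma> k G t)))\<^sup>2 \<le> (\<integral>\<^sup>+ \<alpha>. (ennreal (?v \<alpha>) * h \<alpha>) * (ennreal (cmod (ft (\<lambda>s. G s \<alpha>) (- t))) * h \<alpha>) \<partial>lborel)\<^sup>2"
    by (rule power_mono) simp
  also have "\<dots> \<le> (\<integral>\<^sup>+ \<alpha>. (ennreal (?v \<alpha>) * h \<alpha>)\<^sup>2 \<partial>lborel) * (\<integral>\<^sup>+ \<alpha>. (ennreal (cmod (ft (\<lambda>s. G s \<alpha>) (- t))) * h \<alpha>)\<^sup>2 \<partial>lborel)"
    by (rule nn_integral_Cauchy_Schwarz) (unfold ft_def, measurable)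
  also have "(\<integral>\<^sup>+ \<alpha>. (ennreal (?v \<alpha>) * h \<alpha>)\<^sup>2 \<partial>lborel) = ennreal (normsq_v \<gamma> r k t)"
    unfolding power_mult_distrib h2 by (subst ennreal_power) (auto simp: nn_integral_v[OF g t q])
  also have "(\<integral>\<^sup>+ \<alpha>. (ennreal (cmod (ft (\<lambda>s. G s \<alpha>) (- t))) * h \<alpha>)\<^sup>2 \<partial>lborel) = (\<integral>\<^sup>+ \<alpha>. ennreal ((cmod (ft (\<lambda>s. G s \<alpha>) (- t)))\<^sup>2) * weight r \<alpha> \<partial>lborel)"
    unfolding power_mult_distrib h2 by (subst ennreal_power) auto
  finally show ?thesis by (simp add: ennreal_power)
qed

text \<open>The chain is \<open>bessel_ft\<close> in the output variable, Cauchy-Schwarz in \<open>\<alpha>\<close> at each frequency, and \<open>bessel_ft\<close> again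
  for each slice of \<open>G\<close>; only the positive frequencies of \<open>G\<close> contribute.\<close>
lemma energy_leray_op_le:
  assumes g: "\<gamma> > 1" and p: "p_exp \<gamma> r k > 0" and q: "q_exp \<gamma> r k > 0"
    and int: "integrable plane (leray_density \<gamma> k G)"
    and meas[measurable]: "measurable2 G"
    and slices: "\<And>\<alpha>. \<alpha> > 0 \<Longrightarrow> integrable lborel (\<lambda>s. G s \<alpha>)"
  shows "energy r (leray_op \<gamma> k G) \<le> ennreal (leray_normsq \<gamma> r k) * energy r G"
proof -
  have [measurable]: "leray_density \<gamma> k G \<in> borel_measurable (borel \<Otimes>\<^sub>M borel)"
    using borel_measurable_integrable[OF int] by (simp cong: measurable_cong_sets)
  let ?W = "moment \<gamma> k G"
  let ?F = "\<lambda>\<alpha> t. ennreal ((cmod (ft (\<lambda>s. G s \<alpha>) (- t)))\<^sup>2)"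
  let ?N = "leray_normsq \<gamma> r k / (2 * pi)\<^sup>2"
  have N: "?N \<ge> 0" using leray_normsq_nonneg[OF p q] by simp
  have "energy r (leray_op \<gamma> k G) \<le> (\<integral>\<^sup>+ a0. ennreal (2 * pi) * (sqnorm (fiber \<gamma> k ?W a0) * weight r a0) \<partial>lborel)"
    unfolding energy_def
  proof (intro nn_integral_mono)
    fix a0 :: real
    show "sqnorm (\<lambda>s. leray_op \<gamma> k G s a0) * weight r a0 \<le> ennreal (2 * pi) * (sqnorm (fiber \<gamma> k ?W a0) * weight r a0)"
    proof (cases "a0 > 0")
      case True
      show ?thesis unfolding leray_op_eq_ft(2)[OF g True int] mult.assoc[symmetric]
        by (intro mult_right_mono bessel_ft leray_op_eq_ft(1)[OF g True int]) simp
    qed (simp add: weight_def)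
  qed
  also have "\<dots> = ennreal (2 * pi) * (\<integral>\<^sup>+ a0. sqnorm (fiber \<gamma> k ?W a0) * weight r a0 \<partial>lborel)"
    by (rule nn_integral_cmult) (unfold fiber_def, measurable)
  also have "\<dots> = ennreal (2 * pi) * (\<integral>\<^sup>+ t. ennreal ((leray_const \<gamma> k * t ^ (k + 1))\<^sup>2 * normsq_u \<gamma> r k t) * ennreal ((cmod (?W t))\<^sup>2) * indicator {0<..} t \<partial>lborel)"
    by (subst nn_integral_fiber[OF g p]) auto
  also have "\<dots> \<le> ennreal (2 * pi) * (\<integral>\<^sup>+ t. ennreal ?N * (\<integral>\<^sup>+ \<alpha>. ?F \<alpha> t * weight r \<alpha> \<partial>lborel) \<partial>lborel)"
  proof (intro mult_left_mono nn_integral_mono)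
    fix t :: real
    show "ennreal ((leray_const \<gamma> k * t ^ (k + 1))\<^sup>2 * normsq_u \<gamma> r k t) * ennreal ((cmod (?W t))\<^sup>2) * indicator {0<..} t \<le> ennreal ?N * (\<integral>\<^sup>+ \<alpha>. ?F \<alpha> t * weight r \<alpha> \<partial>lborel)"
    proof (cases "t > 0")
      case True
      let ?c = "(leray_const \<gamma> k * t ^ (k + 1))\<^sup>2 * normsq_u \<gamma> r k t"
      have "ennreal ?c * ennreal ((cmod (?W t))\<^sup>2) \<le> ennreal ?c * (ennreal (normsq_v \<gamma> r k t) * (\<integral>\<^sup>+ \<alpha>. ?F \<alpha> t * weight r \<alpha> \<partial>lborel))"
        by (intro mult_left_mono norm_moment_le[OF g q True int meas]) simp
      also have "\<dots> = ennreal (?c * normsq_v \<gamma> r k t) * (\<integral>\<^sup>+ \<alpha>. ?F \<alpha> t * weight r \<alpha> \<partial>lborel)"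
        by (simp only: mult.assoc[symmetric] ennreal_mult''[OF normsq_v_nonneg[OF g q]])
      also have "?c * normsq_v \<gamma> r k t = ?N"
        using leray_const_normsq[OF g True, of k r] by (simp add: field_simps)
      finally show ?thesis using True by simp
    qed simp
  qed simp
  also have "\<dots> = ennreal (2 * pi) * (ennreal ?N * (\<integral>\<^sup>+ t. \<integral>\<^sup>+ \<alpha>. ?F \<alpha> t * weight r \<alpha> \<partial>lborel \<partial>lborel))"
    by (subst nn_integral_cmult) (unfold ft_def, measurable)
  also have "(\<integral>\<^sup>+ t. \<integral>\<^sup>+ \<alpha>. ?F \<alpha> t * weight r \<alpha> \<partial>lborel \<partial>lborel) = (\<integral>\<^sup>+ \<alpha>. \<integral>\<^sup>+ t. ?F \<alpha> t * weight r \<alpha> \<partial>lborel \<partial>lborel)"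
    by (rule lborel_pair.Fubini') (unfold ft_def, measurable)
  also have "\<dots> = (\<integral>\<^sup>+ \<alpha>. (\<integral>\<^sup>+ t. ?F \<alpha> t \<partial>lborel) * weight r \<alpha> \<partial>lborel)"
    by (subst nn_integral_multc) (unfold ft_def, measurable)
  also have "\<dots> = (\<integral>\<^sup>+ \<alpha>. sqnorm (ft (\<lambda>s. G s \<alpha>)) * weight r \<alpha> \<partial>lborel)"
  proof -
    have "(\<integral>\<^sup>+ t. ?F \<alpha> t \<partial>lborel) = sqnorm (ft (\<lambda>s. G s \<alpha>))" for \<alpha>
    proof -
      have [measurable]: "(\<lambda>s. G s \<alpha>) \<in> borel_measurable borel" by measurable
      have "(\<lambda>t. ennreal ((cmod (ft (\<lambda>s. G s \<alpha>) t))\<^sup>2)) \<in> borel_measurable borel"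
        unfolding ft_def by measurable
      from nn_integral_real_affine[OF this, of "-1" 0]
      show ?thesis by simp
    qed
    then show ?thesis by (simp only:)
  qed
  also have "\<dots> \<le> (\<integral>\<^sup>+ \<alpha>. ennreal (2 * pi) * (sqnorm (\<lambda>s. G s \<alpha>) * weight r \<alpha>) \<partial>lborel)"
  proof (intro nn_integral_mono)
    fix \<alpha> :: real
    show "sqnorm (ft (\<lambda>s. G s \<alpha>)) * weight r \<alpha> \<le> ennreal (2 * pi) * (sqnorm (\<lambda>s. G s \<alpha>) * weight r \<alpha>)"
    proof (cases "\<alpha> > 0")
      case True
      show ?thesis unfolding mult.assoc[symmetric]
        by (intro mult_right_mono bessel_ft slices True) simp
    qed (simp add: weight_def)
  qed
  also have "\<dots> = ennreal (2 * pi) * energy r G"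
    unfolding energy_def by (rule nn_integral_cmult) measurable
  finally have "energy r (leray_op \<gamma> k G) \<le> ennreal (2 * pi) * (ennreal ?N * (ennreal (2 * pi) * energy r G))"
    by (simp add: mult_left_mono)
  also have "\<dots> = ennreal (2 * pi * ?N * (2 * pi)) * energy r G"
    using N by (simp only: ennreal_mult' ennreal_mult'' mult.assoc pi_ge_zero mult_nonneg_nonneg zero_le_numeral)
  also have "2 * pi * ?N * (2 * pi) = leray_normsq \<gamma> r k" by (simp add: power2_eq_square)
  finally show ?thesis .
qed

section \<open>An extremal function\<close>

lemma integrable_inverse_1_plus_square': "integrable lborel (\<lambda>x::real. inverse (1 + x\<^sup>2))"
  using integrable_inverse_1_plus_square by (simp add: set_integrable_def einterval_def)

text \<open>A continuous function of the frequency that vanishes for \<open>t \<le> 1\<close>, damped at the rate \<open>b\<close>.  Staying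
  away from \<open>t = 0\<close> keeps \<open>v\<^sub>t\<close> exponentially decaying in \<open>\<alpha>\<close>, uniformly over the support.\<close>
definition test_profile :: "real \<Rightarrow> real \<Rightarrow> complex" where
  "test_profile b t = of_real (max 0 (t - 1) * exp (- (t * b)))"

text \<open>The function whose Fourier transform at frequency \<open>t\<close> is a multiple of \<open>v\<^sub>t\<close>: the rate \<open>1 + (\<gamma> - 1) \<alpha>^\<gamma>\<close> provides
  the exponential factor of \<open>v\<^sub>t\<close> together with a factor \<open>exp (- t)\<close> independent of \<open>\<alpha>\<close>.\<close>
definition test_fn :: "real \<Rightarrow> real \<Rightarrow> nat \<Rightarrow> real \<Rightarrow> real \<Rightarrow> complex" where
  "test_fn \<gamma> r k s \<alpha> = of_real (\<alpha> powr ((\<gamma> - 1) * (real k + 1) - r)) * ft (test_profile (1 + (\<gamma> - 1) * \<alpha> powr \<gamma>)) s"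

lemma test_profile_shift:
  "test_profile b (1 + 1 * t) = of_real (exp (- b)) * (indicator {0<..} t *\<^sub>R (of_real (t ^ 1) * exp (- (of_real t * of_real b))))"
proof (cases "t > 0")
  case True
  have "exp (- (of_real t * of_real b)) = complex_of_real (exp (- (t * b)))"
    by (simp add: exp_of_real flip: of_real_mult of_real_minus)
  moreover have "exp (- ((1 + 1 * t) * b)) = exp (- b) * exp (- (t * b))"
    by (simp add: algebra_simps flip: exp_add)
  ultimately show ?thesis using True unfolding test_profile_def by (simp add: mult_ac)
qed (simp add: test_profile_def)

lemma test_profile_integrable:
  assumes "b > 0" shows "integrable lborel (test_profile b)"
proof -
  have "integrable lborel (\<lambda>t. test_profile b (1 + 1 * t))"
    unfolding test_profile_shift using assms by (intro integrable_mult_right integrable_power_exp_complex) simp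
  then show ?thesis by (subst (asm) lborel_integrable_real_affine_iff) auto
qed

lemma test_profile_continuous: "continuous_on UNIV (test_profile b)"
  unfolding test_profile_def by (intro continuous_intros)

lemma norm_test_profile_le:
  assumes "b \<ge> 1" shows "norm (test_profile b t) \<le> 1"
proof (cases "t \<ge> 1")
  case True
  have "t - 1 \<le> exp (t - 1)" using exp_ge_add_one_self[of "t - 1"] by linarith
  also have "\<dots> \<le> exp (t * b)"
  proof -
    have "t * 1 \<le> t * b" using True assms by (intro mult_left_mono) auto
    then show ?thesis unfolding exp_le_cancel_iff by linarith
  qed
  finally show ?thesis using True unfolding test_profile_def norm_of_real by (simp add: abs_mult exp_minus field_simps)
qed (simp add: test_profile_def)

text \<open>The profile is a translate of \<open>t exp (- t b)\<close> on the half-line, whose transform is \<open>laplace_power\<close> for \<open>m = 1\<close>.\<close>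
lemma ft_test_profile:
  assumes b: "b > 0"
  shows "ft (test_profile b) s = of_real (exp (- b)) * cis s / Complex b (- s) ^ 2"
proof -
  have "ft (test_profile b) s = (LINT t|lborel. test_profile b (1 + 1 * t) * cis (s * (1 + 1 * t)))"
    unfolding ft_def by (subst lborel_integral_real_affine[where c=1 and t=1]) auto
  also have "\<dots> = (LINT t|lborel. of_real (exp (- b)) * cis s * (indicator {0<..} t *\<^sub>R (of_real (t ^ 1) * exp (- (of_real t * Complex b (- s))))))"
  proof (intro Bochner_Integration.integral_cong refl)
    fix t
    have "exp (- (of_real t * Complex b (- s))) = exp (- (of_real t * of_real b)) * cis (s * t)"
      by (simp add: exp_eq_polar mult.commute)
    moreover have "cis (s * (1 + 1 * t)) = cis s * cis (s * t)"
      by (simp add: cis_mult distrib_left)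
    ultimately show "test_profile b (1 + 1 * t) * cis (s * (1 + 1 * t))
       = of_real (exp (- b)) * cis s * (indicator {0<..} t *\<^sub>R (of_real (t ^ 1) * exp (- (of_real t * Complex b (- s)))))"
      unfolding test_profile_shift by (simp add: mult_ac)
  qed
  also have "\<dots> = of_real (exp (- b)) * cis s * (fact 1 / Complex b (- s) ^ (1 + 1))"
    unfolding integral_mult_right_zero using b by (subst laplace_power) auto
  finally show ?thesis by (simp add: numeral_2_eq_2)
qed

lemma norm_ft_test_profile:
  assumes "b > 0" shows "norm (ft (test_profile b) s) = exp (- b) / (b\<^sup>2 + s\<^sup>2)"
  by (simp add: ft_test_profile[OF assms] norm_mult norm_divide norm_power complex_norm)

lemma norm_ft_test_profile_le:
  assumes "b \<ge> 1" shows "norm (ft (test_profile b) s) \<le> exp (- b) * inverse (1 + s\<^sup>2)"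
proof -
  have "1 + s\<^sup>2 \<le> b\<^sup>2 + s\<^sup>2" "1 + s\<^sup>2 > 0" using assms one_le_power[of b 2] by (auto simp: add_pos_nonneg)
  then show ?thesis using assms by (simp add: norm_ft_test_profile divide_inverse le_imp_inverse_le)
qed

lemma ft_test_profile_integrable:
  assumes b: "b \<ge> 1" shows "integrable lborel (ft (test_profile b))"
proof (rule Bochner_Integration.integrable_bound)
  show "integrable lborel (\<lambda>s. exp (- b) * inverse (1 + s\<^sup>2))"
    using integrable_inverse_1_plus_square' by (rule integrable_mult_right)
  show "ft (test_profile b) \<in> borel_measurable lborel"
    using test_profile_integrable[of b] b by simp
  show "AE s in lborel. norm (ft (test_profile b) s) \<le> norm (exp (- b) * inverse (1 + s\<^sup>2))"
    using norm_ft_test_profile_le[OF b] by (intro AE_I2) (auto intro: order_trans)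
qed

context
  fixes \<gamma> r :: real and k :: nat
  assumes g: "\<gamma> > 1" and p: "p_exp \<gamma> r k > 0" and q: "q_exp \<gamma> r k > 0"
begin

abbreviation (input) "test_rate \<alpha> \<equiv> 1 + (\<gamma> - 1) * \<alpha> powr \<gamma>"
abbreviation (input) "test_power \<equiv> (\<gamma> - 1) * (real k + 1) - r"

lemma test_rate_ge_1: "test_rate \<alpha> \<ge> 1" using g by simp

lemma test_fn_measurable: "measurable2 (test_fn \<gamma> r k)"
  unfolding test_fn_def ft_def test_profile_def by measurable

lemma norm_test_fn_le:
  "norm (test_fn \<gamma> r k s \<alpha>) \<le> (v_fun \<gamma> r k 1 \<alpha>) * inverse (1 + s\<^sup>2)"
proof -
  have "norm (test_fn \<gamma> r k s \<alpha>) \<le> \<alpha> powr test_power * (exp (- test_rate \<alpha>) * inverse (1 + s\<^sup>2))"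
    unfolding test_fn_def norm_mult using norm_ft_test_profile_le[OF test_rate_ge_1] by (simp add: mult_left_mono)
  also have "\<dots> \<le> \<alpha> powr test_power * (exp (- (1 * ((\<gamma> - 1) * \<alpha> powr \<gamma>))) * inverse (1 + s\<^sup>2))"
    by (intro mult_left_mono mult_right_mono) (auto simp: add_nonneg_nonneg)
  finally show ?thesis by (simp add: mult.assoc)
qed

lemma test_fn_nonzero: "\<alpha> > 0 \<Longrightarrow> test_fn \<gamma> r k s \<alpha> \<noteq> 0"
proof -
  assume a: "\<alpha> > 0"
  have b: "test_rate \<alpha> > 0" using test_rate_ge_1[of \<alpha>] by linarith
  then have "(test_rate \<alpha>)\<^sup>2 + s\<^sup>2 \<noteq> 0" by (simp add: add_pos_nonneg less_imp_neq[symmetric])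
  then have "norm (ft (test_profile (test_rate \<alpha>)) s) \<noteq> 0" by (simp only: norm_ft_test_profile[OF b]) simp
  then show ?thesis using a by (simp add: test_fn_def)
qed

lemma test_fn_density_integrable: "integrable plane (leray_density \<gamma> k (test_fn \<gamma> r k))"
proof -
  let ?y = "2 * ((\<gamma> - 1) * (real k + 1)) - r"
  let ?f = "\<lambda>\<alpha>. \<alpha> powr ?y * exp (- ((\<gamma> - 1) * \<alpha> powr \<gamma>)) * indicator {0<..} \<alpha>"
  have x: "(?y + 1) / \<gamma> = q_exp \<gamma> r k" using g by (simp add: q_exp_def p_exp_def field_simps)
  then have "(?y + 1) / \<gamma> > 0" using q by simp
  then have y: "?y > -1" using g by (simp add: zero_less_divide_iff)
  have [measurable]: "(\<lambda>x. leray_density \<gamma> k (test_fn \<gamma> r k) x) \<in> borel_measurable plane"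
    unfolding leray_density_def test_fn_def ft_def test_profile_def by measurable
  show ?thesis
  proof (rule integrableI_bounded)
    have "(\<integral>\<^sup>+ x. ennreal (norm (leray_density \<gamma> k (test_fn \<gamma> r k) x)) \<partial>plane)
       \<le> (\<integral>\<^sup>+ x. ennreal (?f (fst x)) * ennreal (inverse (1 + (snd x)\<^sup>2)) \<partial>plane)"
    proof (intro nn_integral_mono)
      fix x :: "real \<times> real"
      obtain \<alpha> s where xx: "x = (\<alpha>, s)" by fastforce
      have "norm (leray_density \<gamma> k (test_fn \<gamma> r k) x) \<le> ?f (fst x) * inverse (1 + (snd x)\<^sup>2)"
      proof (cases "\<alpha> > 0")
        case True
        have "\<alpha> powr ((\<gamma> - 1) * (real k + 1)) * \<alpha> powr test_power = \<alpha> powr ?y"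
          by (simp flip: powr_add)
        moreover have "norm (leray_density \<gamma> k (test_fn \<gamma> r k) x) \<le> \<alpha> powr ((\<gamma> - 1) * (real k + 1)) * ((v_fun \<gamma> r k 1 \<alpha>) * inverse (1 + s\<^sup>2))"
          using True norm_test_fn_le[of s \<alpha>] by (simp add: leray_density_def xx norm_mult mult_left_mono)
        ultimately show ?thesis using True by (simp add: xx mult.assoc[symmetric])
      qed (simp add: leray_density_def xx)
      then show "ennreal (norm (leray_density \<gamma> k (test_fn \<gamma> r k) x)) \<le> ennreal (?f (fst x)) * ennreal (inverse (1 + (snd x)\<^sup>2))"
        by (subst ennreal_mult''[symmetric]) (auto intro: ennreal_leI)
    qed
    also have "\<dots> = (\<integral>\<^sup>+ \<alpha>. \<integral>\<^sup>+ s. ennreal (?f \<alpha>) * ennreal (inverse (1 + s\<^sup>2)) \<partial>lborel \<partial>lborel)"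
      by (subst lborel.nn_integral_fst[symmetric]) auto
    also have "\<dots> = (\<integral>\<^sup>+ \<alpha>. ennreal (?f \<alpha>) \<partial>lborel) * (\<integral>\<^sup>+ s. ennreal (inverse (1 + s\<^sup>2)) \<partial>lborel)"
      by (simp add: nn_integral_cmult nn_integral_multc)
    also have "(\<integral>\<^sup>+ \<alpha>. ennreal (?f \<alpha>) \<partial>lborel) = (\<integral>\<^sup>+ \<alpha>. ennreal (\<alpha> powr ?y * exp (- ((\<gamma> - 1) * \<alpha> powr \<gamma>))) * indicator {0<..} \<alpha> \<partial>lborel)"
      by (intro nn_integral_cong) (simp split: split_indicator)
    also have "\<dots> * (\<integral>\<^sup>+ s. ennreal (inverse (1 + s\<^sup>2)) \<partial>lborel) < \<infinity>"
      using g y nn_integral_powr_exp_powr[of \<gamma> "\<gamma> - 1" ?y] nn_integral_eq_integral[OF integrable_inverse_1_plus_square']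
      by (simp add: ennreal_mult_less_top add_nonneg_nonneg)
    finally show "(\<integral>\<^sup>+ x. ennreal (norm (leray_density \<gamma> k (test_fn \<gamma> r k) x)) \<partial>plane) < \<infinity>" .
  qed measurable
qed

lemma test_fn_energy_finite: "energy r (test_fn \<gamma> r k) < \<infinity>"
proof -
  let ?I = "\<integral>\<^sup>+ s. ennreal (inverse (1 + s\<^sup>2)) \<partial>lborel"
  let ?v = "\<lambda>\<alpha>. (v_fun \<gamma> r k 1 \<alpha>)\<^sup>2"
  have "energy r (test_fn \<gamma> r k) \<le> (\<integral>\<^sup>+ \<alpha>. ennreal (?v \<alpha>) * ?I * weight r \<alpha> \<partial>lborel)"
    unfolding energy_def
  proof (intro nn_integral_mono mult_right_mono)
    fix \<alpha> :: real
    have "sqnorm (\<lambda>s. test_fn \<gamma> r k s \<alpha>) \<le> (\<integral>\<^sup>+ s. ennreal (?v \<alpha>) * ennreal (inverse (1 + s\<^sup>2)) \<partial>lborel)"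
    proof (intro nn_integral_mono)
      fix s :: real
      have "(cmod (test_fn \<gamma> r k s \<alpha>))\<^sup>2 \<le> ((v_fun \<gamma> r k 1 \<alpha>) * inverse (1 + s\<^sup>2))\<^sup>2"
        by (intro power_mono norm_test_fn_le) simp
      also have "\<dots> = ?v \<alpha> * (inverse (1 + s\<^sup>2))\<^sup>2" by (simp add: power_mult_distrib)
      also have "\<dots> \<le> ?v \<alpha> * inverse (1 + s\<^sup>2)"
      proof (intro mult_left_mono)
        have "inverse (1 + s\<^sup>2) \<le> 1" by (simp add: inverse_le_1_iff)
        then show "(inverse (1 + s\<^sup>2))\<^sup>2 \<le> inverse (1 + s\<^sup>2)"
          by (simp add: power2_eq_square mult_left_le add_nonneg_nonneg del: inverse_eq_divide)
      qed simp
      finally show "ennreal ((cmod (test_fn \<gamma> r k s \<alpha>))\<^sup>2) \<le> ennreal (?v \<alpha>) * ennreal (inverse (1 + s\<^sup>2))"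
        by (subst ennreal_mult''[symmetric]) (auto intro: ennreal_leI simp: add_nonneg_nonneg)
    qed
    also have "\<dots> = ennreal (?v \<alpha>) * ?I" by (rule nn_integral_cmult) measurable
    finally show "sqnorm (\<lambda>s. test_fn \<gamma> r k s \<alpha>) \<le> ennreal (?v \<alpha>) * ?I" .
  qed simp
  also have "\<dots> = ?I * (\<integral>\<^sup>+ \<alpha>. ennreal (?v \<alpha>) * weight r \<alpha> \<partial>lborel)"
    by (subst nn_integral_cmult[symmetric]) (measurable, simp add: mult_ac)
  also have "\<dots> < \<infinity>"
    unfolding nn_integral_v[OF g zero_less_one q] using nn_integral_eq_integral[OF integrable_inverse_1_plus_square']
    by (simp add: ennreal_mult_less_top add_nonneg_nonneg)
  finally show ?thesis .
qed

lemma test_fn_energy_pos: "energy r (test_fn \<gamma> r k) \<noteq> 0"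
proof
  note [measurable] = test_fn_measurable
  assume "energy r (test_fn \<gamma> r k) = 0"
  then have "AE \<alpha> in lborel. sqnorm (\<lambda>s. test_fn \<gamma> r k s \<alpha>) * weight r \<alpha> = 0"
    unfolding energy_def by (subst (asm) nn_integral_0_iff_AE) auto
  moreover have "sqnorm (\<lambda>s. test_fn \<gamma> r k s \<alpha>) * weight r \<alpha> \<noteq> 0" if a: "\<alpha> > 0" for \<alpha>
  proof -
    have "sqnorm (\<lambda>s. test_fn \<gamma> r k s \<alpha>) \<noteq> 0"
    proof
      assume z: "sqnorm (\<lambda>s. test_fn \<gamma> r k s \<alpha>) = 0"
      have "AE s in lborel. ennreal ((cmod (test_fn \<gamma> r k s \<alpha>))\<^sup>2) = 0"
        using z by (subst (asm) nn_integral_0_iff_AE) auto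
      then have "AE s in (lborel::real measure). False"
        using test_fn_nonzero[OF a] by (auto elim!: eventually_mono)
      then show False by (simp add: AE_iff_null null_sets_def)
    qed
    then show ?thesis using a by (simp add: weight_def)
  qed
  ultimately have "AE \<alpha> in lborel. \<not> (\<alpha> > (0::real))" by (auto elim!: eventually_mono)
  then have "emeasure lborel {\<alpha>::real. 0 < \<alpha>} = 0"
    by (simp add: AE_iff_null null_sets_def)
  moreover have "emeasure lborel {0<..<1::real} \<le> emeasure lborel {\<alpha>::real. 0 < \<alpha>}"
    by (intro emeasure_mono) auto
  ultimately show False by simp
qed

text \<open>Fourier inversion recovers the multiple of \<open>v\<^sub>t\<close>, and pairing it with \<open>v\<^sub>t\<close> leaves the squared norm of \<open>v\<^sub>t\<close>.\<close>
lemma test_fn_moment: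
  assumes t: "t > 0"
  shows "moment \<gamma> k (test_fn \<gamma> r k) t = of_real (2 * pi * (max 0 (t - 1) * exp (- t)) * normsq_v \<gamma> r k t)"
proof -
  let ?c = "2 * pi * (max 0 (t - 1) * exp (- t))"
  let ?v = "\<lambda>\<alpha>. (v_fun \<gamma> r k t \<alpha>)\<^sup>2 * (indicator {0<..} \<alpha> * \<alpha> powr r)"
  have inv: "ft (\<lambda>s. test_fn \<gamma> r k s \<alpha>) (- t) = of_real (\<alpha> powr test_power) * (of_real (2 * pi) * test_profile (test_rate \<alpha>) t)" for \<alpha>
  proof -
    have "(LINT s|lborel. ft (test_profile (test_rate \<alpha>)) s * cis (- (s * t))) = of_real (2 * pi) * test_profile (test_rate \<alpha>) t"
      using test_rate_ge_1[of \<alpha>]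
      by (intro fourier_inversion[where B=1] test_profile_integrable test_profile_continuous norm_test_profile_le ft_test_profile_integrable) linarith+
    then show ?thesis unfolding test_fn_def ft_cmult by (simp add: ft_def mult.commute[of t])
  qed
  have "moment \<gamma> k (test_fn \<gamma> r k) t = (LINT \<alpha>|lborel. complex_of_real (?c * ?v \<alpha>))"
    unfolding moment_eq_ft[OF g t test_fn_density_integrable] inv
  proof (intro Bochner_Integration.integral_cong refl)
    fix \<alpha> :: real
    show "of_real (indicator {0<..} \<alpha> * \<alpha> powr ((\<gamma> - 1) * (real k + 1)) * exp (- (t * ((\<gamma> - 1) * \<alpha> powr \<gamma>)))) * (of_real (\<alpha> powr test_power) * (of_real (2 * pi) * test_profile (test_rate \<alpha>) t))
       = complex_of_real (?c * ?v \<alpha>)"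
    proof (cases "\<alpha> > 0")
      case True
      have e: "exp (- (t * test_rate \<alpha>)) = exp (- t) * exp (- (t * ((\<gamma> - 1) * \<alpha> powr \<gamma>)))"
        by (simp add: algebra_simps flip: exp_add)
      have w: "\<alpha> powr ((\<gamma> - 1) * (real k + 1)) = \<alpha> powr test_power * \<alpha> powr r"
        by (simp flip: powr_add)
      show ?thesis using True
        unfolding test_profile_def of_real_mult[symmetric] e w by (simp add: power2_eq_square mult_ac)
    qed simp
  qed
  also have "\<dots> = of_real (?c * (LINT \<alpha>|lborel. ?v \<alpha>))"
    unfolding integral_complex_of_real by (simp only: integral_mult_right_zero)
  also have "(LINT \<alpha>|lborel. ?v \<alpha>) = normsq_v \<gamma> r k t"
  proof -
    have "(\<integral>\<^sup>+ \<alpha>. ennreal (?v \<alpha>) \<partial>lborel) = ennreal (normsq_v \<gamma> r k t)"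
      unfolding nn_integral_v[OF g t q, symmetric] weight_def by (intro nn_integral_cong ennreal_mult'') simp
    moreover have "?v \<alpha> \<ge> 0" for \<alpha> by simp
    ultimately show ?thesis
      using normsq_v_nonneg[OF g q, of t] by (subst integral_eq_nn_integral) auto
  qed
  finally show ?thesis .
qed

text \<open>The negative power of \<open>t\<close> in the norm of \<open>v\<^sub>t\<close> is harmless, since the profile vanishes for \<open>t \<le> 1\<close>.\<close>
lemma test_fn_fiber_continuous: "continuous_on UNIV (fiber \<gamma> k (moment \<gamma> k (test_fn \<gamma> r k)) a0)"
proof -
  let ?V = "\<lambda>t. (2 * max 1 t * (\<gamma> - 1)) powr (- q_exp \<gamma> r k) * Gamma (q_exp \<gamma> r k) / \<gamma>"
  have eq: "fiber \<gamma> k (moment \<gamma> k (test_fn \<gamma> r k)) a0 t = of_real (leray_const \<gamma> k * t ^ (k + 1) * a0 ^ k * exp (- (t * a0 powr \<gamma>)) *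
      (2 * pi * (max 0 (t - 1) * exp (- t)) * ?V t))" for t
  proof (cases "t > 1")
    case True
    then show ?thesis by (simp add: fiber_def test_fn_moment normsq_v_def)
  next
    case False
    then show ?thesis by (cases "t > 0") (simp_all add: fiber_def test_fn_moment)
  qed
  have c: "continuous_on UNIV (\<lambda>t. (2 * max 1 t * (\<gamma> - 1)) powr (- q_exp \<gamma> r k))"
  proof (rule continuous_on_powr)
    show "\<forall>t\<in>UNIV. 2 * max 1 t * (\<gamma> - 1) \<noteq> 0" using g by (simp add: max_def)
  qed (intro continuous_intros)+
  have "\<gamma> \<noteq> 0" using g by simp
  then show ?thesis unfolding eq[abs_def]
    by (intro continuous_on_of_real continuous_on_mult continuous_on_divide c continuous_intros) simp_all
qed

text \<open>Every inequality in the proof of \<open>energy_leray_op_le\<close> is an equality here.  Both sides are the same multiple of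
  \<open>\<integral> (max 0 (t - 1) exp (- t))\<^sup>2 \<parallel>v\<^sub>t\<parallel>\<^sup>2 dt\<close> over \<open>t > 0\<close>.\<close>
lemma test_fn_extremal:
  "energy r (leray_op \<gamma> k (test_fn \<gamma> r k)) = ennreal (leray_normsq \<gamma> r k) * energy r (test_fn \<gamma> r k)"
proof -
  let ?W = "moment \<gamma> k (test_fn \<gamma> r k)"
  let ?\<phi> = "\<lambda>t. (max 0 (t - 1) * exp (- t))\<^sup>2"
  let ?J = "\<integral>\<^sup>+ t. ennreal (?\<phi> t * normsq_v \<gamma> r k t) * indicator {0<..} t \<partial>lborel"
  have [measurable]: "leray_density \<gamma> k (test_fn \<gamma> r k) \<in> borel_measurable (borel \<Otimes>\<^sub>M borel)"
    unfolding leray_density_def test_fn_def ft_def test_profile_def by measurable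
  have "energy r (leray_op \<gamma> k (test_fn \<gamma> r k)) = (\<integral>\<^sup>+ a0. ennreal (2 * pi) * (sqnorm (fiber \<gamma> k ?W a0) * weight r a0) \<partial>lborel)"
    unfolding energy_def
  proof (intro nn_integral_cong)
    fix a0 :: real
    show "sqnorm (\<lambda>s. leray_op \<gamma> k (test_fn \<gamma> r k) s a0) * weight r a0 = ennreal (2 * pi) * (sqnorm (fiber \<gamma> k ?W a0) * weight r a0)"
    proof (cases "a0 > 0")
      case True
      note rep = leray_op_eq_ft[OF g True test_fn_density_integrable]
      obtain B where B: "\<And>t. norm (fiber \<gamma> k ?W a0 t) \<le> B" using rep(3) by blast
      show ?thesis unfolding rep(2) mult.assoc[symmetric] plancherel_ft[OF rep(1) test_fn_fiber_continuous B] ..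
    qed (simp add: weight_def)
  qed
  also have "\<dots> = ennreal (2 * pi) * (\<integral>\<^sup>+ a0. sqnorm (fiber \<gamma> k ?W a0) * weight r a0 \<partial>lborel)"
    by (rule nn_integral_cmult) (unfold fiber_def, measurable)
  also have "\<dots> = ennreal (2 * pi) * (\<integral>\<^sup>+ t. ennreal ((leray_const \<gamma> k * t ^ (k + 1))\<^sup>2 * normsq_u \<gamma> r k t) * ennreal ((cmod (?W t))\<^sup>2) * indicator {0<..} t \<partial>lborel)"
    by (subst nn_integral_fiber[OF g p]) auto
  also have "\<dots> = ennreal (2 * pi) * (\<integral>\<^sup>+ t. ennreal (leray_normsq \<gamma> r k) * (ennreal (?\<phi> t * normsq_v \<gamma> r k t) * indicator {0<..} t) \<partial>lborel)"
  proof (rule arg_cong[where f="\<lambda>x. ennreal (2 * pi) * x"], rule nn_integral_cong)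
    fix t :: real
    show "ennreal ((leray_const \<gamma> k * t ^ (k + 1))\<^sup>2 * normsq_u \<gamma> r k t) * ennreal ((cmod (?W t))\<^sup>2) * indicator {0<..} t
       = ennreal (leray_normsq \<gamma> r k) * (ennreal (?\<phi> t * normsq_v \<gamma> r k t) * indicator {0<..} t)"
    proof (cases "t > 0")
      case True
      have "(cmod (?W t))\<^sup>2 = (2 * pi)\<^sup>2 * ?\<phi> t * (normsq_v \<gamma> r k t)\<^sup>2"
        unfolding test_fn_moment[OF True] norm_of_real power2_abs by (simp add: power_mult_distrib)
      then have "(leray_const \<gamma> k * t ^ (k + 1))\<^sup>2 * normsq_u \<gamma> r k t * (cmod (?W t))\<^sup>2
         = (2 * pi)\<^sup>2 * ((leray_const \<gamma> k * t ^ (k + 1))\<^sup>2 * normsq_u \<gamma> r k t * normsq_v \<gamma> r k t) * (?\<phi> t * normsq_v \<gamma> r k t)"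
        by (simp only: power2_eq_square mult_ac)
      also have "\<dots> = leray_normsq \<gamma> r k * (?\<phi> t * normsq_v \<gamma> r k t)"
        unfolding leray_const_normsq[OF g True] ..
      finally show ?thesis using True normsq_v_nonneg[OF g q, of t]
        by (simp add: ennreal_mult''[symmetric] del: power_Suc)
    qed simp
  qed
  also have "\<dots> = ennreal (2 * pi) * (ennreal (leray_normsq \<gamma> r k) * ?J)"
    by (subst nn_integral_cmult) (unfold normsq_v_def, measurable)
  also have "\<dots> = ennreal (leray_normsq \<gamma> r k) * (ennreal (2 * pi) * ?J)"
    by (simp only: mult_ac)
  also have "ennreal (2 * pi) * ?J = energy r (test_fn \<gamma> r k)"
  proof -
    let ?v = "\<lambda>t \<alpha>. ennreal ((v_fun \<gamma> r k t \<alpha>)\<^sup>2) * weight r \<alpha>"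
    have "sqnorm (\<lambda>s. test_fn \<gamma> r k s \<alpha>) * weight r \<alpha>
      = ennreal (2 * pi) * (\<integral>\<^sup>+ t. ennreal (?\<phi> t) * ?v t \<alpha> \<partial>lborel)" for \<alpha>
    proof -
      have b: "test_rate \<alpha> > 0" using test_rate_ge_1[of \<alpha>] by linarith
      have "sqnorm (\<lambda>s. test_fn \<gamma> r k s \<alpha>)
         = (\<integral>\<^sup>+ s. ennreal ((\<alpha> powr test_power)\<^sup>2) * ennreal ((cmod (ft (test_profile (test_rate \<alpha>)) s))\<^sup>2) \<partial>lborel)"
        by (intro nn_integral_cong) (simp add: test_fn_def norm_mult power_mult_distrib ennreal_mult'')
      also have "\<dots> = ennreal ((\<alpha> powr test_power)\<^sup>2) * sqnorm (ft (test_profile (test_rate \<alpha>)))"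
        by (rule nn_integral_cmult) (use test_profile_integrable[OF b] in simp)
      also have "\<dots> = ennreal ((\<alpha> powr test_power)\<^sup>2) * (ennreal (2 * pi) * sqnorm (test_profile (test_rate \<alpha>)))"
        by (subst plancherel_ft[OF test_profile_integrable[OF b] test_profile_continuous norm_test_profile_le[OF test_rate_ge_1]]) simp
      finally have "sqnorm (\<lambda>s. test_fn \<gamma> r k s \<alpha>) * weight r \<alpha>
         = ennreal ((\<alpha> powr test_power)\<^sup>2) * (ennreal (2 * pi) * sqnorm (test_profile (test_rate \<alpha>))) * weight r \<alpha>"
        by (rule arg_cong)
      also have "\<dots> = ennreal (2 * pi) * (\<integral>\<^sup>+ t. ennreal ((\<alpha> powr test_power)\<^sup>2) * ennreal ((cmod (test_profile (test_rate \<alpha>) t))\<^sup>2) * weight r \<alpha> \<partial>lborel)"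
        unfolding test_profile_def by (simp add: nn_integral_cmult nn_integral_multc mult_ac)
      also have "(\<integral>\<^sup>+ t. ennreal ((\<alpha> powr test_power)\<^sup>2) * ennreal ((cmod (test_profile (test_rate \<alpha>) t))\<^sup>2) * weight r \<alpha> \<partial>lborel)
         = (\<integral>\<^sup>+ t. ennreal (?\<phi> t) * ?v t \<alpha> \<partial>lborel)"
      proof (intro nn_integral_cong)
        fix t
        have e: "exp (- (t * test_rate \<alpha>)) = exp (- t) * exp (- (t * ((\<gamma> - 1) * \<alpha> powr \<gamma>)))"
          by (simp add: algebra_simps flip: exp_add)
        have "(\<alpha> powr test_power)\<^sup>2 * (cmod (test_profile (test_rate \<alpha>) t))\<^sup>2 = ?\<phi> t * (v_fun \<gamma> r k t \<alpha>)\<^sup>2"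
          unfolding test_profile_def norm_of_real power2_abs e by (simp only: power_mult_distrib mult_ac)
        then show "ennreal ((\<alpha> powr test_power)\<^sup>2) * ennreal ((cmod (test_profile (test_rate \<alpha>) t))\<^sup>2) * weight r \<alpha> = ennreal (?\<phi> t) * ?v t \<alpha>"
          by (simp only: ennreal_mult''[symmetric] zero_le_power2 mult.assoc[symmetric])
      qed
      finally show ?thesis .
    qed
    then have "energy r (test_fn \<gamma> r k) = (\<integral>\<^sup>+ \<alpha>. ennreal (2 * pi) * (\<integral>\<^sup>+ t. ennreal (?\<phi> t) * ?v t \<alpha> \<partial>lborel) \<partial>lborel)"
      by (simp only: energy_def)
    also have "\<dots> = ennreal (2 * pi) * (\<integral>\<^sup>+ \<alpha>. \<integral>\<^sup>+ t. ennreal (?\<phi> t) * ?v t \<alpha> \<partial>lborel \<partial>lborel)"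
      by (rule nn_integral_cmult) measurable
    also have "(\<integral>\<^sup>+ \<alpha>. \<integral>\<^sup>+ t. ennreal (?\<phi> t) * ?v t \<alpha> \<partial>lborel \<partial>lborel) = (\<integral>\<^sup>+ t. \<integral>\<^sup>+ \<alpha>. ennreal (?\<phi> t) * ?v t \<alpha> \<partial>lborel \<partial>lborel)"
      by (rule lborel_pair.Fubini') measurable
    also have "\<dots> = ?J"
    proof (intro nn_integral_cong)
      fix t :: real
      have "(\<integral>\<^sup>+ \<alpha>. ennreal (?\<phi> t) * ?v t \<alpha> \<partial>lborel) = ennreal (?\<phi> t) * (\<integral>\<^sup>+ \<alpha>. ?v t \<alpha> \<partial>lborel)"
        by (rule nn_integral_cmult) measurable
      also have "\<dots> = ennreal (?\<phi> t * normsq_v \<gamma> r k t) * indicator {0<..} t"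
      proof (cases "t > 0")
        case True
        then show ?thesis using nn_integral_v[OF g True q] normsq_v_nonneg[OF g q, of t]
          by (simp add: ennreal_mult'')
      qed simp
      finally show "(\<integral>\<^sup>+ \<alpha>. ennreal (?\<phi> t) * ?v t \<alpha> \<partial>lborel) = ennreal (?\<phi> t * normsq_v \<gamma> r k t) * indicator {0<..} t" .
    qed
    finally show ?thesis by simp
  qed
  finally show ?thesis .
qed

end

section \<open>Truncation\<close>

lemma leray_op_cong:
  assumes "\<And>s \<alpha>. \<alpha> > 0 \<Longrightarrow> G s \<alpha> = H s \<alpha>"
  shows "leray_op \<gamma> k G = leray_op \<gamma> k H"
  unfolding leray_op_def fun_eq_iff
  by (auto intro!: arg_cong2[where f="(*)"] set_lebesgue_integral_cong Bochner_Integration.integral_cong simp: assms)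

lemma energy_mono:
  assumes "\<And>s \<alpha>. \<alpha> > 0 \<Longrightarrow> cmod (G s \<alpha>) \<le> cmod (H s \<alpha>)"
  shows "energy r G \<le> energy r H"
  unfolding energy_def
proof (rule nn_integral_mono)
  fix \<alpha> :: real
  show "sqnorm (\<lambda>s. G s \<alpha>) * weight r \<alpha> \<le> sqnorm (\<lambda>s. H s \<alpha>) * weight r \<alpha>"
    by (cases "\<alpha> > 0") (auto simp: weight_def intro!: mult_right_mono nn_integral_mono ennreal_leI power_mono assms)
qed

lemma energy_eq_pair:
  assumes [measurable]: "measurable2 G"
  shows "energy r G = (\<integral>\<^sup>+ x. ennreal ((cmod (G (snd x) (fst x)))\<^sup>2) * weight r (fst x) \<partial>plane)"
proof -
  have "energy r G = (\<integral>\<^sup>+ \<alpha>. \<integral>\<^sup>+ s. ennreal ((cmod (G s \<alpha>))\<^sup>2) * weight r \<alpha> \<partial>lborel \<partial>lborel)"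
    unfolding energy_def by (simp add: nn_integral_multc)
  also have "\<dots> = (\<integral>\<^sup>+ x. ennreal ((cmod (G (snd x) (fst x)))\<^sup>2) * weight r (fst x) \<partial>plane)"
    by (subst lborel.nn_integral_fst[symmetric]) auto
  finally show ?thesis .
qed

lemma leray_op_measurable:
  assumes [measurable]: "measurable2 G"
  shows "measurable2 (leray_op \<gamma> k G)"
  unfolding leray_op_def set_lebesgue_integral_def leray_A_def leray_B_def Complex_eq by measurable

text \<open>Cutting off to a compact subset of the open half-plane \<open>\<alpha> > 0\<close>; the successor avoids the division by zero at \<open>n = 0\<close>.\<close>
definition truncate :: "nat \<Rightarrow> (real \<Rightarrow> real \<Rightarrow> complex) \<Rightarrow> real \<Rightarrow> real \<Rightarrow> complex" where
  "truncate n G s \<alpha> = (if \<bar>s\<bar> \<le> real (Suc n) \<and> 1 / real (Suc n) \<le> \<alpha> \<and> \<alpha> \<le> real (Suc n) then G s \<alpha> else 0)"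

lemma truncate_measurable:
  assumes [measurable]: "measurable2 G"
  shows "measurable2 (truncate n G)"
  unfolding truncate_def by measurable

lemma norm_truncate_le: "cmod (truncate n G s \<alpha>) \<le> cmod (G s \<alpha>)"
  by (simp add: truncate_def)

lemma eventually_truncate_eq:
  assumes "\<alpha> > 0" shows "eventually (\<lambda>n. truncate n G s \<alpha> = G s \<alpha>) sequentially"
proof -
  have "eventually (\<lambda>n. \<bar>s\<bar> \<le> real (Suc n)) sequentially" "eventually (\<lambda>n. \<alpha> \<le> real (Suc n)) sequentially"
    "eventually (\<lambda>n. 1 / real (Suc n) \<le> \<alpha>) sequentially"
    using assms by real_asymp+
  then show ?thesis by eventually_elim (simp add: truncate_def)
qed

lemma leray_density_truncate_integrable:
  assumes int: "integrable plane (leray_density \<gamma> k G)"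
    and meas: "measurable2 G"
  shows "integrable plane (leray_density \<gamma> k (truncate n G))"
proof (rule Bochner_Integration.integrable_bound[OF int])
  note [measurable] = truncate_measurable[OF meas]
  show "leray_density \<gamma> k (truncate n G) \<in> borel_measurable plane"
    unfolding leray_density_def by measurable
  show "AE x in plane. norm (leray_density \<gamma> k (truncate n G) x) \<le> norm (leray_density \<gamma> k G x)"
    by (auto intro!: AE_I2 simp: leray_density_def norm_mult indicator_def mult_left_mono norm_truncate_le)
qed

lemma leray_op_truncate_tendsto:
  assumes g: "\<gamma> > 1" and a0: "a0 > 0" and int: "integrable plane (leray_density \<gamma> k G)"
    and meas: "measurable2 G"
  shows "(\<lambda>n. leray_op \<gamma> k (truncate n G) s0 a0) \<longlonglongrightarrow> leray_op \<gamma> k G s0 a0"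
proof -
  let ?D = "\<lambda>x::real \<times> real. Complex ((\<gamma> - 1) * fst x powr \<gamma> + a0 powr \<gamma>) (snd x - s0) ^ (k + 2)"
  let ?w = "\<lambda>x. norm (of_real (1 / (a0 powr \<gamma>) ^ (k + 2)) * leray_density \<gamma> k G x)"
  have [measurable]: "?D \<in> borel_measurable (borel \<Otimes>\<^sub>M borel)"
    unfolding Complex_eq by measurable
  note intn = leray_density_truncate_integrable[OF int meas]
  have [measurable]: "leray_density \<gamma> k G \<in> borel_measurable (borel \<Otimes>\<^sub>M borel)"
    using borel_measurable_integrable[OF int] by (simp cong: measurable_cong_sets)
  have [measurable]: "leray_density \<gamma> k (truncate n G) \<in> borel_measurable (borel \<Otimes>\<^sub>M borel)" for n
    using borel_measurable_integrable[OF intn] by (simp cong: measurable_cong_sets)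
  have dom: "norm (leray_density \<gamma> k (truncate n G) x) \<le> norm (leray_density \<gamma> k G x)" for n x
    by (auto simp: leray_density_def norm_mult indicator_def mult_left_mono norm_truncate_le split: prod.split)
  have "(\<lambda>n. LINT x|plane. leray_density \<gamma> k (truncate n G) x / ?D x)
     \<longlonglongrightarrow> (LINT x|plane. leray_density \<gamma> k G x / ?D x)"
  proof (rule integral_dominated_convergence[where w="?w"])
    show "integrable plane ?w"
      by (intro integrable_norm integrable_mult_right int)
    show "AE x in plane. norm (leray_density \<gamma> k (truncate n G) x / ?D x) \<le> ?w x" for n
    proof (rule AE_I2)
      fix x
      have "norm (leray_density \<gamma> k (truncate n G) x / ?D x) \<le> norm (of_real (1 / (a0 powr \<gamma>) ^ (k + 2)) * leray_density \<gamma> k (truncate n G) x)"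
        by (rule norm_leray_integrand_le[OF g a0])
      also have "\<dots> \<le> ?w x"
        unfolding norm_mult by (intro mult_left_mono dom) simp
      finally show "norm (leray_density \<gamma> k (truncate n G) x / ?D x) \<le> ?w x" .
    qed
    show "AE x in plane. (\<lambda>n. leray_density \<gamma> k (truncate n G) x / ?D x) \<longlonglongrightarrow> leray_density \<gamma> k G x / ?D x"
    proof (rule AE_I2)
      fix x :: "real \<times> real"
      have "eventually (\<lambda>n. leray_density \<gamma> k (truncate n G) x / ?D x = leray_density \<gamma> k G x / ?D x) sequentially"
      proof (cases "fst x > 0")
        case True
        show ?thesis using eventually_truncate_eq[OF True, of G "snd x"]
          by eventually_elim (simp add: leray_density_def case_prod_unfold)
      qed (simp add: leray_density_def case_prod_unfold)
      then show "(\<lambda>n. leray_density \<gamma> k (truncate n G) x / ?D x) \<longlonglongrightarrow> leray_density \<gamma> k G x / ?D x"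
        by (rule tendsto_eventually)
    qed
  qed measurable
  then show ?thesis
    unfolding leray_op_eq_integral[OF g a0 int] leray_op_eq_integral[OF g a0 intn]
    by (intro tendsto_mult tendsto_const)
qed

text \<open>The transforms of the truncations converge pointwise, so Fatou's lemma applies on the half-plane.\<close>
lemma energy_leray_op_le_liminf:
  assumes g: "\<gamma> > 1" and int: "integrable plane (leray_density \<gamma> k G)"
    and meas: "measurable2 G"
  shows "energy r (leray_op \<gamma> k G) \<le> liminf (\<lambda>n. energy r (leray_op \<gamma> k (truncate n G)))"
proof -
  note m1[measurable] = leray_op_measurable[OF meas, of \<gamma> k]
  note m2[measurable] = leray_op_measurable[OF truncate_measurable[OF meas], of \<gamma> k]
  let ?f = "\<lambda>H x. ennreal ((cmod (H (snd x) (fst x)))\<^sup>2) * weight r (fst x)"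
  have lim: "?f (leray_op \<gamma> k G) x = liminf (\<lambda>n. ?f (leray_op \<gamma> k (truncate n G)) x)" for x
  proof (cases "fst x > 0")
    case True
    have "(\<lambda>n. ?f (leray_op \<gamma> k (truncate n G)) x) \<longlonglongrightarrow> ?f (leray_op \<gamma> k G) x"
      unfolding mult.commute[of _ "weight r (fst x)"]
      by (intro ennreal_tendsto_cmult tendsto_ennrealI tendsto_power tendsto_norm leray_op_truncate_tendsto[OF g True int meas])
         (simp add: weight_def)
    then show ?thesis by (intro lim_imp_Liminf[symmetric]) auto
  qed (simp add: weight_def Liminf_const)
  have "energy r (leray_op \<gamma> k G) = (\<integral>\<^sup>+ x. liminf (\<lambda>n. ?f (leray_op \<gamma> k (truncate n G)) x) \<partial>plane)"
    unfolding energy_eq_pair[OF m1] lim ..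
  also have "\<dots> \<le> liminf (\<lambda>n. \<integral>\<^sup>+ x. ?f (leray_op \<gamma> k (truncate n G)) x \<partial>plane)"
    by (rule nn_integral_liminf) measurable
  also have "\<dots> = liminf (\<lambda>n. energy r (leray_op \<gamma> k (truncate n G)))"
    unfolding energy_eq_pair[OF m2] ..
  finally show ?thesis .
qed

section \<open>Integration over the hypersurface\<close>

lemma L2_norm_square: "(L2_norm M f)\<^sup>2 = (\<integral>\<^sup>+ x. ennreal ((cmod (f x))\<^sup>2) \<partial>M)"
proof -
  define I where "I = (\<integral>\<^sup>+ x. ennreal ((cmod (f x))\<^sup>2) \<partial>M)"
  have "(L2_norm M f)\<^sup>2 = I"
    by (cases I) (simp_all add: L2_norm_def I_def[symmetric] ennreal_power)
  then show ?thesis by (simp only: I_def)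
qed

lemma ennreal_power2_le_imp_le:
  fixes x y :: ennreal assumes "x\<^sup>2 \<le> y\<^sup>2" shows "x \<le> y"
proof (cases y)
  case (real y')
  then have "x\<^sup>2 < top" using assms by (auto simp: ennreal_power intro: le_less_trans)
  then show ?thesis using real assms
    by (cases x) (auto simp: ennreal_power power2_eq_square[of top] intro!: ennreal_leI power2_le_imp_le)
qed simp

text \<open>The parameter domain of \<open>leray_mu\<close>; the parametrization is certain to take values in the hypersurface only here, so all
  measurability statements are restricted to it.\<close>
definition leray_dom :: "(real \<times> real \<times> real) set" where
  "leray_dom = UNIV \<times> {0<..} \<times> {0..<2 * pi}"

lemma leray_dom_measurable [measurable]: "leray_dom \<in> sets borel"
  unfolding borel_prod[symmetric] leray_dom_def by measurable

lemma leray_param_measurable_restrict: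
  "leray_param \<gamma> \<in> restrict_space lborel leray_dom \<rightarrow>\<^sub>M restrict_space borel (leray_M \<gamma>)"
  using leray_param_measurable[of \<gamma> 0] unfolding leray_dom_def by (simp cong: measurable_cong_sets)

lemma nn_integral_leray_mu:
  assumes f: "f \<in> borel_measurable (restrict_space borel (leray_M \<gamma>))"
  shows "(\<integral>\<^sup>+ z. f z \<partial>leray_mu \<gamma> r) =
    (\<integral>\<^sup>+ \<alpha>. (\<integral>\<^sup>+ s. \<integral>\<^sup>+ \<theta>. f (leray_param \<gamma> (s, \<alpha>, \<theta>)) * indicator {0..<2 * pi} \<theta> \<partial>lborel \<partial>lborel) * weight r \<alpha> \<partial>lborel)"
proof -
  define F where "F = (\<lambda>x. f (leray_param \<gamma> x) * indicator leray_dom x)"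
  let ?d = "\<lambda>(s::real, \<alpha>::real, \<theta>::real). ennreal (\<alpha> powr r)"
  have fp: "(\<lambda>x. f (leray_param \<gamma> x)) \<in> borel_measurable (restrict_space lborel leray_dom)"
    using measurable_compose[OF leray_param_measurable_restrict f] .
  have F: "F \<in> borel_measurable lborel"
    unfolding F_def using fp by (subst (asm) borel_measurable_restrict_space_iff_ennreal) (auto simp: mult.commute)
  then have FM[measurable]: "F \<in> borel_measurable (borel \<Otimes>\<^sub>M (borel \<Otimes>\<^sub>M borel))"
    by (simp add: borel_prod)
  have d: "?d \<in> borel_measurable (restrict_space lborel leray_dom)"
  proof (rule measurable_restrict_space1)
    have "?d \<in> borel_measurable (borel \<Otimes>\<^sub>M (borel \<Otimes>\<^sub>M borel))" by measurable
    then show "?d \<in> borel_measurable lborel" by (simp add: borel_prod)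
  qed
  have "(\<integral>\<^sup>+ z. f z \<partial>leray_mu \<gamma> r) = (\<integral>\<^sup>+ x. f (leray_param \<gamma> x) \<partial>density (restrict_space lborel leray_dom) ?d)"
    unfolding leray_mu_def leray_dom_def[symmetric] using leray_param_measurable[of \<gamma> r, folded leray_dom_def] f
    by (subst nn_integral_distr) auto
  also have "\<dots> = (\<integral>\<^sup>+ x. ?d x * f (leray_param \<gamma> x) \<partial>restrict_space lborel leray_dom)"
    by (rule nn_integral_density[OF d fp])
  also have "\<dots> = (\<integral>\<^sup>+ x. ?d x * f (leray_param \<gamma> x) * indicator leray_dom x \<partial>lborel)"
    by (rule nn_integral_restrict_space) simp
  also have "\<dots> = (\<integral>\<^sup>+ x. ?d x * F x \<partial>(lborel \<Otimes>\<^sub>M (lborel \<Otimes>\<^sub>M lborel)))"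
    by (simp add: lborel_prod mult.assoc F_def)
  also have "\<dots> = (\<integral>\<^sup>+ s. \<integral>\<^sup>+ \<alpha>. \<integral>\<^sup>+ \<theta>. ennreal (\<alpha> powr r) * F (s, \<alpha>, \<theta>) \<partial>lborel \<partial>lborel \<partial>lborel)"
  proof -
    have S: "sigma_finite_measure (lborel \<Otimes>\<^sub>M lborel :: (real \<times> real) measure)"
      by (simp add: lborel_prod lborel.sigma_finite_measure_axioms)
    have "(\<integral>\<^sup>+ x. ?d x * F x \<partial>(lborel \<Otimes>\<^sub>M (lborel \<Otimes>\<^sub>M lborel))) = (\<integral>\<^sup>+ s. \<integral>\<^sup>+ y. ?d (s, y) * F (s, y) \<partial>(lborel \<Otimes>\<^sub>M lborel) \<partial>lborel)"
      by (rule sigma_finite_measure.nn_integral_fst[OF S, symmetric]) measurable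
    also have "\<dots> = (\<integral>\<^sup>+ s. \<integral>\<^sup>+ \<alpha>. \<integral>\<^sup>+ \<theta>. ?d (s, \<alpha>, \<theta>) * F (s, \<alpha>, \<theta>) \<partial>lborel \<partial>lborel \<partial>lborel)"
    proof (intro nn_integral_cong lborel.nn_integral_fst[symmetric])
      fix s :: real
      have Fs: "(\<lambda>y. F (s, y)) \<in> borel_measurable (borel \<Otimes>\<^sub>M borel)"
        by (rule measurable_compose[OF measurable_Pair1' FM]) simp
      have "(\<lambda>y. ennreal (fst y powr r) :: ennreal) \<in> borel_measurable (borel \<Otimes>\<^sub>M borel)" by measurable
      from borel_measurable_times_ennreal[OF this Fs]
      have "(\<lambda>y. ?d (s, y) * F (s, y)) \<in> borel_measurable (borel \<Otimes>\<^sub>M borel)"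
        by (simp add: case_prod_unfold)
      then show "(\<lambda>y. ?d (s, y) * F (s, y)) \<in> borel_measurable (lborel \<Otimes>\<^sub>M lborel)"
        by (simp cong: measurable_cong_sets)
    qed
    finally show ?thesis by simp
  qed
  also have "\<dots> = (\<integral>\<^sup>+ \<alpha>. \<integral>\<^sup>+ s. \<integral>\<^sup>+ \<theta>. ennreal (\<alpha> powr r) * F (s, \<alpha>, \<theta>) \<partial>lborel \<partial>lborel \<partial>lborel)"
    by (rule lborel_pair.Fubini') measurable
  also have "\<dots> = (\<integral>\<^sup>+ \<alpha>. ennreal (\<alpha> powr r) * (\<integral>\<^sup>+ s. \<integral>\<^sup>+ \<theta>. F (s, \<alpha>, \<theta>) \<partial>lborel \<partial>lborel) \<partial>lborel)"
    by (simp add: nn_integral_cmult)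
  also have "\<dots> = (\<integral>\<^sup>+ \<alpha>. (\<integral>\<^sup>+ s. \<integral>\<^sup>+ \<theta>. f (leray_param \<gamma> (s, \<alpha>, \<theta>)) * indicator {0..<2 * pi} \<theta> \<partial>lborel \<partial>lborel) * weight r \<alpha> \<partial>lborel)"
  proof (rule nn_integral_cong)
    fix \<alpha> :: real
    show "ennreal (\<alpha> powr r) * (\<integral>\<^sup>+ s. \<integral>\<^sup>+ \<theta>. F (s, \<alpha>, \<theta>) \<partial>lborel \<partial>lborel)
       = (\<integral>\<^sup>+ s. \<integral>\<^sup>+ \<theta>. f (leray_param \<gamma> (s, \<alpha>, \<theta>)) * indicator {0..<2 * pi} \<theta> \<partial>lborel \<partial>lborel) * weight r \<alpha>"
      by (cases "\<alpha> > 0") (simp_all add: F_def leray_dom_def weight_def indicator_times mult.commute)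
  qed
  finally show ?thesis .
qed

lemma leray_param_coords:
  "\<alpha> > 0 \<Longrightarrow> Re (snd (leray_param \<gamma> (s, \<alpha>, \<theta>))) = s"
  "\<alpha> > 0 \<Longrightarrow> cmod (fst (leray_param \<gamma> (s, \<alpha>, \<theta>))) = \<alpha>"
  by (simp_all add: leray_param_def norm_mult)

text \<open>When the modulus depends on \<open>s\<close> and \<open>\<alpha>\<close> only, the angular integral contributes \<open>2 \<pi>\<close>.\<close>
lemma nn_integral_leray_mu_radial:
  assumes f: "(\<lambda>z. ennreal ((cmod (f z))\<^sup>2)) \<in> borel_measurable (restrict_space borel (leray_M \<gamma>))"
    and H: "\<And>s \<alpha> \<theta>. \<alpha> > 0 \<Longrightarrow> cmod (f (leray_param \<gamma> (s, \<alpha>, \<theta>))) = cmod (H s \<alpha>)"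
    and meas[measurable]: "measurable2 H"
  shows "(L2_norm (leray_mu \<gamma> r) f)\<^sup>2 = ennreal (2 * pi) * energy r H"
proof -
  have "(L2_norm (leray_mu \<gamma> r) f)\<^sup>2 = (\<integral>\<^sup>+ \<alpha>. ennreal (2 * pi) * (sqnorm (\<lambda>s. H s \<alpha>) * weight r \<alpha>) \<partial>lborel)"
    unfolding L2_norm_square nn_integral_leray_mu[OF f]
  proof (rule nn_integral_cong)
    fix \<alpha> :: real
    show "(\<integral>\<^sup>+ s. \<integral>\<^sup>+ \<theta>. ennreal ((cmod (f (leray_param \<gamma> (s, \<alpha>, \<theta>))))\<^sup>2) * indicator {0..<2 * pi} \<theta> \<partial>lborel \<partial>lborel) * weight r \<alpha>
       = ennreal (2 * pi) * (sqnorm (\<lambda>s. H s \<alpha>) * weight r \<alpha>)"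
    proof (cases "\<alpha> > 0")
      case True
      have "(\<integral>\<^sup>+ s. \<integral>\<^sup>+ \<theta>. ennreal ((cmod (f (leray_param \<gamma> (s, \<alpha>, \<theta>))))\<^sup>2) * indicator {0..<2 * pi} \<theta> \<partial>lborel \<partial>lborel)
         = (\<integral>\<^sup>+ s. ennreal ((cmod (H s \<alpha>))\<^sup>2) * ennreal (2 * pi) \<partial>lborel)"
        using True by (simp add: H nn_integral_cmult)
      also have "\<dots> = sqnorm (\<lambda>s. H s \<alpha>) * ennreal (2 * pi)"
        by (rule nn_integral_multc) measurable
      finally show ?thesis by (simp only: mult_ac)
    qed (simp add: weight_def)
  qed
  also have "\<dots> = ennreal (2 * pi) * energy r H"
    unfolding energy_def by (rule nn_integral_cmult) measurable
  finally show ?thesis .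
qed

text \<open>The Fourier coefficient, cut off to the half-plane \<open>\<alpha> > 0\<close>: beyond it the parametrization may leave the
  hypersurface, where a function in the \<open>L\<^sup>2\<close> space is arbitrary and its coefficient need not be measurable.\<close>
definition radial_part :: "real \<Rightarrow> nat \<Rightarrow> (complex \<times> complex \<Rightarrow> complex) \<Rightarrow> real \<Rightarrow> real \<Rightarrow> complex" where
  "radial_part \<gamma> k f s \<alpha> = indicator {0<..} \<alpha> *\<^sub>R fourier_coeff \<gamma> (int k) f s \<alpha>"

definition pullback :: "real \<Rightarrow> (complex \<times> complex \<Rightarrow> complex) \<Rightarrow> real \<times> real \<times> real \<Rightarrow> complex" where
  "pullback \<gamma> f x = indicator leray_dom x *\<^sub>R f (leray_param \<gamma> x)"

lemma pullback_measurable: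
  assumes f: "f \<in> borel_measurable (restrict_space borel (leray_M \<gamma>))"
  shows "pullback \<gamma> f \<in> borel_measurable (borel \<Otimes>\<^sub>M (borel \<Otimes>\<^sub>M borel))"
proof -
  have "pullback \<gamma> f \<in> borel_measurable lborel"
    unfolding pullback_def[abs_def] using measurable_compose[OF leray_param_measurable_restrict f]
    by (subst (asm) borel_measurable_restrict_space_iff) (auto simp: scaleR_conv_of_real)
  then show ?thesis by (simp add: borel_prod)
qed

lemma radial_part_eq:
  "radial_part \<gamma> k f s \<alpha> = of_real (1 / (2 * pi)) *
     (LINT \<theta>|lborel. pullback \<gamma> f (s, \<alpha>, \<theta>) * cis (- (of_int (int k) * \<theta>)))"
  by (cases "\<alpha> > 0") (simp_all add: radial_part_def fourier_coeff_def set_lebesgue_integral_def pullback_def leray_dom_def indicator_times)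

lemma radial_part_measurable:
  assumes f: "f \<in> borel_measurable (restrict_space borel (leray_M \<gamma>))"
  shows "measurable2 (radial_part \<gamma> k f)"
proof -
  note [measurable] = pullback_measurable[OF f]
  show ?thesis unfolding radial_part_eq by measurable
qed

text \<open>Bessel's inequality for one angular mode, by Cauchy-Schwarz on the circle.\<close>
lemma energy_radial_part_le:
  assumes f: "f \<in> borel_measurable (restrict_space borel (leray_M \<gamma>))"
  shows "ennreal (2 * pi) * energy r (radial_part \<gamma> k f) \<le> (L2_norm (leray_mu \<gamma> r) f)\<^sup>2"
proof -
  note [measurable] = pullback_measurable[OF f] radial_part_measurable[OF f]
  have f2: "(\<lambda>z. ennreal ((cmod (f z))\<^sup>2)) \<in> borel_measurable (restrict_space borel (leray_M \<gamma>))"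
    using f by measurable
  have "ennreal (2 * pi) * energy r (radial_part \<gamma> k f) = (\<integral>\<^sup>+ \<alpha>. (\<integral>\<^sup>+ s. ennreal (2 * pi) * ennreal ((cmod (radial_part \<gamma> k f s \<alpha>))\<^sup>2) \<partial>lborel) * weight r \<alpha> \<partial>lborel)"
    unfolding energy_def by (simp add: nn_integral_cmult mult.assoc)
  also have "\<dots> \<le> (L2_norm (leray_mu \<gamma> r) f)\<^sup>2"
    unfolding L2_norm_square nn_integral_leray_mu[OF f2]
  proof (rule nn_integral_mono)
    fix \<alpha> :: real
    show "(\<integral>\<^sup>+ s. ennreal (2 * pi) * ennreal ((cmod (radial_part \<gamma> k f s \<alpha>))\<^sup>2) \<partial>lborel) * weight r \<alpha>
       \<le> (\<integral>\<^sup>+ s. \<integral>\<^sup>+ \<theta>. ennreal ((cmod (f (leray_param \<gamma> (s, \<alpha>, \<theta>))))\<^sup>2) * indicator {0..<2 * pi} \<theta> \<partial>lborel \<partial>lborel) * weight r \<alpha>"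
    proof (cases "\<alpha> > 0")
      case a: True
      show ?thesis
      proof (intro mult_right_mono nn_integral_mono)
        fix s :: real
        let ?g = "\<lambda>\<theta>. pullback \<gamma> f (s, \<alpha>, \<theta>)"
        let ?I = "\<integral>\<^sup>+ \<theta>. ennreal ((cmod (f (leray_param \<gamma> (s, \<alpha>, \<theta>))))\<^sup>2) * indicator {0..<2 * pi} \<theta> \<partial>lborel"
        have "ennreal (2 * pi * cmod (radial_part \<gamma> k f s \<alpha>)) = ennreal (cmod (LINT \<theta>|lborel. ?g \<theta> * cis (- (of_int (int k) * \<theta>))))"
          unfolding radial_part_eq by (simp add: norm_mult norm_divide)
        also have "\<dots> \<le> (\<integral>\<^sup>+ \<theta>. ennreal (cmod (?g \<theta> * cis (- (of_int (int k) * \<theta>)))) \<partial>lborel)"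
          by (rule norm_integral_le_nn_integral)
        also have "\<dots> = (\<integral>\<^sup>+ \<theta>. indicator {0..<2 * pi} \<theta> * ennreal (cmod (?g \<theta>)) \<partial>lborel)"
          by (intro nn_integral_cong) (simp add: norm_mult pullback_def leray_dom_def indicator_times split: split_indicator)
        finally have "(ennreal (2 * pi * cmod (radial_part \<gamma> k f s \<alpha>)))\<^sup>2 \<le> (\<integral>\<^sup>+ \<theta>. indicator {0..<2 * pi} \<theta> * ennreal (cmod (?g \<theta>)) \<partial>lborel)\<^sup>2"
          by (rule power_mono) simp
        also have "\<dots> \<le> (\<integral>\<^sup>+ \<theta>. (indicator {0..<2 * pi} \<theta>)\<^sup>2 \<partial>lborel) * (\<integral>\<^sup>+ \<theta>. (ennreal (cmod (?g \<theta>)))\<^sup>2 \<partial>lborel)"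
          by (rule nn_integral_Cauchy_Schwarz) measurable
        also have "(\<integral>\<^sup>+ \<theta>. (indicator {0..<2 * pi} \<theta>)\<^sup>2 \<partial>(lborel::real measure)) = ennreal (2 * pi)"
        proof -
          have "(\<integral>\<^sup>+ \<theta>. (indicator {0..<2 * pi} \<theta>)\<^sup>2 \<partial>(lborel::real measure)) = (\<integral>\<^sup>+ \<theta>. indicator {0..<2 * pi} \<theta> \<partial>(lborel::real measure))"
            by (intro nn_integral_cong) (simp split: split_indicator)
          then show ?thesis by simp
        qed
        also have "(\<integral>\<^sup>+ \<theta>. (ennreal (cmod (?g \<theta>)))\<^sup>2 \<partial>lborel) = ?I"
          by (intro nn_integral_cong) (use a in \<open>simp add: ennreal_power pullback_def leray_dom_def indicator_times split: split_indicator\<close>)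
        finally have "ennreal (2 * pi) * (ennreal (2 * pi) * ennreal ((cmod (radial_part \<gamma> k f s \<alpha>))\<^sup>2)) \<le> ennreal (2 * pi) * ?I"
          by (simp add: ennreal_power ennreal_mult''[symmetric] power_mult_distrib) (simp add: power2_eq_square mult_ac)
        then show "ennreal (2 * pi) * ennreal ((cmod (radial_part \<gamma> k f s \<alpha>))\<^sup>2) \<le> ?I"
          by (subst (asm) ennreal_mult_le_mult_iff) auto
      qed simp
    qed (simp add: weight_def)
  qed
  finally show ?thesis .
qed

section \<open>From the hypersurface to radial functions\<close>

lemma measurable_leray_mu_iff:
  "f \<in> borel_measurable (leray_mu \<gamma> r) \<longleftrightarrow> f \<in> borel_measurable (restrict_space borel (leray_M \<gamma>))"
  unfolding leray_mu_def by simp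

lemma leray_coords_measurable:
  assumes H: "(\<lambda>(s, \<alpha>). H s \<alpha> :: complex) \<in> borel_measurable (borel \<Otimes>\<^sub>M borel)"
  shows "(\<lambda>z::complex \<times> complex. H (Re (snd z)) (cmod (fst z))) \<in> borel_measurable borel"
proof -
  note [measurable] = H
  have [measurable]: "Re \<in> borel_measurable borel" by (intro borel_measurable_continuous_onI continuous_intros)
  show ?thesis unfolding borel_prod[symmetric] by measurable
qed

lemma leray_op_square_measurable:
  assumes meas: "measurable2 G"
  shows "(\<lambda>z. ennreal ((cmod (leray_op \<gamma> k G (Re (snd z)) (cmod (fst z))))\<^sup>2)) \<in> borel_measurable (restrict_space borel (leray_M \<gamma>))"
proof -
  note [measurable] = leray_coords_measurable[OF leray_op_measurable[OF meas, of \<gamma> k]]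
  show ?thesis by (rule measurable_restrict_space1) measurable
qed

lemma cmod_leray_k:
  "cmod (leray_k \<gamma> k f z) = cmod (leray_op \<gamma> k (radial_part \<gamma> k f) (Re (snd z)) (cmod (fst z)))"
proof -
  have "leray_op \<gamma> k (radial_part \<gamma> k f) = leray_op \<gamma> k (fourier_coeff \<gamma> (int k) f)"
    by (rule leray_op_cong) (simp add: radial_part_def)
  moreover have "leray_k \<gamma> k f z = cis (real k * Arg (fst z)) * leray_op \<gamma> k (fourier_coeff \<gamma> (int k) f) (Re (snd z)) (cmod (fst z))"
    by (simp only: leray_k_def leray_op_def Let_def mult.assoc)
  ultimately show ?thesis by (simp add: norm_mult)
qed

lemma L2_norm_leray_k:
  assumes f: "f \<in> borel_measurable (restrict_space borel (leray_M \<gamma>))"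
  shows "(L2_norm (leray_mu \<gamma> r) (leray_k \<gamma> k f))\<^sup>2 = ennreal (2 * pi) * energy r (leray_op \<gamma> k (radial_part \<gamma> k f))"
proof (rule nn_integral_leray_mu_radial)
  show "(\<lambda>z. ennreal ((cmod (leray_k \<gamma> k f z))\<^sup>2)) \<in> borel_measurable (restrict_space borel (leray_M \<gamma>))"
    unfolding cmod_leray_k by (rule leray_op_square_measurable[OF radial_part_measurable[OF f]])
  show "cmod (leray_k \<gamma> k f (leray_param \<gamma> (s, \<alpha>, \<theta>))) = cmod (leray_op \<gamma> k (radial_part \<gamma> k f) s \<alpha>)" if "\<alpha> > 0" for s \<alpha> \<theta>
    unfolding cmod_leray_k leray_param_coords[OF that] ..
qed (rule leray_op_measurable[OF radial_part_measurable[OF f]])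

text \<open>The integrability hypotheses of \<open>energy_leray_op_le\<close> hold for bounded functions supported in a compact
  subset of the open half-plane.\<close>
lemma bounded_support_admissible:
  assumes meas: "measurable2 G"
    and d: "\<delta> > 0"
    and bound: "\<And>s \<alpha>. cmod (G s \<alpha>) \<le> B"
    and supp: "\<And>s \<alpha>. G s \<alpha> \<noteq> 0 \<Longrightarrow> \<bar>s\<bar> \<le> R \<and> \<delta> \<le> \<alpha> \<and> \<alpha> \<le> R"
  shows "integrable plane (leray_density \<gamma> k G)"
    and "integrable lborel (\<lambda>s. G s \<alpha>)"
proof -
  note [measurable] = meas
  let ?w = "(\<gamma> - 1) * (real k + 1)"
  obtain C where C: "\<And>\<alpha>. \<delta> \<le> \<alpha> \<Longrightarrow> \<alpha> \<le> R \<Longrightarrow> \<alpha> powr ?w \<le> C"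
  proof -
    have "compact ((\<lambda>\<alpha>. \<alpha> powr ?w) ` {\<delta>..R})"
      using d by (intro compact_continuous_image continuous_intros) auto
    then obtain C where "\<forall>x\<in>(\<lambda>\<alpha>. \<alpha> powr ?w) ` {\<delta>..R}. norm x \<le> C"
      using compact_imp_bounded bounded_iff by metis
    then show ?thesis by (intro that[of C]) auto
  qed
  have B: "B \<ge> 0" using bound[of 0 0] norm_ge_zero order_trans by blast
  show "integrable plane (leray_density \<gamma> k G)"
  proof (rule Bochner_Integration.integrable_bound)
    show "integrable plane (\<lambda>x. indicator (cbox (\<delta>, -R) (R, R)) x *\<^sub>R (C * B))"
      unfolding lborel_prod by (intro integrable_scaleR_left integrable_real_indicator emeasure_lborel_cbox_finite) simp
    show "leray_density \<gamma> k G \<in> borel_measurable plane"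
      unfolding leray_density_def by measurable
    show "AE x in plane. norm (leray_density \<gamma> k G x) \<le> norm (indicator (cbox (\<delta>, -R) (R, R)) x *\<^sub>R (C * B))"
    proof (rule AE_I2)
      fix x :: "real \<times> real"
      obtain \<alpha> s where x: "x = (\<alpha>, s)" by fastforce
      show "norm (leray_density \<gamma> k G x) \<le> norm (indicator (cbox (\<delta>, -R) (R, R)) x *\<^sub>R (C * B))"
      proof (cases "G s \<alpha> = 0")
        case True
        then show ?thesis by (simp add: leray_density_def x)
      next
        case False
        then have s: "\<bar>s\<bar> \<le> R" "\<delta> \<le> \<alpha>" "\<alpha> \<le> R" using supp by auto
        then have "x \<in> cbox (\<delta>, -R) (R, R)" by (auto simp: x cbox_Pair_eq)
        moreover have "norm (leray_density \<gamma> k G x) \<le> C * B"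
          using s d C[OF s(2,3)] bound[of s \<alpha>] by (auto simp: leray_density_def x norm_mult intro!: mult_mono intro: order_trans[OF powr_ge_zero])
        ultimately show ?thesis using abs_ge_self[of "C * B"] by (simp only: indicator_simps scaleR_one real_norm_def)
      qed
    qed
  qed
  show "integrable lborel (\<lambda>s. G s \<alpha>)"
  proof (rule Bochner_Integration.integrable_bound)
    show "integrable lborel (\<lambda>s. indicator {-R..R} s *\<^sub>R B)"
      by (intro integrable_scaleR_left integrable_real_indicator) (auto simp: emeasure_lborel_Icc_eq)
    show "(\<lambda>s. G s \<alpha>) \<in> borel_measurable lborel" by measurable
    show "AE s in lborel. norm (G s \<alpha>) \<le> norm (indicator {-R..R} s *\<^sub>R B)"
    proof (rule AE_I2)
      fix s
      show "norm (G s \<alpha>) \<le> norm (indicator {-R..R} s *\<^sub>R B)"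
        using supp[of s \<alpha>] bound[of s \<alpha>] B by (cases "G s \<alpha> = 0") (auto simp: abs_le_iff)
    qed
  qed
qed

text \<open>A compact subset of the hypersurface that avoids \<open>\<zeta>\<^sub>1 = 0\<close> stays at a positive distance from it.\<close>
lemma L2k_core_radial_part:
  assumes f: "f \<in> L2k_core \<gamma> r (int k)"
  obtains \<delta> B R where "\<delta> > 0" "\<And>s \<alpha>. cmod (radial_part \<gamma> k f s \<alpha>) \<le> B"
    "\<And>s \<alpha>. radial_part \<gamma> k f s \<alpha> \<noteq> 0 \<Longrightarrow> \<bar>s\<bar> \<le> R \<and> \<delta> \<le> \<alpha> \<and> \<alpha> \<le> R"
proof -
  from f obtain K where bd: "bounded (f ` leray_M \<gamma>)" and K: "compact K" "K \<subseteq> {\<zeta> \<in> leray_M \<gamma>. fst \<zeta> \<noteq> 0}"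
    and z: "\<And>\<zeta>. \<zeta> \<in> leray_M \<gamma> \<Longrightarrow> \<zeta> \<notin> K \<Longrightarrow> f \<zeta> = 0"
    unfolding L2k_core_def by blast
  obtain B where B: "\<And>\<zeta>. \<zeta> \<in> leray_M \<gamma> \<Longrightarrow> cmod (f \<zeta>) \<le> B"
    using bd unfolding bounded_iff by auto
  obtain R where R: "\<And>\<zeta>. \<zeta> \<in> K \<Longrightarrow> norm \<zeta> \<le> R"
    using compact_imp_bounded[OF K(1)] unfolding bounded_iff by auto
  obtain \<delta> where \<delta>: "\<delta> > 0" "\<And>\<zeta>. \<zeta> \<in> K \<Longrightarrow> \<delta> \<le> cmod (fst \<zeta>)"
  proof (cases "K = {}")
    case False
    have "\<exists>x\<in>K. \<forall>y\<in>K. cmod (fst x) \<le> cmod (fst y)"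
      by (rule continuous_attains_inf[OF K(1) False]) (intro continuous_intros)
    then obtain \<zeta>0 where "\<zeta>0 \<in> K" "\<And>\<zeta>. \<zeta> \<in> K \<Longrightarrow> cmod (fst \<zeta>0) \<le> cmod (fst \<zeta>)"
      by blast
    then show ?thesis using K(2) by (intro that[of "cmod (fst \<zeta>0)"]) auto
  qed (auto intro: that[of 1])
  \<comment> \<open>Outside the box determined by \<open>K\<close> the whole circle over \<open>(s, \<alpha>)\<close> misses \<open>K\<close>.\<close>
  have pb: "pullback \<gamma> f (s, \<alpha>, \<theta>) = 0" if "\<not> (\<bar>s\<bar> \<le> R \<and> \<delta> \<le> \<alpha> \<and> \<alpha> \<le> R)" for s \<alpha> \<theta>
  proof (cases "\<alpha> > 0")
    case a: True
    let ?\<zeta> = "leray_param \<gamma> (s, \<alpha>, \<theta>)"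
    have "?\<zeta> \<notin> K"
    proof
      assume in_K: "?\<zeta> \<in> K"
      have "\<delta> \<le> \<alpha>" using \<delta>(2)[OF in_K] leray_param_coords(2)[OF a] by simp
      moreover have "\<alpha> \<le> R" using R[OF in_K] norm_fst_le[of "fst ?\<zeta>" "snd ?\<zeta>"] leray_param_coords(2)[OF a, of \<gamma> s \<theta>] by simp
      moreover have "\<bar>s\<bar> \<le> R"
        using R[OF in_K] norm_snd_le[of "snd ?\<zeta>" "fst ?\<zeta>"] abs_Re_le_cmod[of "snd ?\<zeta>"] leray_param_coords(1)[OF a, of \<gamma> s \<theta>] by simp
      ultimately show False using that by simp
    qed
    then show ?thesis using z[OF leray_param_in_M[OF a]] by (simp add: pullback_def)
  qed (simp add: pullback_def leray_dom_def)
  have "leray_param \<gamma> (0, 1, 0) \<in> leray_M \<gamma>" by (rule leray_param_in_M) simp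
  then have B0: "B \<ge> 0" using B norm_ge_zero order_trans by blast
  have pbB: "cmod (pullback \<gamma> f (s, \<alpha>, \<theta>)) \<le> indicator {0..<2*pi} \<theta> * B" for s \<alpha> \<theta>
  proof (cases "(s, \<alpha>, \<theta>) \<in> leray_dom")
    case True
    then show ?thesis using B[OF leray_param_in_M] by (auto simp: pullback_def leray_dom_def)
  next
    case False
    then show ?thesis using B0 by (simp add: pullback_def)
  qed
  show ?thesis
  proof (rule that)
    show "\<delta> > 0" by (rule \<delta>)
    show "\<bar>s\<bar> \<le> R \<and> \<delta> \<le> \<alpha> \<and> \<alpha> \<le> R" if "radial_part \<gamma> k f s \<alpha> \<noteq> 0" for s \<alpha>
      using that pb[of s \<alpha>] unfolding radial_part_eq by fastforce
    show "cmod (radial_part \<gamma> k f s \<alpha>) \<le> B" for s \<alpha>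
    proof -
      have "cmod (LINT \<theta>|lborel. pullback \<gamma> f (s, \<alpha>, \<theta>) * cis (- (of_int (int k) * \<theta>))) \<le> (LINT \<theta>|lborel. indicator {0..<2*pi} \<theta> * B)"
      proof (rule order_trans[OF integral_norm_bound])
        have i: "integrable lborel (\<lambda>\<theta>. indicator {0..<2*pi} \<theta> * B)"
          by (intro integrable_mult_left integrable_real_indicator) auto
        show "(LINT \<theta>|lborel. norm (pullback \<gamma> f (s, \<alpha>, \<theta>) * cis (- (of_int (int k) * \<theta>)))) \<le> (LINT \<theta>|lborel. indicator {0..<2*pi} \<theta> * B)"
          using pbB[of s \<alpha>] B0 by (intro integral_mono_AE' i AE_I2) (auto simp: norm_mult)
      qed
      also have "\<dots> = 2 * pi * B" by simp
      finally show ?thesis unfolding radial_part_eq by (simp add: norm_mult norm_divide field_simps)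
    qed
  qed
qed

lemma L2k_core_in_L2_space:
  assumes "f \<in> L2k_core \<gamma> r k" shows "f \<in> L2_space (leray_mu \<gamma> r)"
proof -
  have "f \<in> L2k_space \<gamma> r k"
    using assms unfolding L2k_core_def mem_Collect_eq by (rule conjunct1)
  then show ?thesis unfolding L2k_space_def mem_Collect_eq by (rule conjunct1)
qed

lemma L2k_core_measurable:
  assumes "f \<in> L2k_core \<gamma> r k"
  shows "f \<in> borel_measurable (restrict_space borel (leray_M \<gamma>))"
    and "L2_norm (leray_mu \<gamma> r) f < top"
  using L2k_core_in_L2_space[OF assms] by (simp_all add: L2_space_def measurable_leray_mu_iff)

lemma L2_norm_leray_k_le:
  assumes g: "\<gamma> > 1" and p: "p_exp \<gamma> r k > 0" and q: "q_exp \<gamma> r k > 0" and f: "f \<in> L2k_core \<gamma> r (int k)"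
  shows "(L2_norm (leray_mu \<gamma> r) (leray_k \<gamma> k f))\<^sup>2 \<le> ennreal (leray_normsq \<gamma> r k) * (L2_norm (leray_mu \<gamma> r) f)\<^sup>2"
proof (rule L2k_core_radial_part[OF f])
  note m = L2k_core_measurable(1)[OF f]
  note rm = radial_part_measurable[OF m, of k]
  fix \<delta> B R
  assume adm: "\<delta> > 0" "\<And>s \<alpha>. cmod (radial_part \<gamma> k f s \<alpha>) \<le> B"
    "\<And>s \<alpha>. radial_part \<gamma> k f s \<alpha> \<noteq> 0 \<Longrightarrow> \<bar>s\<bar> \<le> R \<and> \<delta> \<le> \<alpha> \<and> \<alpha> \<le> R"
  note int = bounded_support_admissible[OF rm adm]
  have "(L2_norm (leray_mu \<gamma> r) (leray_k \<gamma> k f))\<^sup>2 = ennreal (2 * pi) * energy r (leray_op \<gamma> k (radial_part \<gamma> k f))"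
    by (rule L2_norm_leray_k[OF m])
  also have "\<dots> \<le> ennreal (2 * pi) * (ennreal (leray_normsq \<gamma> r k) * energy r (radial_part \<gamma> k f))"
    by (intro mult_left_mono energy_leray_op_le[OF g p q int(1) rm int(2)]) simp_all
  also have "\<dots> = ennreal (leray_normsq \<gamma> r k) * (ennreal (2 * pi) * energy r (radial_part \<gamma> k f))"
    by (simp only: mult_ac)
  also have "\<dots> \<le> ennreal (leray_normsq \<gamma> r k) * (L2_norm (leray_mu \<gamma> r) f)\<^sup>2"
    by (intro mult_left_mono energy_radial_part_le[OF m]) simp_all
  finally show "(L2_norm (leray_mu \<gamma> r) (leray_k \<gamma> k f))\<^sup>2 \<le> ennreal (leray_normsq \<gamma> r k) * (L2_norm (leray_mu \<gamma> r) f)\<^sup>2" .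
qed

section \<open>The norm of each component and its limit\<close>

lemma ennreal_divide_le_iff:
  fixes a b c :: ennreal assumes "b \<noteq> 0" "b \<noteq> top"
  shows "a / b \<le> c \<longleftrightarrow> a \<le> c * b"
proof
  assume "a / b \<le> c"
  then have "a / b * b \<le> c * b" by (rule mult_right_mono) simp
  also have "a / b * b = a"
    using ennreal_mult_divide_eq[OF assms, of a] by (simp only: mult.commute[of "a / b"] ennreal_times_divide mult.commute[of a])
  finally show "a \<le> c * b" .
next
  assume "a \<le> c * b"
  then have "a / b \<le> c * b / b" by (rule divide_right_mono_ennreal)
  then show "a / b \<le> c" using assms by (simp add: ennreal_mult_divide_eq)
qed

text \<open>The function with modulus \<open>|G|\<close> and angular mode \<open>k\<close>; the power of \<open>sgn \<zeta>\<^sub>1\<close> is a manifestly measurable form of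
  \<open>cis (k * Arg \<zeta>\<^sub>1)\<close>.\<close>
definition lift_radial :: "nat \<Rightarrow> (real \<Rightarrow> real \<Rightarrow> complex) \<Rightarrow> complex \<times> complex \<Rightarrow> complex" where
  "lift_radial k G \<zeta> = G (Re (snd \<zeta>)) (cmod (fst \<zeta>)) * sgn (fst \<zeta>) ^ k"

lemma sgn_power_eq_cis:
  assumes "z \<noteq> 0" shows "sgn z ^ k = cis (real k * Arg z)"
  unfolding cis_Arg[OF assms, symmetric] by (rule Complex.DeMoivre)

lemma lift_radial_param:
  assumes "\<alpha> > 0"
  shows "lift_radial k G (leray_param \<gamma> (s, \<alpha>, \<theta>)) = G s \<alpha> * cis (real k * \<theta>)"
proof -
  have "sgn (fst (leray_param \<gamma> (s, \<alpha>, \<theta>))) = cis \<theta>"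
    using assms by (simp add: leray_param_def sgn_eq norm_mult)
  then show ?thesis
    unfolding lift_radial_def leray_param_coords[OF assms] by (simp add: Complex.DeMoivre)
qed

lemma lift_radial_measurable:
  assumes "measurable2 G"
  shows "lift_radial k G \<in> borel_measurable borel"
proof -
  note [measurable] = leray_coords_measurable[OF assms]
  have [measurable]: "(\<lambda>z::complex \<times> complex. fst z) \<in> borel_measurable borel"
    by (intro borel_measurable_continuous_onI continuous_intros)
  have [measurable]: "(sgn :: complex \<Rightarrow> complex) \<in> borel_measurable borel"
    unfolding sgn_div_norm[abs_def] by measurable
  show ?thesis unfolding lift_radial_def by measurable
qed

lemma fourier_coeff_lift_radial:
  assumes "\<alpha> > 0"
  shows "fourier_coeff \<gamma> (int k) (lift_radial k G) s \<alpha> = G s \<alpha>"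
proof -
  have "fourier_coeff \<gamma> (int k) (lift_radial k G) s \<alpha> = of_real (1 / (2 * pi)) * (LINT \<theta>:{0..<2 * pi}|lborel. G s \<alpha>)"
    unfolding fourier_coeff_def lift_radial_param[OF assms] mult.assoc cis_mult by simp
  also have "(LINT \<theta>:{0..<2 * pi}|lborel. G s \<alpha>) = of_real (2 * pi) * G s \<alpha>"
    by (simp add: set_lebesgue_integral_def scaleR_conv_of_real)
  finally show ?thesis by simp
qed

lemma L2_norm_lift_radial:
  assumes meas: "measurable2 G"
  shows "(L2_norm (leray_mu \<gamma> r) (lift_radial k G))\<^sup>2 = ennreal (2 * pi) * energy r G"
proof (rule nn_integral_leray_mu_radial)
  note [measurable] = lift_radial_measurable[OF meas, of k]
  show "(\<lambda>z. ennreal ((cmod (lift_radial k G z))\<^sup>2)) \<in> borel_measurable (restrict_space borel (leray_M \<gamma>))"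
    by (rule measurable_restrict_space1) measurable
qed (simp_all add: lift_radial_param norm_mult meas)

lemma leray_M_closed: "\<gamma> > 0 \<Longrightarrow> closed (leray_M \<gamma>)"
  unfolding leray_M_def by (intro closed_Collect_eq continuous_on_powr' continuous_intros) auto

text \<open>The truncation vanishes at \<open>\<alpha> = 0\<close>, so the defining identity of the \<open>k\<close>-th space holds at every point and not only
  almost everywhere.\<close>
lemma lift_truncate_in_core:
  assumes g: "\<gamma> > 0" and meas: "measurable2 G"
    and bound: "\<And>s \<alpha>. cmod (truncate n G s \<alpha>) \<le> B" and fin: "energy r G < \<infinity>"
  shows "lift_radial k (truncate n G) \<in> L2k_core \<gamma> r (int k)"
proof -
  let ?f = "lift_radial k (truncate n G)" and ?N = "real (Suc n)"
  let ?K = "{\<zeta> \<in> leray_M \<gamma>. \<bar>Re (snd \<zeta>)\<bar> \<le> ?N \<and> 1 / ?N \<le> cmod (fst \<zeta>) \<and> cmod (fst \<zeta>) \<le> ?N}"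
  note tm = truncate_measurable[OF meas, of n]
  have "(L2_norm (leray_mu \<gamma> r) ?f)\<^sup>2 < top"
  proof -
    have "energy r (truncate n G) < \<infinity>"
      using energy_mono[of "truncate n G" G r] norm_truncate_le fin by (meson le_less_trans)
    then show ?thesis unfolding L2_norm_lift_radial[OF tm] by (simp add: ennreal_mult_less_top)
  qed
  then have "L2_norm (leray_mu \<gamma> r) ?f < top"
    by (auto simp: power2_eq_square ennreal_mult_less_top less_top)
  moreover have "?f \<in> borel_measurable (leray_mu \<gamma> r)"
    unfolding measurable_leray_mu_iff by (rule measurable_restrict_space1[OF lift_radial_measurable[OF tm]])
  ultimately have L2: "?f \<in> L2_space (leray_mu \<gamma> r)" by (simp add: L2_space_def)
  have F: "?f \<zeta> = fourier_coeff \<gamma> (int k) ?f (Re (snd \<zeta>)) (cmod (fst \<zeta>)) * cis (of_int (int k) * Arg (fst \<zeta>))" for \<zeta>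
  proof (cases "fst \<zeta> = 0")
    case False
    then show ?thesis by (simp add: fourier_coeff_lift_radial sgn_power_eq_cis) (simp add: lift_radial_def sgn_power_eq_cis)
  next
    case True
    have t0: "truncate n G s 0 = 0" for s by (simp add: truncate_def)
    have "fourier_coeff \<gamma> (int k) ?f s 0 = 0" for s
      by (simp add: fourier_coeff_def leray_param_def lift_radial_def t0)
    then show ?thesis using True by (simp add: lift_radial_def t0)
  qed
  have L2k: "?f \<in> L2k_space \<gamma> r (int k)"
    unfolding L2k_space_def mem_Collect_eq by (intro conjI L2 AE_I2 F)
  have bd: "bounded (?f ` leray_M \<gamma>)"
    unfolding bounded_iff
  proof (intro exI ballI)
    fix x assume "x \<in> ?f ` leray_M \<gamma>"
    then obtain \<zeta> where x: "x = ?f \<zeta>" by blast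
    have "cmod (sgn (fst \<zeta>) ^ k) \<le> 1" by (simp add: norm_power norm_sgn power_le_one)
    then have "cmod (?f \<zeta>) \<le> cmod (truncate n G (Re (snd \<zeta>)) (cmod (fst \<zeta>)))"
      unfolding lift_radial_def norm_mult by (simp add: mult_left_le)
    then show "norm x \<le> B" unfolding x using bound order_trans by blast
  qed
  have K: "compact ?K"
    unfolding compact_eq_bounded_closed
  proof
    have "?K = leray_M \<gamma> \<inter> {\<zeta>. \<bar>Re (snd \<zeta>)\<bar> \<le> ?N} \<inter> {\<zeta>. 1 / ?N \<le> cmod (fst \<zeta>)} \<inter> {\<zeta>. cmod (fst \<zeta>) \<le> ?N}" by blast
    also have "closed \<dots>"
      by (intro closed_Int leray_M_closed g closed_Collect_le continuous_intros)
    finally show "closed ?K" .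
    show "bounded ?K"
    proof (rule boundedI)
      fix \<zeta> assume z: "\<zeta> \<in> ?K"
      have "norm \<zeta> \<le> cmod (fst \<zeta>) + cmod (snd \<zeta>)"
        using norm_Pair_le[of "fst \<zeta>" "snd \<zeta>"] by simp
      also have "cmod (snd \<zeta>) \<le> \<bar>Re (snd \<zeta>)\<bar> + \<bar>Im (snd \<zeta>)\<bar>" by (rule cmod_le)
      also have "Im (snd \<zeta>) = cmod (fst \<zeta>) powr \<gamma>" using z by (simp add: leray_M_def)
      also have "\<bar>cmod (fst \<zeta>) powr \<gamma>\<bar> \<le> ?N powr \<gamma>"
        using z g by (simp add: powr_mono2)
      finally show "norm \<zeta> \<le> ?N + (?N + ?N powr \<gamma>)" using z by auto
    qed
  qed
  have sub: "?K \<subseteq> {\<zeta> \<in> leray_M \<gamma>. fst \<zeta> \<noteq> 0}"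
  proof -
    have "1 / ?N > 0" by simp
    then show ?thesis by (auto simp del: of_nat_Suc)
  qed
  have z: "\<forall>\<zeta> \<in> leray_M \<gamma> - ?K. ?f \<zeta> = 0"
    by (auto simp: lift_radial_def truncate_def simp del: of_nat_Suc)
  show ?thesis
    unfolding L2k_core_def mem_Collect_eq using L2k bd K sub z by blast
qed

text \<open>The upper bound is \<open>energy_leray_op_le\<close>.  For the lower bound, with \<open>S\<close> the operator norm and \<open>F\<close> the extremal
  function, the truncations give \<open>energy (L F) \<le> liminf (energy (L F\<^sub>n)) \<le> S\<^sup>2 energy F\<close>, and the left-hand side is
  \<open>leray_normsq \<gamma> r k * energy F\<close> with \<open>0 < energy F < \<infinity>\<close>.\<close>
lemma leray_k_norm_eq:
  assumes g: "\<gamma> > 1" and p: "p_exp \<gamma> r k > 0" and q: "q_exp \<gamma> r k > 0"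
  shows "leray_k_norm \<gamma> r k = ennreal (sqrt (leray_normsq \<gamma> r k))"
proof (rule antisym)
  let ?N = "ennreal (sqrt (leray_normsq \<gamma> r k))" and ?S = "leray_k_norm \<gamma> r k"
  let ?L = "L2_norm (leray_mu \<gamma> r)"
  have N2: "?N\<^sup>2 = ennreal (leray_normsq \<gamma> r k)"
    using leray_normsq_nonneg[OF p q] by (simp add: ennreal_power)
  have le: "?L (leray_k \<gamma> k f) \<le> ?N * ?L f" if "f \<in> L2k_core \<gamma> r (int k)" for f
    by (rule ennreal_power2_le_imp_le) (use L2_norm_leray_k_le[OF g p q that] in \<open>simp only: power_mult_distrib N2\<close>)
  show "?S \<le> ?N"
    unfolding leray_k_norm_def
  proof (rule SUP_least)
    fix f assume f: "f \<in> {f \<in> L2k_core \<gamma> r (int k). ?L f \<noteq> 0}"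
    then have "?L f \<noteq> 0" "?L f \<noteq> top" using L2k_core_measurable(2)[of f \<gamma> r "int k"] by auto
    then show "?L (leray_k \<gamma> k f) / ?L f \<le> ?N"
      using le[of f] f by (simp add: ennreal_divide_le_iff)
  qed
  let ?F = "test_fn \<gamma> r k"
  note Fm = test_fn_measurable[OF g p q] and Fint = test_fn_density_integrable[OF g p q]
  let ?f = "\<lambda>n. lift_radial k (truncate n ?F)"
  have core: "?f n \<in> L2k_core \<gamma> r (int k)" for n
  proof -
    let ?N = "real (Suc n)" and ?x = "(\<gamma> - 1) * (real k + 1) - r"
    have "compact ((\<lambda>\<alpha>. \<alpha> powr ?x) ` {1 / ?N..?N})"
      by (intro compact_continuous_image continuous_intros) auto
    then obtain C where C: "\<forall>x\<in>(\<lambda>\<alpha>. \<alpha> powr ?x) ` {1 / ?N..?N}. norm x \<le> C"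
      using compact_imp_bounded bounded_iff by metis
    have bound: "cmod (truncate n ?F s \<alpha>) \<le> \<bar>C\<bar>" for s \<alpha>
    proof (cases "\<bar>s\<bar> \<le> ?N \<and> 1 / ?N \<le> \<alpha> \<and> \<alpha> \<le> ?N")
      case True
      then have a: "\<alpha> powr ?x \<le> C" using C by auto
      have "cmod (?F s \<alpha>) \<le> (\<alpha> powr ?x * exp (- (1 * ((\<gamma> - 1) * \<alpha> powr \<gamma>)))) * inverse (1 + s\<^sup>2)"
        by (rule norm_test_fn_le[OF g p q])
      also have "\<dots> \<le> (\<alpha> powr ?x * 1) * 1"
        using g by (intro mult_mono mult_nonneg_nonneg) (auto simp: inverse_le_1_iff)
      finally show ?thesis using a True by (simp add: truncate_def)
    next
      case False
      then have "truncate n ?F s \<alpha> = 0" unfolding truncate_def by (rule if_not_P)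
      then show ?thesis by simp
    qed
    show ?thesis
      by (rule lift_truncate_in_core[OF _ Fm bound test_fn_energy_finite[OF g p q]]) (use g in simp)
  qed
  \<comment> \<open>Functions of norm zero are excluded from the supremum; for them the upper bound gives \<open>0 \<le> 0\<close>.\<close>
  have ratio: "?L (leray_k \<gamma> k (?f n)) \<le> ?S * ?L (?f n)" for n
  proof (cases "?L (?f n) = 0")
    case True
    then show ?thesis using le[OF core[of n]] by simp
  next
    case False
    then have "?L (leray_k \<gamma> k (?f n)) / ?L (?f n) \<le> ?S"
      unfolding leray_k_norm_def using core by (intro SUP_upper) auto
    moreover have "?L (?f n) \<noteq> top" using L2k_core_measurable(2)[OF core[of n]] by simp
    ultimately show ?thesis using False
      by (simp add: ennreal_divide_le_iff)
  qed
  have "energy r (leray_op \<gamma> k (truncate n ?F)) \<le> ?S\<^sup>2 * energy r ?F" for n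
  proof -
    note tm = truncate_measurable[OF Fm, of n]
    note lm = measurable_restrict_space1[OF lift_radial_measurable[OF tm, of k], of "leray_M \<gamma>"]
    have "leray_op \<gamma> k (radial_part \<gamma> k (?f n)) = leray_op \<gamma> k (truncate n ?F)"
      by (rule leray_op_cong) (simp add: radial_part_def fourier_coeff_lift_radial)
    then have "ennreal (2 * pi) * energy r (leray_op \<gamma> k (truncate n ?F)) = (?L (leray_k \<gamma> k (?f n)))\<^sup>2"
      using L2_norm_leray_k[OF lm, of r k] by simp
    also have "\<dots> \<le> (?S * ?L (?f n))\<^sup>2"
      by (intro power_mono ratio) simp
    also have "\<dots> = ?S\<^sup>2 * (ennreal (2 * pi) * energy r (truncate n ?F))"
      by (simp only: power_mult_distrib L2_norm_lift_radial[OF tm])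
    also have "\<dots> \<le> ?S\<^sup>2 * (ennreal (2 * pi) * energy r ?F)"
      by (intro mult_left_mono energy_mono norm_truncate_le) simp_all
    also have "\<dots> = ennreal (2 * pi) * (?S\<^sup>2 * energy r ?F)" by (simp only: mult_ac)
    finally show ?thesis by (subst (asm) ennreal_mult_le_mult_iff) auto
  qed
  then have "liminf (\<lambda>n. energy r (leray_op \<gamma> k (truncate n ?F))) \<le> liminf (\<lambda>n::nat. ?S\<^sup>2 * energy r ?F)"
    by (intro Liminf_mono always_eventually allI)
  then have "ennreal (leray_normsq \<gamma> r k) * energy r ?F \<le> ?S\<^sup>2 * energy r ?F"
    using energy_leray_op_le_liminf[OF g Fint Fm, of r] unfolding test_fn_extremal[OF g p q] by (simp add: Liminf_const)
  then have "energy r ?F * ?N\<^sup>2 \<le> energy r ?F * ?S\<^sup>2"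
    by (simp only: N2 mult.commute)
  then have "?N\<^sup>2 \<le> ?S\<^sup>2"
    using test_fn_energy_pos[OF g p q] test_fn_energy_finite[OF g p q] by (subst (asm) ennreal_mult_le_mult_iff) auto
  then show "?N \<le> ?S" by (rule ennreal_power2_le_imp_le)
qed

theorem theorem1p11:
  fixes \<gamma> r :: real
  assumes "\<gamma> > 1"
  shows "leray_HF_norm \<gamma> r = ennreal (sqrt (\<gamma> / (2 * sqrt (\<gamma> - 1))))"
proof -
  have p: "eventually (\<lambda>k. p_exp \<gamma> r k > 0) sequentially"
    using assms unfolding p_exp_def by real_asymp
  have q: "eventually (\<lambda>k. q_exp \<gamma> r k > 0) sequentially"
  proof -
    have e: "q_exp \<gamma> r k = (2 * (\<gamma> - 1) * real k + (2 * \<gamma> - r - 1)) / \<gamma>" for k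
      using assms by (simp add: q_exp_def p_exp_def field_simps)
    have "2 * (\<gamma> - 1) > 0" using assms by simp
    then show ?thesis using assms unfolding e by real_asymp
  qed
  have "(\<lambda>k. leray_normsq \<gamma> r k) \<longlonglongrightarrow> \<gamma> / (2 * sqrt (\<gamma> - 1))"
  proof -
    have "leray_normsq \<gamma> r k = (\<gamma> ^ Suc k / (fact (Suc k - 1) * 2 ^ Suc k))\<^sup>2 *
       ((\<gamma> - 1) powr (- (2 * real (Suc k) - (2 * real (Suc k) + (r - 1)) / \<gamma>)) * Gamma ((2 * real (Suc k) + (r - 1)) / \<gamma>) *
        Gamma (2 * real (Suc k) - (2 * real (Suc k) + (r - 1)) / \<gamma>))" for k
    proof -
      have "p_exp \<gamma> r k = (2 * real (Suc k) + (r - 1)) / \<gamma>" by (simp add: p_exp_def)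
      then show ?thesis by (simp add: leray_normsq_def q_exp_def add.commute)
    qed
    then show ?thesis using LIMSEQ_Suc[OF Gamma_Stirling_limit[OF assms, of "r - 1"]] by simp
  qed
  then have lim: "(\<lambda>k. ennreal (sqrt (leray_normsq \<gamma> r k))) \<longlonglongrightarrow> ennreal (sqrt (\<gamma> / (2 * sqrt (\<gamma> - 1))))"
    by (intro tendsto_ennrealI tendsto_real_sqrt)
  have "eventually (\<lambda>k. ennreal (sqrt (leray_normsq \<gamma> r k)) = leray_k_norm \<gamma> r k) sequentially"
    using p q by eventually_elim (simp add: leray_k_norm_eq[OF assms])
  with lim have "(\<lambda>k. leray_k_norm \<gamma> r k) \<longlonglongrightarrow> ennreal (sqrt (\<gamma> / (2 * sqrt (\<gamma> - 1))))"
    by (rule Lim_transform_eventually)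
  then show ?thesis
    unfolding leray_HF_norm_def by (intro lim_imp_Limsup) auto
qed

end
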